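(* For every $c\ge 0$ the limit $$\lim_{n\to\infty}\frac{\mathrm{GLP}(n,c)}{n}\equiv f(c)$$ exists with high probability. That is, there exists a number $f(c)\ge 0$ such that for every $\epsilon>0$ $$\mathbb P\Big\{\Big|\frac{\mathrm{GLP}(n,c)}{n}-f(c)\Big|>\epsilon\Big\}\to 0\qquad\text{as } n\to\infty .$$
   Context: Fix an integer $K\ge 1$, reals $B^1_x\le B^2_x$, and a nonempty finite collection $\mathcal C$ of linear constraints $\sum_{k=1}^K a_{rk}y_k\le b_r$, $r=1,\dots,|\mathcal C|$, in $K$ variables $y_1,\dots,y_K$, where $a_{rk},b_r$ are arbitrary fixed reals. Fix constants $w_x\ge 0$, $w_\psi>0$ and a probability distribution with bounded support $[-B_w,B_w]$. For $c\ge 0$ and a large integer $n$ put $m=cn$ (with the convention $m=\lfloor cn\rfloor$). A random instance with variables $x_1,\dots,x_n,\psi_1,\dots,\psi_m$ is generated as follows: independently for each $j=1,\dots,m$, choose an ordered $K$-tuple $(i_1,\dots,i_K)$ of indices uniformly at random from $\{1,\dots,n\}$ (either always with replacement or always without replacement; the statement is meant for either convention), choose $r\in\{1,\dots,|\mathcal C|\}$ uniformly at random, and choose $W_j$ from the given distribution, all independently; the constraint $C_j$ is $$C_j:\quad \sum_{k=1}^K a_{rk}x_{i_k}\le b_r+W_j+\psi_j .$$ $\mathrm{GLP}(n,c)$ denotes the (random) optimal value of the linear program: minimize $w_x\sum_{i=1}^n x_i+w_\psi\sum_{j=1}^m\psi_j$ subject to $C_1,\dots,C_m$, $x_i\in[B^1_x,B^2_x]$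 for all $i$, and $\psi_j\ge 0$ for all $j$.
   Formalization: The limit is proved for all parameters, but f(c) ≥ 0 is asserted only when w_x = 0 or B^1_x ≥ 0, since otherwise it fails: at c = 0, f(0) = w_x B^1_x, which is negative when w_x > 0 and B^1_x < 0. *)

theory Defs
  imports "HOL-Probability.Probability"
begin

text \<open>
  Variables \<open>x\<close>, slacks \<open>\<psi>\<close>, constraint templates and positions within a template are all
  indexed from 0. The family of templates is given by \<open>a r k\<close> and \<open>b r\<close> for \<open>r < R\<close>, \<open>k < K\<close>.
  A generated constraint is a triple of its list of variable indices, its template \<open>r\<close> and its
  noise term \<open>W\<close>.
\<close>

type_synonym glp_constraint = "nat list \<times> nat \<times> real"

text \<open>\<open>repl\<close> selects sampling with (\<open>True\<close>) or without (\<open>False\<close>) replacement.\<close>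

definition index_tuples :: "bool \<Rightarrow> nat \<Rightarrow> nat \<Rightarrow> nat list set" where
  "index_tuples repl K n =
     {idx. length idx = K \<and> set idx \<subseteq> {..<n} \<and> (repl \<or> distinct idx)}"

text \<open>
  If \<open>index_tuples repl K n\<close> is empty, which is only possible for \<open>n < K\<close>, the distribution of
  the index tuple is an unspecified probability distribution.
\<close>

definition constraint_measure ::
    "bool \<Rightarrow> nat \<Rightarrow> nat \<Rightarrow> real measure \<Rightarrow> nat \<Rightarrow> glp_constraint measure" where
  "constraint_measure repl K R \<mu> n =
     measure_pmf (pmf_of_set (index_tuples repl K n)) \<Otimes>\<^sub>M
       (measure_pmf (pmf_of_set {..<R}) \<Otimes>\<^sub>M \<mu>)"

definition instance_measure ::
    "bool \<Rightarrow> nat \<Rightarrow> nat \<Rightarrow> real measure \<Rightarrow> nat \<Rightarrow> nat \<Rightarrow> (nat \<Rightarrow> glp_constraint) measure" where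
  "instance_measure repl K R \<mu> n m =
     (\<Pi>\<^sub>M j\<in>{..<m}. constraint_measure repl K R \<mu> n)"

definition glp_feasible ::
    "nat \<Rightarrow> (nat \<Rightarrow> nat \<Rightarrow> real) \<Rightarrow> (nat \<Rightarrow> real) \<Rightarrow> real \<Rightarrow> real \<Rightarrow> nat \<Rightarrow> nat \<Rightarrow>
     (nat \<Rightarrow> glp_constraint) \<Rightarrow> (nat \<Rightarrow> real) \<Rightarrow> (nat \<Rightarrow> real) \<Rightarrow> bool" where
  "glp_feasible K a b B1 B2 n m C x \<psi> \<longleftrightarrow>
     (\<forall>i<n. x i \<in> {B1..B2}) \<and>
     (\<forall>j<m. 0 \<le> \<psi> j) \<and>
     (\<forall>j<m. case C j of (idx, r, W) \<Rightarrow>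
        (\<Sum>k<K. a r k * x (idx ! k)) \<le> b r + W + \<psi> j)"

text \<open>
  For \<open>B1 \<le> B2\<close>, \<open>wx \<ge> 0\<close>, \<open>w\<psi> \<ge> 0\<close> and index tuples in range, the set below is nonempty (take
  all \<open>\<psi> j\<close> large) and bounded below by \<open>wx * n * B1\<close>, so \<open>Inf\<close> is the true infimum.
\<close>

definition GLP ::
    "nat \<Rightarrow> (nat \<Rightarrow> nat \<Rightarrow> real) \<Rightarrow> (nat \<Rightarrow> real) \<Rightarrow> real \<Rightarrow> real \<Rightarrow> real \<Rightarrow> real \<Rightarrow> nat \<Rightarrow> nat \<Rightarrow>
     (nat \<Rightarrow> glp_constraint) \<Rightarrow> real" where
  "GLP K a b B1 B2 wx w\<psi> n m C =
     Inf {wx * (\<Sum>i<n. x i) + w\<psi> * (\<Sum>j<m. \<psi> j) | x \<psi>. glp_feasible K a b B1 B2 n m C x \<psi>}"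

end

theory Submission
  imports Defs
begin

text \<open>
  Eliminating the slacks turns the linear program into the minimisation of a convex, Lipschitz
  function \<open>F\<close> of \<open>x\<close> over a box: a linear term plus one penalty per constraint. Convexity is what
  makes the limit exist. Projected subgradient descent finds a near-optimal point of \<open>F\<close> in a number
  of rounds that depends only on the desired accuracy and not on the size of the instance, and the
  value of a coordinate after \<open>t\<close> rounds depends only on the constraints within distance \<open>t\<close> of
  that variable. So the optimum per variable is approximated, uniformly in \<open>n\<close>, by the mean of a
  local statistic, and local statistics of a sparse random hypergraph converge because its
  neighbourhoods do.

  The step size at a variable is divided by one plus its degree. In the norm weighted by these
  numbers the error of the descent is then controlled by the sum of all degrees, which is known
  exactly, instead of by the largest degree, which is unbounded (\<open>descent_regret\<close>, \<open>descent_near_optimal\<close>).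

  The convergence of local statistics (\<open>local_limit\<close>) is shown without any reference to limit trees,
  by induction on the radius. The expectation over \<open>m\<close> independent constraints is the \<open>m\<close>-th power
  of an averaging operator that acts on functions of a multiset of constraints. Split this operator
  into the part that touches a given finite set of variables and the part that avoids it; the two
  parts commute, and the binomial theorem decomposes the expectation according to the number \<open>q\<close> of
  touching constraints (\<open>adjoin_binomial\<close>). Each such term converges as \<open>n\<close> grows: up to a
  vanishing fraction, the touching constraints bring in distinct new variables, which may be renamed
  to fixed ones (\<open>tendsto_adjoin_touching\<close>), and once the touching constraints are fixed, round
  \<open>t + 1\<close> at the given variables is a function of round \<open>t\<close> at a larger finite set. Terms with large
  \<open>q\<close> are bounded by an exponential series, so that the sum converges by Tannery's theorem.

  This makes the expected optimum per variable converge (\<open>mean_limit\<close>). One constraint changes the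
  optimum by a bounded amount, so an Efron-Stein bound (\<open>avg_variance_le\<close>) and Chebyshev's
  inequality turn this into convergence in probability (\<open>concentration\<close>).

  All this is done for noise with finitely many values, where expectations are finite sums. Rounding
  the noise down to multiples of \<open>\<delta>\<close> changes the optimum by at most \<open>w\<psi> * m * \<delta>\<close>
  (\<open>GLP_near_optimum\<close>), and \<open>integral_PiM_eq_avg\<close> identifies the law of the rounded instance with the
  averaging operator. The limits for different \<open>\<delta>\<close> are compatible and have a common limit
  (\<open>ex_common_limit\<close>).
\<close>

section \<open>Averaging over random constraints\<close>

type_synonym 's con = "nat list \<times> 's"

text \<open>
  A constraint consists of \<open>K\<close> variables and a label from the finite set \<open>S\<close>, drawn with the weights
  \<open>p\<close>; for the linear program a label is a template together with a rounded noise value.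
\<close>

locale sparse_model =
  fixes K :: nat and repl :: bool and S :: "'s set" and p :: "'s \<Rightarrow> real"
  assumes K_pos: "K \<ge> 1"
    and finite_S: "finite S"
    and p_nonneg: "\<And>s. s \<in> S \<Longrightarrow> p s \<ge> 0"
    and sum_p: "(\<Sum>s\<in>S. p s) = 1"
begin

definition tuples :: "nat set \<Rightarrow> nat list set" where
  "tuples V = {idx. length idx = K \<and> set idx \<subseteq> V \<and> (repl \<or> distinct idx)}"

text \<open>
  Left unnormalised, so that the operators for disjoint sets of index tuples add up.
\<close>

definition adjoin :: "nat list set \<Rightarrow> ('s con multiset \<Rightarrow> real) \<Rightarrow> 's con multiset \<Rightarrow> real" where
  "adjoin J H M = (\<Sum>idx\<in>J. \<Sum>s\<in>S. p s * H (add_mset (idx, s) M))"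

text \<open>
  Conditional expectation given the constraints present so far: \<open>(avg V ^^ m) H Q\<close> is the expectation of
  \<open>H\<close> on the system that consists of the planted constraints \<open>Q\<close> and \<open>m\<close> independent random
  constraints on the variables \<open>V\<close>.
\<close>

definition avg :: "nat set \<Rightarrow> ('s con multiset \<Rightarrow> real) \<Rightarrow> 's con multiset \<Rightarrow> real" where
  "avg V H M = adjoin (tuples V) H M / real (card (tuples V))"

lemma finite_tuples [simp]: "finite V \<Longrightarrow> finite (tuples V)"
  unfolding tuples_def
  by (rule finite_subset[OF _ finite_lists_length_eq[of V K]]) auto

lemma tuples_mono: "V \<subseteq> W \<Longrightarrow> tuples V \<subseteq> tuples W"
  by (auto simp: tuples_def)

lemma adjoin_Un: "finite I \<Longrightarrow> finite J \<Longrightarrow> I \<inter> J = {} \<Longrightarrow>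
    adjoin (I \<union> J) H M = adjoin I H M + adjoin J H M"
  by (simp add: adjoin_def sum.union_disjoint)

lemma adjoin_cong: "J = J' \<Longrightarrow> (\<And>M. G M = H M) \<Longrightarrow> adjoin J G M = adjoin J' H M"
  by (simp add: adjoin_def)

lemma adjoin_sum: "adjoin J (\<lambda>M. \<Sum>i\<in>A. c i * H i M) M = (\<Sum>i\<in>A. c i * adjoin J (H i) M)"
proof -
  have "(\<Sum>idx\<in>J. \<Sum>s\<in>S. p s * (\<Sum>i\<in>A. c i * H i (add_mset (idx, s) M)))
      = (\<Sum>idx\<in>J. \<Sum>s\<in>S. \<Sum>i\<in>A. c i * (p s * H i (add_mset (idx, s) M)))"
    by (simp add: sum_distrib_left algebra_simps)
  also have "\<dots> = (\<Sum>idx\<in>J. \<Sum>i\<in>A. \<Sum>s\<in>S. c i * (p s * H i (add_mset (idx, s) M)))"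
    by (intro sum.cong refl sum.swap)
  also have "\<dots> = (\<Sum>i\<in>A. \<Sum>idx\<in>J. \<Sum>s\<in>S. c i * (p s * H i (add_mset (idx, s) M)))"
    by (rule sum.swap)
  finally show ?thesis
    by (simp add: adjoin_def sum_distrib_left)
qed

lemma adjoin_cmult: "adjoin J (\<lambda>M. c * H M) M = c * adjoin J H M"
  using adjoin_sum[of J "\<lambda>_. c" "\<lambda>_. H" "{()}" M] by simp

lemma adjoin_commute: "adjoin I (adjoin J H) M = adjoin J (adjoin I H) M"
proof -
  have "adjoin I (adjoin J H) M
      = (\<Sum>i\<in>I. \<Sum>s\<in>S. \<Sum>j\<in>J. \<Sum>t\<in>S. p s * p t * H (add_mset (j, t) (add_mset (i, s) M)))"
    by (simp add: adjoin_def sum_distrib_left mult.assoc)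
  also have "\<dots> = (\<Sum>i\<in>I. \<Sum>j\<in>J. \<Sum>s\<in>S. \<Sum>t\<in>S. p s * p t * H (add_mset (j, t) (add_mset (i, s) M)))"
    by (intro sum.cong refl sum.swap)
  also have "\<dots> = (\<Sum>j\<in>J. \<Sum>i\<in>I. \<Sum>s\<in>S. \<Sum>t\<in>S. p s * p t * H (add_mset (j, t) (add_mset (i, s) M)))"
    by (rule sum.swap)
  also have "\<dots> = (\<Sum>j\<in>J. \<Sum>i\<in>I. \<Sum>t\<in>S. \<Sum>s\<in>S. p s * p t * H (add_mset (j, t) (add_mset (i, s) M)))"
    by (intro sum.cong refl sum.swap)
  also have "\<dots> = (\<Sum>j\<in>J. \<Sum>t\<in>S. \<Sum>i\<in>I. \<Sum>s\<in>S. p s * p t * H (add_mset (j, t) (add_mset (i, s) M)))"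
    by (intro sum.cong refl sum.swap)
  also have "\<dots> = adjoin J (adjoin I H) M"
    by (simp add: adjoin_def sum_distrib_left mult_ac add_mset_commute)
  finally show ?thesis .
qed

lemma adjoin_commute_funpow: "adjoin J ((adjoin I ^^ q) H) = (adjoin I ^^ q) (adjoin J H)"
proof (induction q)
  case (Suc q)
  have "adjoin J ((adjoin I ^^ Suc q) H) = adjoin I (adjoin J ((adjoin I ^^ q) H))"
    using adjoin_commute by (intro ext) simp
  then show ?case using Suc by simp
qed simp

text \<open>
  Pascal's rule, in the form needed for the binomial theorem below.
\<close>

lemma sum_binomial_Pascal:
  fixes g :: "nat \<Rightarrow> nat \<Rightarrow> real"
  shows "(\<Sum>q\<le>m. real (m choose q) * g (Suc q) (m - q)) + (\<Sum>q\<le>m. real (m choose q) * g q (Suc (m - q)))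
    = (\<Sum>q\<le>Suc m. real (Suc m choose q) * g q (Suc m - q))"
proof -
  have "(\<Sum>q\<le>Suc m. real (Suc m choose q) * g q (Suc m - q))
      = g 0 (Suc m) + (\<Sum>q\<le>m. real (Suc m choose Suc q) * g (Suc q) (m - q))"
    by (subst sum.atMost_Suc_shift) simp
  also have "\<dots> = g 0 (Suc m) + (\<Sum>q\<le>m. real (m choose q) * g (Suc q) (m - q))
      + (\<Sum>q\<le>m. real (m choose Suc q) * g (Suc q) (m - q))"
    by (simp add: sum.distrib algebra_simps)
  also have "g 0 (Suc m) + (\<Sum>q\<le>m. real (m choose Suc q) * g (Suc q) (m - q))
      = (\<Sum>q\<le>Suc m. real (m choose q) * g q (Suc m - q))"
    by (subst sum.atMost_Suc_shift) simp
  then have "g 0 (Suc m) + (\<Sum>q\<le>m. real (m choose q) * g (Suc q) (m - q))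
      + (\<Sum>q\<le>m. real (m choose Suc q) * g (Suc q) (m - q))
     = (\<Sum>q\<le>m. real (m choose q) * g (Suc q) (m - q)) + (\<Sum>q\<le>Suc m. real (m choose q) * g q (Suc m - q))"
    by simp
  also have "(\<Sum>q\<le>Suc m. real (m choose q) * g q (Suc m - q)) = (\<Sum>q\<le>m. real (m choose q) * g q (Suc (m - q)))"
    by (simp add: Suc_diff_le)
  finally show ?thesis by simp
qed

text \<open>
  Commuting operators obey the binomial theorem. In probabilistic terms, \<open>q\<close> counts the constraints
  that fall into \<open>I\<close>; by symmetry these may be taken to come first.
\<close>

lemma adjoin_binomial:
  assumes "finite I" "finite J" "I \<inter> J = {}"
  shows "(adjoin (I \<union> J) ^^ m) H M =
    (\<Sum>q\<le>m. real (m choose q) * (adjoin I ^^ q) ((adjoin J ^^ (m - q)) H) M)"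
proof (induction m arbitrary: M)
  case (Suc m)
  define X where "X = (\<lambda>M. \<Sum>q\<le>m. real (m choose q) * (adjoin I ^^ q) ((adjoin J ^^ (m - q)) H) M)"
  have "(adjoin (I \<union> J) ^^ Suc m) H M = adjoin (I \<union> J) X M"
    using Suc.IH by (auto simp: X_def intro!: adjoin_cong)
  also have "\<dots> = adjoin I X M + adjoin J X M"
    using assms by (rule adjoin_Un)
  also have "adjoin I X M = (\<Sum>q\<le>m. real (m choose q) * (adjoin I ^^ Suc q) ((adjoin J ^^ (m - q)) H) M)"
    unfolding X_def by (subst adjoin_sum) simp
  also have "adjoin J X M = (\<Sum>q\<le>m. real (m choose q) * (adjoin I ^^ q) ((adjoin J ^^ Suc (m - q)) H) M)"
    unfolding X_def by (subst adjoin_sum) (simp add: adjoin_commute_funpow)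
  finally show ?case
    by (simp only: sum_binomial_Pascal[of m "\<lambda>q r. (adjoin I ^^ q) ((adjoin J ^^ r) H) M"])
qed simp

lemma avg_cong: "(\<And>M. G M = H M) \<Longrightarrow> avg V G M = avg V H M"
  by (simp add: avg_def adjoin_def)

lemma avg_eq: "avg V = (\<lambda>H M. (1 / real (card (tuples V))) * adjoin (tuples V) H M)"
  by (intro ext) (simp add: avg_def)

lemma scaled_adjoin_funpow:
  "((\<lambda>H M. c * adjoin J H M) ^^ m) H M = c ^ m * (adjoin J ^^ m) H M"
proof (induction m arbitrary: M)
  case (Suc m)
  have "((\<lambda>H M. c * adjoin J H M) ^^ Suc m) H M
     = c * adjoin J (\<lambda>M. c ^ m * (adjoin J ^^ m) H M) M"
    using Suc.IH by (auto intro!: adjoin_cong)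
  then show ?case by (simp add: adjoin_cmult)
qed simp

lemma avg_funpow: "(avg V ^^ m) H M = (adjoin (tuples V) ^^ m) H M / real (card (tuples V)) ^ m"
  unfolding avg_eq scaled_adjoin_funpow by (simp add: power_one_over)

lemma adjoin_funpow_cmult: "(adjoin J ^^ m) (\<lambda>M. c * H M) M = c * (adjoin J ^^ m) H M"
proof (induction m arbitrary: M)
  case (Suc m)
  have "(adjoin J ^^ Suc m) (\<lambda>M. c * H M) M = adjoin J (\<lambda>M. c * (adjoin J ^^ m) H M) M"
    using Suc.IH by (auto intro!: adjoin_cong)
  then show ?case by (simp add: adjoin_cmult)
qed simp

lemma avg_funpow_sum:
  "(avg V ^^ m) (\<lambda>M. \<Sum>i\<in>A. c i * H i M) M = (\<Sum>i\<in>A. c i * (avg V ^^ m) (H i) M)"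
proof (induction m arbitrary: M)
  case (Suc m)
  have "(avg V ^^ Suc m) (\<lambda>M. \<Sum>i\<in>A. c i * H i M) M = avg V (\<lambda>M. \<Sum>i\<in>A. c i * (avg V ^^ m) (H i) M) M"
    using Suc.IH by (auto intro!: avg_cong)
  also have "\<dots> = (\<Sum>i\<in>A. c i * avg V ((avg V ^^ m) (H i)) M)"
    by (simp add: avg_def adjoin_sum sum_divide_distrib)
  finally show ?case by simp
qed simp

lemma avg_funpow_cmult: "(avg V ^^ m) (\<lambda>M. c * H M) M = c * (avg V ^^ m) H M"
  using avg_funpow_sum[of m V "\<lambda>_. c" "\<lambda>_. H" "{()}" M] by simp

lemma avg_funpow_add: "(avg V ^^ m) (\<lambda>M. G M + H M) M = (avg V ^^ m) G M + (avg V ^^ m) H M"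
  using avg_funpow_sum[of m V "\<lambda>_. 1" "\<lambda>b. if b then G else H" UNIV M]
  by (simp add: UNIV_bool add.commute)

lemma avg_const: "finite V \<Longrightarrow> tuples V \<noteq> {} \<Longrightarrow> avg V (\<lambda>_. c) M = c"
  by (simp add: avg_def adjoin_def sum_distrib_right[symmetric] sum_p)

lemma avg_funpow_const: "finite V \<Longrightarrow> tuples V \<noteq> {} \<Longrightarrow> (avg V ^^ m) (\<lambda>_. c) M = c"
proof (induction m arbitrary: M)
  case (Suc m)
  then have "(avg V ^^ Suc m) (\<lambda>_. c) M = avg V (\<lambda>_. c) M"
    by (auto intro!: avg_cong)
  with Suc show ?case by (simp add: avg_const)
qed simp

lemma adjoin_mono:
  assumes "\<And>idx s. idx \<in> J \<Longrightarrow> s \<in> S \<Longrightarrow> G (add_mset (idx, s) M) \<le> H (add_mset (idx, s) M)"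
  shows "adjoin J G M \<le> adjoin J H M"
  unfolding adjoin_def by (intro sum_mono mult_left_mono assms p_nonneg)

lemma adjoin_funpow_mono:
  assumes step: "\<And>M idx s. P M \<Longrightarrow> idx \<in> J \<Longrightarrow> s \<in> S \<Longrightarrow> P (add_mset (idx, s) M)"
    and le: "\<And>M. P M \<Longrightarrow> G M \<le> H M" and "P M"
  shows "(adjoin J ^^ m) G M \<le> (adjoin J ^^ m) H M"
  using \<open>P M\<close>
proof (induction m arbitrary: M)
  case (Suc m)
  then show ?case by (auto intro!: adjoin_mono intro: step)
qed (use le in auto)

text \<open>
  The predicate \<open>P\<close> restricts the comparison to systems that can arise, such as well-formed ones, since
  bounds on functionals usually fail for arbitrary multisets of constraints.
\<close>

lemma avg_funpow_mono:
  assumes "\<And>M idx s. P M \<Longrightarrow> idx \<in> tuples V \<Longrightarrow> s \<in> S \<Longrightarrow> P (add_mset (idx, s) M)"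
    and "\<And>M. P M \<Longrightarrow> G M \<le> H M" and "P M"
  shows "(avg V ^^ m) G M \<le> (avg V ^^ m) H M"
  unfolding avg_funpow using adjoin_funpow_mono[where P = P, OF assms] by (intro divide_right_mono) auto

lemma avg_funpow_cong:
  assumes "\<And>M idx s. P M \<Longrightarrow> idx \<in> tuples V \<Longrightarrow> s \<in> S \<Longrightarrow> P (add_mset (idx, s) M)"
    and "\<And>M. P M \<Longrightarrow> G M = H M" and "P M"
  shows "(avg V ^^ m) G M = (avg V ^^ m) H M"
  using avg_funpow_mono[where P = P, OF assms(1) _ assms(3), where G = G and H = H and m = m] 
    avg_funpow_mono[where P = P, OF assms(1) _ assms(3), where G = H and H = G and m = m] assms(2) by force

lemma abs_adjoin_le:
  assumes "finite J" "\<And>M. \<bar>H M\<bar> \<le> B"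
  shows "\<bar>adjoin J H M\<bar> \<le> real (card J) * B"
proof -
  have "adjoin J H M \<le> adjoin J (\<lambda>_. B) M" "adjoin J (\<lambda>_. - B) M \<le> adjoin J H M"
    using assms(2) by (auto intro!: adjoin_mono simp: abs_le_iff minus_le_iff)
  then show ?thesis
    by (simp add: adjoin_def sum_distrib_right[symmetric] sum_p sum_negf)
qed

lemma abs_adjoin_funpow_le:
  assumes "finite J" "\<And>M. \<bar>H M\<bar> \<le> B"
  shows "\<bar>(adjoin J ^^ m) H M\<bar> \<le> real (card J) ^ m * B"
proof (induction m arbitrary: M)
  case (Suc m)
  then show ?case using abs_adjoin_le[OF assms(1), of "(adjoin J ^^ m) H"] by (simp add: mult.assoc)
qed (use assms in auto)

lemma abs_avg_funpow_le:
  assumes "finite V" "\<And>M. \<bar>H M\<bar> \<le> B"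
  shows "\<bar>(avg V ^^ m) H M\<bar> \<le> B"
proof -
  have B: "B \<ge> 0" using assms(2)[of "{#}"] by linarith
  have "\<bar>(avg V ^^ m) H M\<bar> = \<bar>(adjoin (tuples V) ^^ m) H M\<bar> / real (card (tuples V)) ^ m"
    by (simp add: avg_funpow)
  also have "\<dots> \<le> real (card (tuples V)) ^ m * B / real (card (tuples V)) ^ m"
    using abs_adjoin_funpow_le[of "tuples V" H B m M] assms by (intro divide_right_mono) auto
  also have "\<dots> \<le> B" using B by simp
  finally show ?thesis .
qed

text \<open>
  Linearity and exchangeability: a sum over all constraints reduces to one distinguished constraint,
  which is either planted already or one of the \<open>m\<close> random ones and can then be planted first.
\<close>

lemma avg_funpow_sum_mset:
  "(avg V ^^ m) (\<lambda>M. \<Sum>C\<in>#M. \<Psi> C M) Q =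
    (\<Sum>C\<in>#Q. (avg V ^^ m) (\<Psi> C) Q)
    + real m / real (card (tuples V)) *
      (\<Sum>idx\<in>tuples V. \<Sum>s\<in>S. p s * (avg V ^^ (m - 1)) (\<Psi> (idx, s)) (add_mset (idx, s) Q))"
proof (induction m arbitrary: Q)
  case (Suc m)
  define T where "T = tuples V"
  define t where "t = real (card T)"
  define A where "A = (\<lambda>m C. (avg V ^^ m) (\<Psi> C))"
  have shift: "avg V (\<lambda>Q'. A m C Q') = A (Suc m) C" for C
    by (simp add: A_def)
  have planted: "(\<Sum>i\<in>T. \<Sum>s\<in>S. p s * (\<Sum>C\<in>#Q. A m C (add_mset (i, s) Q))) / t = (\<Sum>C\<in>#Q'. A (Suc m) C Q)"
    if "Q' = Q" for Q'
  proof -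
    have "(\<Sum>i\<in>T. \<Sum>s\<in>S. p s * (\<Sum>C\<in>#N. A m C (add_mset (i, s) Q))) / t = (\<Sum>C\<in>#N. A (Suc m) C Q)" for N
    proof (induction N)
      case (add C N)
      have "A (Suc m) C Q = (\<Sum>i\<in>T. \<Sum>s\<in>S. p s * A m C (add_mset (i, s) Q)) / t"
        by (simp flip: shift add: avg_def adjoin_def T_def t_def)
      with add show ?case
        by (simp add: sum.distrib algebra_simps add_divide_distrib)
    qed simp
    with that show ?thesis by simp
  qed
  have fresh: "(\<Sum>i\<in>T. \<Sum>s\<in>S. p s * ((real m / t) * (\<Sum>j\<in>T. \<Sum>r\<in>S. p r * A (m - 1) (j, r) (add_mset (j, r) (add_mset (i, s) Q))))) / t
     = (real m / t) * (\<Sum>j\<in>T. \<Sum>r\<in>S. p r * A m (j, r) (add_mset (j, r) Q))"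
  proof (cases m)
    case (Suc m')
    have "(\<Sum>i\<in>T. \<Sum>s\<in>S. p s * ((real m / t) * (\<Sum>j\<in>T. \<Sum>r\<in>S. p r * A m' (j, r) (add_mset (j, r) (add_mset (i, s) Q)))))
       = (\<Sum>i\<in>T. \<Sum>s\<in>S. \<Sum>j\<in>T. \<Sum>r\<in>S. (real m / t) * p r * (p s * A m' (j, r) (add_mset (i, s) (add_mset (j, r) Q))))"
      by (simp add: sum_distrib_left mult_ac add_mset_commute)
    also have "\<dots> = (\<Sum>i\<in>T. \<Sum>j\<in>T. \<Sum>s\<in>S. \<Sum>r\<in>S. (real m / t) * p r * (p s * A m' (j, r) (add_mset (i, s) (add_mset (j, r) Q))))"
      by (intro sum.cong refl sum.swap)
    also have "\<dots> = (\<Sum>j\<in>T. \<Sum>i\<in>T. \<Sum>s\<in>S. \<Sum>r\<in>S. (real m / t) * p r * (p s * A m' (j, r) (add_mset (i, s) (add_mset (j, r) Q))))"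
      by (rule sum.swap)
    also have "\<dots> = (\<Sum>j\<in>T. \<Sum>i\<in>T. \<Sum>r\<in>S. \<Sum>s\<in>S. (real m / t) * p r * (p s * A m' (j, r) (add_mset (i, s) (add_mset (j, r) Q))))"
      by (intro sum.cong refl sum.swap)
    also have "\<dots> = (\<Sum>j\<in>T. \<Sum>r\<in>S. \<Sum>i\<in>T. \<Sum>s\<in>S. (real m / t) * p r * (p s * A m' (j, r) (add_mset (i, s) (add_mset (j, r) Q))))"
      by (intro sum.cong refl sum.swap)
    also have "\<dots> = (\<Sum>j\<in>T. \<Sum>r\<in>S. (real m / t) * p r * adjoin T (A m' (j, r)) (add_mset (j, r) Q))"
      by (simp add: adjoin_def sum_distrib_left)
    finally have "(\<Sum>i\<in>T. \<Sum>s\<in>S. p s * ((real m / t) * (\<Sum>j\<in>T. \<Sum>r\<in>S. p r * A m' (j, r) (add_mset (j, r) (add_mset (i, s) Q))))) / t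
      = (\<Sum>j\<in>T. \<Sum>r\<in>S. (real m / t) * p r * (adjoin T (A m' (j, r)) (add_mset (j, r) Q) / t))"
      by (simp add: sum_divide_distrib)
    also have "\<dots> = (\<Sum>j\<in>T. \<Sum>r\<in>S. (real m / t) * p r * A m (j, r) (add_mset (j, r) Q))"
      by (simp add: Suc A_def avg_def T_def t_def)
    finally show ?thesis by (simp add: Suc sum_distrib_left mult.assoc)
  qed simp
  have "(avg V ^^ Suc m) (\<lambda>M. \<Sum>C\<in>#M. \<Psi> C M) Q
     = (\<Sum>i\<in>T. \<Sum>s\<in>S. p s * (avg V ^^ m) (\<lambda>M. \<Sum>C\<in>#M. \<Psi> C M) (add_mset (i, s) Q)) / t"
    by (simp add: avg_def adjoin_def T_def t_def)
  also have "\<dots> = (\<Sum>i\<in>T. \<Sum>s\<in>S. p s * A m (i, s) (add_mset (i, s) Q)) / t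
     + (\<Sum>i\<in>T. \<Sum>s\<in>S. p s * (\<Sum>C\<in>#Q. A m C (add_mset (i, s) Q))) / t
     + (\<Sum>i\<in>T. \<Sum>s\<in>S. p s * ((real m / t) * (\<Sum>j\<in>T. \<Sum>r\<in>S. p r * A (m - 1) (j, r) (add_mset (j, r) (add_mset (i, s) Q))))) / t"
    unfolding Suc.IH by (simp add: A_def T_def t_def sum.distrib add_divide_distrib distrib_left)
  also have "\<dots> = (\<Sum>C\<in>#Q. A (Suc m) C Q)
     + (real (Suc m) / t) * (\<Sum>j\<in>T. \<Sum>r\<in>S. p r * A m (j, r) (add_mset (j, r) Q))"
    unfolding fresh planted[OF refl] by (simp add: algebra_simps add_divide_distrib)
  finally show ?case by (simp add: A_def T_def t_def)
qed simp

text \<open>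
  An Efron-Stein bound. Conditioning on one constraint at a time, the variance grows in each step by
  at most the squared oscillation of a conditional expectation, and these expectations inherit the
  Lipschitz bound of \<open>H\<close>.
\<close>

lemma avg_variance_le:
  assumes V: "finite V" "tuples V \<noteq> {}"
    and step: "\<And>M idx s. P M \<Longrightarrow> idx \<in> tuples V \<Longrightarrow> s \<in> S \<Longrightarrow> P (add_mset (idx, s) M)"
    and lip: "\<And>M idx s. P M \<Longrightarrow> idx \<in> tuples V \<Longrightarrow> s \<in> S \<Longrightarrow> \<bar>H (add_mset (idx, s) M) - H M\<bar> \<le> B"
    and "P M"
  shows "(avg V ^^ m) (\<lambda>M. (H M)\<^sup>2) M - ((avg V ^^ m) H M)\<^sup>2 \<le> real m * B\<^sup>2"
  using \<open>P M\<close>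
proof (induction m arbitrary: M)
  case (Suc m)
  define G where "G = (avg V ^^ m) H"
  define c where "c = G M"
  have G_lip: "\<bar>G (add_mset (idx, s) M) - c\<bar> \<le> B" if "idx \<in> tuples V" "s \<in> S" for idx s
  proof -
    \<comment> \<open>A constraint may be adjoined before or after the \<open>m\<close> random ones.\<close>
    have shift: "(avg V ^^ m) (\<lambda>M. H (add_mset C M)) M = (avg V ^^ m) H (add_mset C M)" for C M
      by (induction m arbitrary: M) (simp_all add: avg_def adjoin_def add_mset_commute)
    have "(avg V ^^ m) (\<lambda>M. H (add_mset (idx, s) M)) M \<le> (avg V ^^ m) (\<lambda>M. H M + B) M"
      by (rule avg_funpow_mono[where P = P]) (use step lip that Suc.prems in \<open>force simp: abs_le_iff\<close>)+
    moreover have "(avg V ^^ m) H M \<le> (avg V ^^ m) (\<lambda>M. H (add_mset (idx, s) M) + B) M"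
      by (rule avg_funpow_mono[where P = P]) (use step lip that Suc.prems in \<open>force simp: abs_le_iff\<close>)+
    ultimately show ?thesis
      by (auto simp: G_def c_def shift avg_funpow_add avg_funpow_const[OF V])
  qed
  have "(avg V ^^ Suc m) (\<lambda>M. (H M)\<^sup>2) M \<le> avg V (\<lambda>M. (G M)\<^sup>2 + real m * B\<^sup>2) M"
    unfolding avg_def funpow.simps o_apply
  proof (intro divide_right_mono adjoin_mono)
    fix idx s assume "idx \<in> tuples V" "s \<in> S"
    then show "((\<lambda>H M. adjoin (tuples V) H M / real (card (tuples V))) ^^ m) (\<lambda>M. (H M)\<^sup>2) (add_mset (idx, s) M)
       \<le> (G (add_mset (idx, s) M))\<^sup>2 + real m * B\<^sup>2"
      using Suc.IH[OF step[OF Suc.prems]] by (fastforce simp: G_def avg_def[abs_def])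
  qed simp
  also have "\<dots> = avg V (\<lambda>M. (G M)\<^sup>2) M + real m * B\<^sup>2"
    using avg_funpow_add[of 1 V] avg_const[OF V] by simp
  \<comment> \<open>The variance of \<open>G\<close> is at most its second moment about the constant \<open>c\<close>.\<close>
  also have "avg V (\<lambda>M. (G M)\<^sup>2) M \<le> (avg V G M)\<^sup>2 + B\<^sup>2"
  proof -
    have "avg V (\<lambda>M. (G M - c)\<^sup>2) M \<le> avg V (\<lambda>M. B\<^sup>2) M"
      unfolding avg_def
    proof (intro divide_right_mono adjoin_mono)
      fix idx s assume "idx \<in> tuples V" "s \<in> S"
      then show "(G (add_mset (idx, s) M) - c)\<^sup>2 \<le> B\<^sup>2"
        using power_mono[OF G_lip, of idx s 2] by simp
    qed simp
    then have "avg V (\<lambda>M. (G M - c)\<^sup>2) M \<le> B\<^sup>2"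
      by (simp add: avg_const[OF V])
    moreover have "avg V (\<lambda>M. (G M - c)\<^sup>2) M = avg V (\<lambda>M. (G M)\<^sup>2) M - 2 * c * avg V G M + c\<^sup>2"
    proof -
      have "(\<lambda>M. (G M - c)\<^sup>2) = (\<lambda>M. (G M)\<^sup>2 + ((- 2 * c) * G M + c\<^sup>2))"
        by (intro ext) (simp add: power2_eq_square algebra_simps)
      then show ?thesis
        using avg_funpow_add[of 1 V "\<lambda>M. (G M)\<^sup>2" "\<lambda>M. (- 2 * c) * G M + c\<^sup>2" M]
          avg_funpow_add[of 1 V "\<lambda>M. (- 2 * c) * G M" "\<lambda>_. c\<^sup>2" M]
          avg_funpow_cmult[of 1 V "- 2 * c" G M]
        by (simp add: avg_const[OF V])
    qed
    moreover have "(avg V G M - c)\<^sup>2 \<ge> 0" by simp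
    ultimately show ?thesis by (simp add: power2_eq_square algebra_simps)
  qed
  finally show ?case by (simp add: G_def algebra_simps)
qed simp

end

section \<open>The sparse regime\<close>

text \<open>
  The number of variables tends to infinity and the number of constraints per variable to \<open>c\<close>. A
  filter is used instead of the sequence \<open>m = \<lfloor>c * n\<rfloor>\<close> because revealing \<open>q\<close> constraints leaves
  \<open>m - q\<close> of them, and the limits must agree for both.
\<close>

definition sparse_regime :: "real \<Rightarrow> (nat \<times> nat) filter" where
  "sparse_regime c = inf (filtercomap fst at_top) (filtercomap (\<lambda>z. real (snd z) / real (fst z)) (nhds c))"

lemma filterlim_fst_sparse: "filterlim fst at_top (sparse_regime c)"
  unfolding sparse_regime_def by (rule filterlim_mono[OF filterlim_filtercomap]) auto

lemma filterlim_real_fst_sparse: "filterlim (\<lambda>z. real (fst z)) at_top (sparse_regime c)"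
  using filterlim_compose[OF filterlim_real_sequentially filterlim_fst_sparse] .

lemma tendsto_ratio_sparse: "((\<lambda>z. real (snd z) / real (fst z)) \<longlongrightarrow> c) (sparse_regime c)"
  unfolding sparse_regime_def by (rule filterlim_mono[OF filterlim_filtercomap]) auto

lemma eventually_fst_sparse: "eventually (\<lambda>z. fst z \<ge> N) (sparse_regime c)"
  using filterlim_fst_sparse[of c] by (auto simp: filterlim_at_top)

lemma tendsto_const_over_fst: "((\<lambda>z. C / real (fst z)) \<longlongrightarrow> 0) (sparse_regime c)"
  by (rule tendsto_divide_0[OF tendsto_const filterlim_at_top_imp_at_infinity[OF filterlim_real_fst_sparse]])

lemma filterlim_sparse_shift: "filterlim (\<lambda>z. (fst z, snd z - q)) (sparse_regime c) (sparse_regime c)"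
proof -
  have "((\<lambda>z. real (snd z - q) / real (fst z)) \<longlongrightarrow> c) (sparse_regime c)"
  proof (rule tendsto_sandwich)
    show "((\<lambda>z. real (snd z) / real (fst z) - real q / real (fst z)) \<longlongrightarrow> c) (sparse_regime c)"
      using tendsto_diff[OF tendsto_ratio_sparse tendsto_const_over_fst] by simp
    show "((\<lambda>z. real (snd z) / real (fst z)) \<longlongrightarrow> c) (sparse_regime c)"
      by (rule tendsto_ratio_sparse)
  qed (auto simp: diff_divide_distrib[symmetric] intro!: divide_right_mono always_eventually)
  then show ?thesis
    unfolding sparse_regime_def[of c] filterlim_inf filterlim_filtercomap_iff
    by (simp add: o_def filterlim_fst_sparse sparse_regime_def[symmetric])
qed

lemma filterlim_sparse_floor:
  assumes "c \<ge> 0"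
  shows "filterlim (\<lambda>n. (n, nat \<lfloor>c * real n\<rfloor>)) (sparse_regime c) sequentially"
proof -
  have "(\<lambda>n. real (nat \<lfloor>c * real n\<rfloor>) / real n) \<longlonglongrightarrow> c"
  proof (rule tendsto_sandwich)
    show "(\<lambda>n. c - 1 / real n) \<longlonglongrightarrow> c"
      using tendsto_diff[OF tendsto_const lim_inverse_n'] by simp
    show "(\<lambda>n. c) \<longlonglongrightarrow> c" by simp
    show "\<forall>\<^sub>F n in sequentially. c - 1 / real n \<le> real (nat \<lfloor>c * real n\<rfloor>) / real n"
      using eventually_gt_at_top[of 0]
    proof eventually_elim
      case (elim n)
      have "c * real n - 1 \<le> real (nat \<lfloor>c * real n\<rfloor>)" by linarith
      then have "(c * real n - 1) / real n \<le> real (nat \<lfloor>c * real n\<rfloor>) / real n"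
        by (rule divide_right_mono) simp
      with elim show ?case by (simp add: diff_divide_distrib)
    qed
    show "\<forall>\<^sub>F n in sequentially. real (nat \<lfloor>c * real n\<rfloor>) / real n \<le> c"
      using eventually_gt_at_top[of 0]
    proof eventually_elim
      case (elim n)
      then show ?case using assms by (simp add: field_simps)
    qed
  qed
  then show ?thesis
    unfolding sparse_regime_def filterlim_inf filterlim_filtercomap_iff
    by (simp add: o_def filterlim_ident)
qed

lemma sparse_not_bot: "c \<ge> 0 \<Longrightarrow> sparse_regime c \<noteq> bot"
  using filterlim_sparse_floor[of c]
  by (metis filtermap_bot_iff bot.extremum_uniqueI filterlim_def sequentially_bot)

lemma tendsto_binomial_over_power:
  "((\<lambda>z. real (snd z choose q) / real (fst z) ^ q) \<longlongrightarrow> c ^ q / fact q) (sparse_regime c)"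
proof -
  have eq: "real (m choose q) / real n ^ q = (\<Prod>i<q. real m / real n - real i / real n) / fact q" for m n
  proof -
    have "real (m choose q) = (\<Prod>i<q. real m - real i) / fact q"
      by (simp add: binomial_gbinomial gbinomial_prod_rev lessThan_atLeast0)
    moreover have "(\<Prod>i<q. real m / real n - real i / real n) = (\<Prod>i<q. real m - real i) / real n ^ q"
      by (simp add: diff_divide_distrib[symmetric] prod_dividef)
    ultimately show ?thesis by simp
  qed
  have "((\<lambda>z. (\<Prod>i<q. real (snd z) / real (fst z) - real i / real (fst z)) / fact q)
      \<longlongrightarrow> (\<Prod>i<q. c - 0) / fact q) (sparse_regime c)"
    by (intro tendsto_intros tendsto_ratio_sparse tendsto_const_over_fst) simp
  then show ?thesis by (simp add: eq)
qed

text \<open>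
  The Poisson limit for the probability that none of \<open>m\<close> independent events of probability \<open>y\<close> occurs.
\<close>

lemma tendsto_one_minus_power:
  fixes y :: "'b \<Rightarrow> real" and m :: "'b \<Rightarrow> nat"
  assumes y: "(y \<longlongrightarrow> 0) F" and my: "((\<lambda>z. real (m z) * y z) \<longlongrightarrow> l) F"
    and nonneg: "\<And>z. y z \<ge> 0"
  shows "((\<lambda>z. (1 - y z) ^ m z) \<longlongrightarrow> exp (- l)) F"
proof -
  have small: "\<forall>\<^sub>F z in F. y z < 1/2"
    using order_tendstoD(2)[OF y, of "1/2"] by simp
  have "((\<lambda>z. real (m z) * ln (1 - y z)) \<longlongrightarrow> - l) F"
  proof (rule tendsto_sandwich)
    show "((\<lambda>z. - (real (m z) * y z) - 2 * ((real (m z) * y z) * y z)) \<longlongrightarrow> - l) F"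
      by (rule tendsto_eq_intros my y refl | simp)+
    show "((\<lambda>z. - (real (m z) * y z)) \<longlongrightarrow> - l) F"
      by (intro tendsto_intros my)
    show "\<forall>\<^sub>F z in F. - (real (m z) * y z) - 2 * ((real (m z) * y z) * y z) \<le> real (m z) * ln (1 - y z)"
      using small
    proof eventually_elim
      case (elim z)
      then show ?case
        using mult_left_mono[OF ln_one_minus_pos_lower_bound[of "y z"], of "real (m z)"] nonneg
        by (simp add: algebra_simps power2_eq_square)
    qed
    show "\<forall>\<^sub>F z in F. real (m z) * ln (1 - y z) \<le> - (real (m z) * y z)"
      using small
    proof eventually_elim
      case (elim z)
      then show ?case
        using mult_left_mono[OF ln_add_one_self_le_self2[of "- y z"], of "real (m z)"] by simp
    qed
  qed
  then have "((\<lambda>z. exp (real (m z) * ln (1 - y z))) \<longlongrightarrow> exp (- l)) F"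
    by (rule tendsto_exp)
  moreover have "\<forall>\<^sub>F z in F. exp (real (m z) * ln (1 - y z)) = (1 - y z) ^ m z"
    using small by eventually_elim (simp add: exp_of_nat_mult)
  ultimately show ?thesis
    by (rule Lim_transform_eventually)
qed

section \<open>Counting fresh and attached index tuples\<close>

text \<open>
  Lists of new variables, numbered from \<open>u\<close> on, that a revealed constraint brings in.
\<close>

definition fresh :: "nat \<Rightarrow> nat \<Rightarrow> nat \<Rightarrow> nat list set" where
  "fresh r u n = {vs. length vs = r \<and> distinct vs \<and> set vs \<subseteq> {u..<n}}"

lemma finite_fresh [simp]: "finite (fresh r u n)"
  unfolding fresh_def
  by (rule finite_subset[OF _ finite_lists_length_eq[of "{u..<n}" r]]) auto

lemma card_fresh_ge: "(n - u - r) ^ r \<le> card (fresh r u n)"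
proof (cases "r \<le> n - u")
  case True
  have "(n - u - r) ^ r = (\<Prod>i\<in>{n - u - r + 1..n - u}. n - u - r)"
    using diff_diff_cancel[OF True] by simp
  also have "\<dots> \<le> \<Prod>{n - u - r + 1..n - u}"
    by (intro prod_mono) auto
  also have "\<dots> = card (fresh r u n)"
    using True unfolding fresh_def by (subst card_lists_distinct_length_eq) auto
  finally show ?thesis .
next
  case False
  then show ?thesis by (cases r) auto
qed

text \<open>
  Sampling with and without replacement are treated alike: all counts of tuples that occur lie between
  the number of tuples with distinct entries and the number of all tuples, up to a bounded shift.
\<close>

lemma tendsto_card_ratio_squeeze:
  assumes "\<And>n. real ((n - u - r) ^ r) \<le> f n" "\<And>n. f n \<le> real n ^ r"
  shows "((\<lambda>z. f (fst z) / real (fst z) ^ r) \<longlongrightarrow> 1) (sparse_regime c)"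
proof (rule tendsto_sandwich)
  have "((\<lambda>z. (1 - real (u + r) / real (fst z)) ^ r) \<longlongrightarrow> (1 - 0) ^ r) (sparse_regime c)"
    by (intro tendsto_intros tendsto_const_over_fst)
  then show "((\<lambda>z. (1 - real (u + r) / real (fst z)) ^ r) \<longlongrightarrow> 1) (sparse_regime c)" by simp
  show "\<forall>\<^sub>F z in sparse_regime c. (1 - real (u + r) / real (fst z)) ^ r \<le> f (fst z) / real (fst z) ^ r"
    using eventually_fst_sparse[of "u + r + 1"]
  proof eventually_elim
    case (elim z)
    have "(1 - real (u + r) / real (fst z)) ^ r = real ((fst z - u - r) ^ r) / real (fst z) ^ r"
      using elim by (simp add: power_divide[symmetric] diff_divide_distrib of_nat_diff)
    also have "\<dots> \<le> f (fst z) / real (fst z) ^ r"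
      by (intro divide_right_mono assms) simp
    finally show ?case .
  qed
  show "\<forall>\<^sub>F z in sparse_regime c. f (fst z) / real (fst z) ^ r \<le> 1"
    using eventually_fst_sparse[of 1]
    by eventually_elim (use assms(2) in \<open>simp add: divide_le_eq\<close>)
qed simp

lemma card_fresh_le: "card (fresh r u n) \<le> n ^ r"
proof -
  have "card (fresh r u n) \<le> card {vs. set vs \<subseteq> {..<n} \<and> length vs = r}"
    unfolding fresh_def by (intro card_mono finite_lists_length_eq) auto
  then show ?thesis by (simp add: card_lists_length_eq)
qed

lemma tendsto_card_fresh: "((\<lambda>z. real (card (fresh r u (fst z))) / real (fst z) ^ r) \<longlongrightarrow> 1) (sparse_regime c)"
proof (rule tendsto_card_ratio_squeeze)
  show "real ((n - u - r) ^ r) \<le> real (card (fresh r u n))" for n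
    using card_fresh_ge by (simp only: of_nat_le_iff)
  show "real (card (fresh r u n)) \<le> real n ^ r" for n
    using card_fresh_le[of r u n] by (simp flip: of_nat_power)
qed

text \<open>
  Used to write a tuple as one distinguished entry \<open>v\<close> at position \<open>k\<close> together with the other entries.
\<close>

definition insert_at :: "nat \<Rightarrow> 'b \<Rightarrow> 'b list \<Rightarrow> 'b list" where
  "insert_at k v vs = take k vs @ v # drop k vs"

lemma length_insert_at [simp]: "length (insert_at k v vs) = Suc (length vs)"
  by (simp add: insert_at_def)

lemma set_insert_at [simp]: "set (insert_at k v vs) = insert v (set vs)"
proof -
  have "set (insert_at k v vs) = insert v (set (take k vs @ drop k vs))"
    by (auto simp: insert_at_def simp del: append_take_drop_id)
  then show ?thesis by simp
qed

lemma distinct_insert_at [simp]: "distinct (insert_at k v vs) \<longleftrightarrow> v \<notin> set vs \<and> distinct vs"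
proof -
  have "distinct (insert_at k v vs) \<longleftrightarrow> v \<notin> set (take k vs @ drop k vs) \<and> distinct (take k vs @ drop k vs)"
    by (auto simp: insert_at_def simp del: append_take_drop_id)
  then show ?thesis by simp
qed

lemma map_insert_at: "map f (insert_at k v vs) = insert_at k (f v) (map f vs)"
  by (simp add: insert_at_def take_map drop_map)

lemma insert_at_nth_remove: "k < length idx \<Longrightarrow> insert_at k (idx ! k) (take k idx @ drop (Suc k) idx) = idx"
  by (simp add: insert_at_def Cons_nth_drop_Suc min_def)

text \<open>
  The inserted entry is the only one below \<open>u\<close>, so that its position can be read off.
\<close>

lemma inj_insert_at:
  "inj_on (\<lambda>(k, v, vs). insert_at k v vs) ({..<K} \<times> {..<u} \<times> fresh (K - 1) u n)"
proof (rule inj_onI)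
  fix x y
  assume "x \<in> {..<K} \<times> {..<u} \<times> fresh (K - 1) u n" "y \<in> {..<K} \<times> {..<u} \<times> fresh (K - 1) u n"
    and eq': "(case x of (k, v, vs) \<Rightarrow> insert_at k v vs) = (case y of (k, v, vs) \<Rightarrow> insert_at k v vs)"
  then obtain k v vs k' v' vs' where xy: "x = (k, v, vs)" "y = (k', v', vs')"
    and *: "k < K" "v < u" "vs \<in> fresh (K - 1) u n" "k' < K" "v' < u" "vs' \<in> fresh (K - 1) u n"
    by auto
  from eq' have eq: "insert_at k v vs = insert_at k' v' vs'" by (simp add: xy)
  have nth: "insert_at k v vs ! i = (if i < k then vs ! i else if i = k then v else vs ! (i - 1))"
    if "k < K" "vs \<in> fresh (K - 1) u n" "i < K" for k v vs i
    using that by (auto simp: insert_at_def nth_append fresh_def min_def nth_Cons' intro: arg_cong[where f = "nth vs"])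
  have big: "vs ! i \<ge> u" if "vs \<in> fresh (K - 1) u n" "i < K - 1" for vs i
    using that nth_mem[of i vs] by (auto simp: fresh_def subset_iff)
  have "k = k'"
  proof (rule ccontr)
    assume "k \<noteq> k'"
    then have "insert_at k' v' vs' ! k \<ge> u"
      using * by (subst nth) (auto intro!: big)
    moreover have "insert_at k v vs ! k = v" using * by (subst nth) auto
    ultimately show False using eq * by simp
  qed
  with eq * show "x = y"
    by (auto simp: xy insert_at_def fresh_def) (metis append_take_drop_id length_take append_eq_append_conv)+
qed

context sparse_model
begin

lemma card_tuples_le: "card (tuples {d..<n}) \<le> n ^ K"
proof -
  have "card (tuples {d..<n}) \<le> card {vs. set vs \<subseteq> {..<n} \<and> length vs = K}"
    unfolding tuples_def by (intro card_mono finite_lists_length_eq) auto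
  then show ?thesis by (simp add: card_lists_length_eq)
qed

lemma fresh_subset_tuples: "fresh K d n \<subseteq> tuples {d..<n}"
  by (auto simp: fresh_def tuples_def)

lemma tendsto_card_tuples: "((\<lambda>z. real (card (tuples {d..<fst z})) / real (fst z) ^ K) \<longlongrightarrow> 1) (sparse_regime c)"
proof (rule tendsto_card_ratio_squeeze)
  show "real ((n - d - K) ^ K) \<le> real (card (tuples {d..<n}))" for n
    using order_trans[OF card_fresh_ge[of n d K] card_mono[OF _ fresh_subset_tuples[of d n]]]
    by (simp only: of_nat_le_iff finite_tuples finite_atLeastLessThan)
  show "real (card (tuples {d..<n})) \<le> real n ^ K" for n
    using card_tuples_le[of d n] by (simp flip: of_nat_power)
qed

lemma eventually_card_tuples_pos: "\<forall>\<^sub>F z in sparse_regime c. card (tuples {d..<fst z}) > 0"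
  using eventually_fst_sparse[of "d + K + 1"]
proof eventually_elim
  case (elim z)
  then have "0 < (fst z - d - K) ^ K" by simp
  also have "\<dots> \<le> card (tuples {d..<fst z})"
    using order_trans[OF card_fresh_ge[of "fst z" d K] card_mono[OF _ fresh_subset_tuples]] by simp
  finally show ?case .
qed

text \<open>
  With the variables below \<open>d\<close> no longer in use, these are the constraints that contain one of the
  variables \<open>d, ..., u - 1\<close>.
\<close>

definition touching :: "nat \<Rightarrow> nat \<Rightarrow> nat \<Rightarrow> nat list set" where
  "touching d u n = tuples {d..<n} - tuples {u..<n}"

lemma finite_touching [simp]: "finite (touching d u n)"
  by (simp add: touching_def)

lemma card_touching_le: "card (touching d u n) \<le> K * (u - d) * n ^ (K - 1)"
proof -
  let ?L = "{vs. set vs \<subseteq> {..<n} \<and> length vs = K - 1}"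
  have fin: "finite ?L" by (intro finite_lists_length_eq) simp
  have "touching d u n \<subseteq> (\<lambda>(k, v, vs). insert_at k v vs) ` ({..<K} \<times> {d..<u} \<times> ?L)"
  proof
    fix idx assume idx: "idx \<in> touching d u n"
    then have len: "length idx = K" and sub: "set idx \<subseteq> {d..<n}" by (auto simp: touching_def tuples_def)
    from idx have "\<not> set idx \<subseteq> {u..<n}" by (auto simp: touching_def tuples_def)
    with sub obtain k where k: "k < K" "idx ! k < u"
      by (force simp: in_set_conv_nth len subset_iff)
    moreover have "idx ! k \<ge> d" using subsetD[OF sub nth_mem[of k idx]] k len by simp
    moreover have "take k idx @ drop (Suc k) idx \<in> ?L"
      using k len sub by (auto dest: in_set_takeD in_set_dropD)
    ultimately show "idx \<in> (\<lambda>(k, v, vs). insert_at k v vs) ` ({..<K} \<times> {d..<u} \<times> ?L)"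
      using insert_at_nth_remove[of k idx] len
      by (intro image_eqI[where x = "(k, idx ! k, take k idx @ drop (Suc k) idx)"]) auto
  qed
  then have "card (touching d u n) \<le> card ({..<K} \<times> {d..<u} \<times> ?L)"
    by (rule surj_card_le[rotated]) (use fin in auto)
  then show ?thesis by (simp add: card_cartesian_product card_lists_length_eq)
qed

text \<open>
  The typical touching tuples: one old variable, and otherwise distinct variables from \<open>u'\<close> on.
\<close>

definition attachments :: "nat \<Rightarrow> nat \<Rightarrow> nat \<Rightarrow> nat \<Rightarrow> nat list set" where
  "attachments d u u' n = (\<lambda>(k, v, vs). insert_at k v vs) ` ({..<K} \<times> {d..<u} \<times> fresh (K - 1) u' n)"

lemma inj_attachments:
  assumes "u \<le> u'"
  shows "inj_on (\<lambda>(k, v, vs). insert_at k v vs) ({..<K} \<times> {d..<u} \<times> fresh (K - 1) u' n)"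
  by (rule inj_on_subset[OF inj_insert_at[of K u' n]]) (use assms in auto)

lemma card_attachments: "u \<le> u' \<Longrightarrow> card (attachments d u u' n) = K * (u - d) * card (fresh (K - 1) u' n)"
  unfolding attachments_def by (subst card_image[OF inj_attachments]) (auto simp: card_cartesian_product)

lemma attachments_subset:
  assumes "d \<le> u" "u \<le> u'" "u' \<le> n"
  shows "attachments d u u' n \<subseteq> touching d u n"
proof
  fix idx assume "idx \<in> attachments d u u' n"
  then obtain k v vs where idx: "idx = insert_at k v vs" and v: "d \<le> v" "v < u"
    and vs: "length vs = K - 1" "distinct vs" "\<And>w. w \<in> set vs \<Longrightarrow> u' \<le> w \<and> w < n"
    by (force simp: attachments_def fresh_def subset_iff)
  have "set idx \<subseteq> {d..<n}"
    using v assms by (auto simp: idx dest: vs(3))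
  moreover have "length idx = K" using K_pos vs(1) by (simp add: idx)
  moreover have "distinct idx" using v assms vs(2) by (auto simp: idx dest: vs(3))
  moreover have "\<not> set idx \<subseteq> {u..<n}" using v by (auto simp: idx)
  ultimately show "idx \<in> touching d u n" by (auto simp: touching_def tuples_def)
qed

text \<open>
  The trivial upper bound on the number of touching tuples and the number of attachments are
  asymptotically equal, so that all but a vanishing fraction of the touching tuples are attachments.
\<close>

lemma tendsto_touching_scaled:
  assumes "d \<le> u" "u \<le> u'"
  shows "((\<lambda>z. real (fst z) / real (card (tuples {d..<fst z})) * real (card (touching d u (fst z)))) \<longlongrightarrow> real (K * (u - d))) (sparse_regime c)"
    and "((\<lambda>z. real (fst z) / real (card (tuples {d..<fst z})) * real (card (attachments d u u' (fst z)))) \<longlongrightarrow> real (K * (u - d))) (sparse_regime c)"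
    and "((\<lambda>z. real (fst z) / real (card (tuples {d..<fst z})) * real (card (fresh (K - 1) u' (fst z)))) \<longlongrightarrow> 1) (sparse_regime c)"
proof -
  have att: "((\<lambda>z. real (card (attachments d u u' (fst z))) / real (fst z) ^ (K - 1)) \<longlongrightarrow> real (K * (u - d)) * 1) (sparse_regime c)"
    unfolding card_attachments[OF assms(2)] of_nat_mult times_divide_eq_right[symmetric]
    by (intro tendsto_intros tendsto_card_fresh)
  have touch: "((\<lambda>z. real (card (touching d u (fst z))) / real (fst z) ^ (K - 1)) \<longlongrightarrow> real (K * (u - d))) (sparse_regime c)"
  proof (rule tendsto_sandwich)
    show "((\<lambda>z. real (card (attachments d u u' (fst z))) / real (fst z) ^ (K - 1)) \<longlongrightarrow> real (K * (u - d))) (sparse_regime c)"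
      using att by simp
    show "\<forall>\<^sub>F z in sparse_regime c. real (card (attachments d u u' (fst z))) / real (fst z) ^ (K - 1)
        \<le> real (card (touching d u (fst z))) / real (fst z) ^ (K - 1)"
      using eventually_fst_sparse[of u']
    proof eventually_elim
      case (elim z)
      show ?case
        using card_mono[OF finite_touching attachments_subset[OF assms elim]]
        by (intro divide_right_mono) auto
    qed
    show "\<forall>\<^sub>F z in sparse_regime c. real (card (touching d u (fst z))) / real (fst z) ^ (K - 1) \<le> real (K * (u - d))"
      using eventually_fst_sparse[of 1]
    proof eventually_elim
      case (elim z)
      have "real (card (touching d u (fst z))) \<le> real (K * (u - d) * fst z ^ (K - 1))"
        using card_touching_le by (simp only: of_nat_le_iff)
      with elim show ?case by (simp add: divide_le_eq)
    qed
  qed simp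
  have rescale: "((\<lambda>z. real (fst z) / real (card (tuples {d..<fst z})) * f z) \<longlongrightarrow> l) (sparse_regime c)"
    if "((\<lambda>z. f z / real (fst z) ^ (K - 1)) \<longlongrightarrow> l) (sparse_regime c)" for f l
  proof (rule Lim_transform_eventually)
    show "((\<lambda>z. (f z / real (fst z) ^ (K - 1)) / (real (card (tuples {d..<fst z})) / real (fst z) ^ K)) \<longlongrightarrow> l) (sparse_regime c)"
      using tendsto_divide[OF that tendsto_card_tuples[of d]] by simp
    show "\<forall>\<^sub>F z in sparse_regime c. (f z / real (fst z) ^ (K - 1)) / (real (card (tuples {d..<fst z})) / real (fst z) ^ K)
        = real (fst z) / real (card (tuples {d..<fst z})) * f z"
      using eventually_fst_sparse[of 1]
    proof eventually_elim
      case (elim z)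
      have "real (fst z) ^ K = real (fst z) * real (fst z) ^ (K - 1)"
        using K_pos by (simp flip: power_Suc)
      with elim show ?case by simp
    qed
  qed
  show "((\<lambda>z. real (fst z) / real (card (tuples {d..<fst z})) * real (card (touching d u (fst z)))) \<longlongrightarrow> real (K * (u - d))) (sparse_regime c)"
    by (rule rescale[OF touch])
  show "((\<lambda>z. real (fst z) / real (card (tuples {d..<fst z})) * real (card (attachments d u u' (fst z)))) \<longlongrightarrow> real (K * (u - d))) (sparse_regime c)"
    using rescale[OF att] by simp
  show "((\<lambda>z. real (fst z) / real (card (tuples {d..<fst z})) * real (card (fresh (K - 1) u' (fst z)))) \<longlongrightarrow> 1) (sparse_regime c)"
    by (rule rescale[OF tendsto_card_fresh])
qed

end

section \<open>Relabelling\<close>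

definition relabel :: "(nat \<Rightarrow> nat) \<Rightarrow> 's con multiset \<Rightarrow> 's con multiset" where
  "relabel \<pi> = image_mset (map_prod (map \<pi>) id)"

lemma relabel_add_mset: "relabel \<pi> (add_mset (idx, s) M) = add_mset (map \<pi> idx, s) (relabel \<pi> M)"
  by (simp add: relabel_def)

definition variables_below :: "nat \<Rightarrow> 's con multiset \<Rightarrow> bool" where
  "variables_below u M \<longleftrightarrow> (\<forall>C\<in>#M. set (fst C) \<subseteq> {..<u})"

lemma variables_below_empty [simp]: "variables_below u {#}"
  by (simp add: variables_below_def)

lemma variables_below_add_mset [simp]:
  "variables_below u (add_mset C M) \<longleftrightarrow> set (fst C) \<subseteq> {..<u} \<and> variables_below u M"
  by (auto simp: variables_below_def)

lemma variables_below_mono: "variables_below u M \<Longrightarrow> u \<le> v \<Longrightarrow> variables_below v M"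
  by (force simp: variables_below_def)

lemma relabel_id_below:
  assumes "variables_below u M" "\<And>i. i < u \<Longrightarrow> \<pi> i = i"
  shows "relabel \<pi> M = M"
proof -
  have "map_prod (map \<pi>) id C = C" if "C \<in># M" for C
    using that assms by (cases C) (fastforce simp: variables_below_def intro!: map_idI)
  then show ?thesis unfolding relabel_def by (rule multiset.map_ident_strong)
qed

text \<open>
  Used to rename new variables to prescribed ones.
\<close>

lemma ex_permutes_map_eq:
  assumes "finite A" "distinct xs" "distinct ys" "length xs = length ys" "set xs \<subseteq> A" "set ys \<subseteq> A"
  shows "\<exists>\<pi>. \<pi> permutes A \<and> map \<pi> xs = ys"
proof -
  have "card (A - set xs) = card (A - set ys)"
    using assms by (simp add: card_Diff_subset distinct_card)
  then obtain g where g: "bij_betw g (A - set xs) (A - set ys)"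
    using finite_same_card_bij[of "A - set xs" "A - set ys"] assms(1) by auto
  define \<pi> where "\<pi> i = (if i \<in> set xs then ys ! (THE k. k < length xs \<and> xs ! k = i) else if i \<in> A then g i else i)" for i
  have nth: "\<pi> (xs ! k) = ys ! k" if "k < length xs" for k
  proof -
    have "(THE j. j < length xs \<and> xs ! j = xs ! k) = k"
      using that assms(2) by (auto simp: nth_eq_iff_index_eq)
    then show ?thesis using that by (simp add: \<pi>_def)
  qed
  have map: "map \<pi> xs = ys"
    using nth assms(4) by (intro nth_equalityI) auto
  have "\<pi> ` set xs = set ys" using map by (metis set_map)
  then have "bij_betw \<pi> (set xs) (set ys)"
    by (auto simp: bij_betw_def intro!: eq_card_imp_inj_on) (simp add: assms distinct_card)
  moreover have "bij_betw \<pi> (A - set xs) (A - set ys)"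
    using g by (subst bij_betw_cong[of _ _ g]) (auto simp: \<pi>_def)
  ultimately have "bij_betw \<pi> (set xs \<union> (A - set xs)) (set ys \<union> (A - set ys))"
    by (rule bij_betw_combine) auto
  moreover have "set xs \<union> (A - set xs) = A" "set ys \<union> (A - set ys) = A" using assms by auto
  ultimately have "\<pi> permutes A"
    using assms(5) by (intro bij_imp_permutes) (auto simp: \<pi>_def)
  with map show ?thesis by blast
qed

section \<open>Local algorithms\<close>

text \<open>
  The messages that a variable \<open>i\<close> receives from a constraint: the label, the position at which \<open>i\<close>
  occurs, and the current values of all variables of the constraint. A variable that occurs several
  times receives one message per occurrence.
\<close>

definition messages :: "nat \<Rightarrow> (nat \<Rightarrow> 'v) \<Rightarrow> 's con \<Rightarrow> ('s \<times> nat \<times> 'v list) multiset" where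
  "messages i x C = {#(snd C, k, map x (fst C)). k \<in># {#k \<in># mset [0..<length (fst C)]. fst C ! k = i#}#}"

definition inbox :: "nat \<Rightarrow> (nat \<Rightarrow> 'v) \<Rightarrow> 's con multiset \<Rightarrow> ('s \<times> nat \<times> 'v list) multiset" where
  "inbox i x M = (\<Sum>C\<in>#M. messages i x C)"

text \<open>
  A synchronous message-passing algorithm. All variables start in the state \<open>v0\<close> and follow the same
  rule \<open>upd\<close>, which makes the algorithm equivariant under renaming of variables (\<open>state_relabel\<close>).
\<close>

primrec state :: "('v \<Rightarrow> ('s \<times> nat \<times> 'v list) multiset \<Rightarrow> 'v) \<Rightarrow> 'v \<Rightarrow> nat \<Rightarrow> 's con multiset \<Rightarrow> nat \<Rightarrow> 'v" where
  "state upd v0 0 M i = v0"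
| "state upd v0 (Suc t) M i = upd (state upd v0 t M i) (inbox i (state upd v0 t M) M)"

lemma inbox_add_mset [simp]: "inbox i x (add_mset C M) = messages i x C + inbox i x M"
  by (simp add: inbox_def)

lemma inbox_empty [simp]: "inbox i x {#} = {#}"
  by (simp add: inbox_def)

lemma messages_relabel:
  assumes "inj \<pi>"
  shows "messages (\<pi> i) y (map \<pi> idx, s) = messages i (y \<circ> \<pi>) (idx, s)"
proof -
  have "{#k \<in># mset [0..<length idx]. map \<pi> idx ! k = \<pi> i#} = {#k \<in># mset [0..<length idx]. idx ! k = i#}"
    using assms by (intro filter_mset_cong refl) (auto simp: inj_eq)
  then show ?thesis by (simp add: messages_def)
qed

lemma inbox_relabel: "inj \<pi> \<Longrightarrow> inbox (\<pi> i) y (relabel \<pi> M) = inbox i (y \<circ> \<pi>) M"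
  by (induction M) (auto simp: relabel_add_mset messages_relabel relabel_def)

lemma state_relabel:
  assumes "inj \<pi>"
  shows "state upd v0 t (relabel \<pi> M) (\<pi> i) = state upd v0 t M i"
proof (induction t arbitrary: i)
  case (Suc t)
  have "state upd v0 t (relabel \<pi> M) \<circ> \<pi> = state upd v0 t M" using Suc by auto
  with Suc show ?case by (simp add: inbox_relabel[OF assms])
qed simp

lemma messages_cong:
  "(\<And>j. j \<in> set (fst C) \<Longrightarrow> x j = y j) \<Longrightarrow> messages i x C = messages i y C"
  by (simp add: messages_def cong: map_cong)

lemma messages_notin: "i \<notin> set (fst C) \<Longrightarrow> messages i x C = {#}"
  unfolding messages_def by (subst filter_mset_eq_mempty_iff[THEN iffD2]) auto

lemma inbox_cong_below:
  assumes "variables_below u Q" "\<And>j. j < u \<Longrightarrow> x j = y j"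
  shows "inbox i x Q = inbox i y Q"
  using assms(1)
  by (induction Q) (force intro!: messages_cong assms(2) arg_cong2[where f = "(+)"])+

context sparse_model
begin

lemma map_permutes_tuples:
  assumes "bij \<pi>" "\<pi> ` V = V"
  shows "map \<pi> ` tuples V = tuples V"
proof -
  have sub: "map \<pi> ` tuples V \<subseteq> tuples V" if "inj \<pi>" "\<pi> ` V = V" for \<pi>
    using that by (force simp: tuples_def distinct_map intro: inj_on_subset[OF that(1)])
  have inv: "map (inv \<pi>) ` tuples V \<subseteq> tuples V"
    using assms by (intro sub) (metis bij_imp_bij_inv bij_is_inj, metis bij_is_inj image_inv_f_f)
  have "idx \<in> map \<pi> ` tuples V" if "idx \<in> tuples V" for idx
  proof
    show "idx = map \<pi> (map (inv \<pi>) idx)"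
      using assms(1) by (simp add: o_def bij_is_surj surj_f_inv_f)
    show "map (inv \<pi>) idx \<in> tuples V" using inv that by blast
  qed
  then show ?thesis using sub[OF bij_is_inj[OF assms(1)] assms(2)] by blast
qed

lemma adjoin_relabel:
  assumes "inj \<pi>" "map \<pi> ` J = J"
  shows "adjoin J H (relabel \<pi> M) = adjoin J (\<lambda>M. H (relabel \<pi> M)) M"
proof -
  have "adjoin J H (relabel \<pi> M) = (\<Sum>idx\<in>map \<pi> ` J. \<Sum>s\<in>S. p s * H (add_mset (idx, s) (relabel \<pi> M)))"
    by (simp add: assms(2) adjoin_def)
  also have "\<dots> = adjoin J (\<lambda>M. H (relabel \<pi> M)) M"
    using assms(1) by (subst sum.reindex) (auto simp: adjoin_def relabel_add_mset intro: inj_on_subset)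
  finally show ?thesis .
qed

lemma adjoin_funpow_relabel:
  assumes "inj \<pi>" "map \<pi> ` J = J"
  shows "(adjoin J ^^ q) H (relabel \<pi> M) = (adjoin J ^^ q) (\<lambda>M. H (relabel \<pi> M)) M"
proof (induction q arbitrary: M)
  case (Suc q)
  then show ?case by (auto simp: adjoin_relabel[OF assms] intro!: adjoin_cong)
qed simp

lemma avg_funpow_relabel:
  assumes "bij \<pi>" "\<pi> ` V = V"
  shows "(avg V ^^ m) H (relabel \<pi> M) = (avg V ^^ m) (\<lambda>M. H (relabel \<pi> M)) M"
  unfolding avg_funpow
  using adjoin_funpow_relabel[OF bij_is_inj[OF assms(1)] map_permutes_tuples[OF assms]] by simp

text \<open>
  By invariance under renaming, it does not matter where the new variables of a constraint are placed,
  so that they may be taken to be the first unused ones.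
\<close>

lemma sum_fresh_invariant:
  assumes inv: "\<And>\<pi> M. \<pi> permutes {u..<n} \<Longrightarrow> X (relabel \<pi> M) = X M"
    and Q: "variables_below u Q" and n: "u + r \<le> n"
    and idx: "\<And>\<pi> vs. (\<And>i. i < u \<Longrightarrow> \<pi> i = i) \<Longrightarrow> map \<pi> (idx vs) = idx (map \<pi> vs)"
  shows "(\<Sum>vs\<in>fresh r u n. X (add_mset (idx vs, s) Q))
    = real (card (fresh r u n)) * X (add_mset (idx [u..<u + r], s) Q)"
proof -
  have "X (add_mset (idx vs, s) Q) = X (add_mset (idx [u..<u + r], s) Q)" if "vs \<in> fresh r u n" for vs
  proof -
    have "\<exists>\<pi>. \<pi> permutes {u..<n} \<and> map \<pi> [u..<u + r] = vs"
      using that n by (intro ex_permutes_map_eq) (auto simp: fresh_def)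
    then obtain \<pi> where \<pi>: "\<pi> permutes {u..<n}" "map \<pi> [u..<u + r] = vs"
      by blast
    have stays: "\<pi> i = i" if "i < u" for i
      using permutes_not_in[OF \<pi>(1)] that by simp
    have "relabel \<pi> (add_mset (idx [u..<u + r], s) Q) = add_mset (idx vs, s) Q"
      using idx[OF stays] relabel_id_below[OF Q stays] \<pi>(2) by (simp add: relabel_add_mset)
    then show ?thesis using inv[OF \<pi>(1)] by metis
  qed
  then show ?thesis by simp
qed

text \<open>
  Revealing one touching constraint. The scaling by \<open>n / card\<close> makes the number of touching tuples
  bounded. Attachments contribute finitely many limits, one for each position, old variable and label,
  since their new variables can be renamed; the remaining touching tuples are negligible.
\<close>

lemma tendsto_adjoin_touching:
  fixes X :: "nat \<times> nat \<Rightarrow> 's con multiset \<Rightarrow> real"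
  assumes du: "d \<le> u" "u \<le> u'" and Q: "variables_below u' Q"
    and bound: "\<forall>\<^sub>F z in sparse_regime c. \<forall>M. \<bar>X z M\<bar> \<le> B"
    and inv: "\<And>z \<pi> M. u' \<le> fst z \<Longrightarrow> \<pi> permutes {u'..<fst z} \<Longrightarrow> X z (relabel \<pi> M) = X z M"
    and conv: "\<And>k v s. k < K \<Longrightarrow> d \<le> v \<Longrightarrow> v < u \<Longrightarrow> s \<in> S \<Longrightarrow>
      \<exists>L. ((\<lambda>z. X z (add_mset (insert_at k v [u'..<u' + (K - 1)], s) Q)) \<longlongrightarrow> L) (sparse_regime c)"
  shows "\<exists>L. ((\<lambda>z. real (fst z) / real (card (tuples {d..<fst z})) * adjoin (touching d u (fst z)) (X z) Q) \<longlongrightarrow> L) (sparse_regime c)"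
proof -
  define a where "a z = real (fst z) / real (card (tuples {d..<fst z}))" for z :: "nat \<times> nat"
  have a_nonneg: "a z \<ge> 0" for z by (simp add: a_def)
  note scaled = tendsto_touching_scaled[OF du, folded a_def]
  obtain L where L: "\<And>k v s. k < K \<Longrightarrow> d \<le> v \<Longrightarrow> v < u \<Longrightarrow> s \<in> S \<Longrightarrow>
      ((\<lambda>z. X z (add_mset (insert_at k v [u'..<u' + (K - 1)], s) Q)) \<longlongrightarrow> L k v s) (sparse_regime c)"
    using conv by metis
  \<comment> \<open>The new variables are now in canonical position, so that the range of the sum does not grow with \<open>n\<close>.\<close>
  define G where "G z = (\<Sum>k<K. \<Sum>v\<in>{d..<u}. \<Sum>s\<in>S. p s * X z (add_mset (insert_at k v [u'..<u' + (K - 1)], s) Q))" for z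
  have G: "(G \<longlongrightarrow> (\<Sum>k<K. \<Sum>v\<in>{d..<u}. \<Sum>s\<in>S. p s * L k v s)) (sparse_regime c)"
    unfolding G_def by (intro tendsto_sum tendsto_mult tendsto_const L) auto
  have good: "adjoin (attachments d u u' (fst z)) (X z) Q = real (card (fresh (K - 1) u' (fst z))) * G z"
    if z: "u' + K \<le> fst z" for z
  proof -
    define Fr where "Fr = fresh (K - 1) u' (fst z)"
    have "adjoin (attachments d u u' (fst z)) (X z) Q
      = (\<Sum>(k, v, vs)\<in>{..<K} \<times> {d..<u} \<times> Fr. \<Sum>s\<in>S. p s * X z (add_mset (insert_at k v vs, s) Q))"
      unfolding adjoin_def attachments_def Fr_def
      by (subst sum.reindex[OF inj_attachments[OF du(2)]]) (simp add: case_prod_unfold)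
    also have "\<dots> = (\<Sum>k<K. \<Sum>v\<in>{d..<u}. \<Sum>vs\<in>Fr. \<Sum>s\<in>S. p s * X z (add_mset (insert_at k v vs, s) Q))"
      by (simp only: sum.cartesian_product[symmetric] prod.case)
    also have "\<dots> = (\<Sum>k<K. \<Sum>v\<in>{d..<u}. \<Sum>s\<in>S. \<Sum>vs\<in>Fr. p s * X z (add_mset (insert_at k v vs, s) Q))"
      by (intro sum.cong refl sum.swap)
    also have "\<dots> = (\<Sum>k<K. \<Sum>v\<in>{d..<u}. \<Sum>s\<in>S. p s * (real (card Fr) * X z (add_mset (insert_at k v [u'..<u' + (K - 1)], s) Q)))"
    proof (intro sum.cong refl)
      fix k v s assume v: "v \<in> {d..<u}"
      show "(\<Sum>vs\<in>Fr. p s * X z (add_mset (insert_at k v vs, s) Q))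
        = p s * (real (card Fr) * X z (add_mset (insert_at k v [u'..<u' + (K - 1)], s) Q))"
        unfolding sum_distrib_left[symmetric] Fr_def
        using sum_fresh_invariant[of u' "fst z" "X z" Q "K - 1" "insert_at k v" s] inv Q z v du
        by (simp add: map_insert_at)
    qed
    also have "\<dots> = real (card Fr) * G z"
      by (simp add: G_def sum_distrib_left mult_ac)
    finally show ?thesis by (simp add: Fr_def)
  qed
  have main: "((\<lambda>z. a z * adjoin (attachments d u u' (fst z)) (X z) Q) \<longlongrightarrow> 1 * (\<Sum>k<K. \<Sum>v\<in>{d..<u}. \<Sum>s\<in>S. p s * L k v s)) (sparse_regime c)"
  proof (rule Lim_transform_eventually)
    show "((\<lambda>z. a z * real (card (fresh (K - 1) u' (fst z))) * G z) \<longlongrightarrow> 1 * (\<Sum>k<K. \<Sum>v\<in>{d..<u}. \<Sum>s\<in>S. p s * L k v s)) (sparse_regime c)"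
      by (rule tendsto_mult[OF scaled(3) G])
    show "\<forall>\<^sub>F z in sparse_regime c. a z * real (card (fresh (K - 1) u' (fst z))) * G z = a z * adjoin (attachments d u u' (fst z)) (X z) Q"
      using eventually_fst_sparse[of "u' + K"] by eventually_elim (simp add: good)
  qed
  have rest: "((\<lambda>z. a z * adjoin (touching d u (fst z) - attachments d u u' (fst z)) (X z) Q) \<longlongrightarrow> 0) (sparse_regime c)"
  proof (rule Lim_null_comparison)
    show "((\<lambda>z. (a z * real (card (touching d u (fst z))) - a z * real (card (attachments d u u' (fst z)))) * B) \<longlongrightarrow> 0) (sparse_regime c)"
      using tendsto_mult[OF tendsto_diff[OF scaled(1,2)] tendsto_const[of B]] by simp
    show "\<forall>\<^sub>F z in sparse_regime c. norm (a z * adjoin (touching d u (fst z) - attachments d u u' (fst z)) (X z) Q)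
      \<le> (a z * real (card (touching d u (fst z))) - a z * real (card (attachments d u u' (fst z)))) * B"
      using eventually_fst_sparse[of u'] bound
    proof eventually_elim
      case (elim z)
      have sub: "attachments d u u' (fst z) \<subseteq> touching d u (fst z)"
        by (rule attachments_subset[OF du elim(1)])
      have "real (card (touching d u (fst z) - attachments d u u' (fst z)))
         = real (card (touching d u (fst z))) - real (card (attachments d u u' (fst z)))"
        using sub by (simp add: card_Diff_subset finite_subset[OF sub] of_nat_diff card_mono)
      then show ?case
        using abs_adjoin_le[of "touching d u (fst z) - attachments d u u' (fst z)" "X z" B Q] elim(2)
          mult_left_mono[OF _ a_nonneg[of z]]
        by (simp add: abs_mult a_nonneg right_diff_distrib[symmetric] mult.assoc)
    qed
  qed
  have "((\<lambda>z. a z * adjoin (touching d u (fst z)) (X z) Q) \<longlongrightarrow>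
     1 * (\<Sum>k<K. \<Sum>v\<in>{d..<u}. \<Sum>s\<in>S. p s * L k v s) + 0) (sparse_regime c)"
  proof (rule Lim_transform_eventually[OF tendsto_add[OF main rest]])
    show "\<forall>\<^sub>F z in sparse_regime c. a z * adjoin (attachments d u u' (fst z)) (X z) Q
       + a z * adjoin (touching d u (fst z) - attachments d u u' (fst z)) (X z) Q
      = a z * adjoin (touching d u (fst z)) (X z) Q"
      using eventually_fst_sparse[of u']
    proof eventually_elim
      case (elim z)
      have sub: "attachments d u u' (fst z) \<subseteq> touching d u (fst z)"
        by (rule attachments_subset[OF du elim])
      then have "touching d u (fst z) = attachments d u u' (fst z) \<union> (touching d u (fst z) - attachments d u u' (fst z))"
        by auto
      then have "adjoin (touching d u (fst z)) (X z) Q = adjoin (attachments d u u' (fst z)) (X z) Q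
         + adjoin (touching d u (fst z) - attachments d u u' (fst z)) (X z) Q"
        using adjoin_Un[of "attachments d u u' (fst z)" "touching d u (fst z) - attachments d u u' (fst z)" "X z" Q]
          finite_subset[OF sub] by simp
      then show ?case by (simp add: distrib_left)
    qed
  qed
  then show ?thesis unfolding a_def by blast
qed

end

lemma inbox_union: "inbox i x (M + N) = inbox i x M + inbox i x N"
  by (simp add: inbox_def)

lemma inbox_notin: "(\<And>C. C \<in># M \<Longrightarrow> i \<notin> set (fst C)) \<Longrightarrow> inbox i x M = {#}"
  by (induction M) (simp_all add: messages_notin)

context sparse_model
begin

section \<open>Convergence of local statistics\<close>

text \<open>
  The variables below \<open>d\<close> take part only in planted constraints, and the statistic \<open>h\<close> looks at all
  variables below \<open>u\<close>. The statement has to cover all \<open>d\<close>, \<open>u\<close>, \<open>Q\<close> and \<open>h\<close> at once, since the induction on the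
  radius \<open>t\<close> exhausts the variables below \<open>u\<close>, plants the constraints that touch them, and enlarges the
  observed set.
\<close>

lemma local_limit:
  fixes upd :: "'v \<Rightarrow> ('s \<times> nat \<times> 'v list) multiset \<Rightarrow> 'v" and h :: "'v list \<Rightarrow> real"
  assumes c: "c \<ge> 0" and du: "d \<le> u" and Q: "variables_below u Q" and hB: "\<And>xs. \<bar>h xs\<bar> \<le> B"
  shows "\<exists>L. ((\<lambda>z. (avg {d..<fst z} ^^ snd z) (\<lambda>M. h (map (state upd v0 t M) [0..<u])) Q) \<longlongrightarrow> L) (sparse_regime c)"
  using du Q hB
proof (induction t arbitrary: d u Q h)
  case 0
  have start: "state upd v0 0 M = (\<lambda>_. v0)" for M by (intro ext) simp
  have "\<forall>\<^sub>F z in sparse_regime c. h (map (\<lambda>_. v0) [0..<u])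
      = (avg {d..<fst z} ^^ snd z) (\<lambda>M. h (map (state upd v0 0 M) [0..<u])) Q"
    using eventually_card_tuples_pos[of d]
    unfolding start by eventually_elim (subst avg_funpow_const, auto simp: card_gt_0_iff)
  then show ?case
    by (intro exI) (rule Lim_transform_eventually[OF tendsto_const])
next
  case (Suc t)
  define H where "H M = h (map (state upd v0 (Suc t) M) [0..<u])" for M
  have HB: "\<bar>H M\<bar> \<le> B" for M by (simp only: H_def Suc.prems)
  have B: "B \<ge> 0" using HB[of "{#}"] by linarith
  have H_relabel: "H (relabel \<pi> M) = H M" if "\<pi> permutes {u'..<n}" "u \<le> u'" for \<pi> M u' n
  proof -
    have "map (state upd v0 (Suc t) (relabel \<pi> M)) [0..<u] = map (state upd v0 (Suc t) M) [0..<u]"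
    proof (rule map_cong[OF refl])
      fix i assume "i \<in> set [0..<u]"
      then have "\<pi> i = i" using permutes_not_in[OF that(1)] that(2) by simp
      then show "state upd v0 (Suc t) (relabel \<pi> M) i = state upd v0 (Suc t) M i"
        using state_relabel[OF bij_is_inj[OF permutes_bij[OF that(1)]]] by metis
    qed
    then show ?thesis by (simp only: H_def)
  qed
  define T where "T n = real (card (tuples {d..<n}))" for n
  define T' where "T' n = real (card (tuples {u..<n}))" for n
  define a where "a n = real n / T n" for n
  \<comment> \<open>The contribution of \<open>q\<close> touching constraints, up to the combinatorial weight.\<close>
  define Z where "Z q z = (\<lambda>M. a (fst z) ^ q * (adjoin (touching d u (fst z)) ^^ q) ((avg {u..<fst z} ^^ snd z) H) M)" for q z
  note touch_lim = tendsto_touching_scaled(1)[OF \<open>d \<le> u\<close> order_refl, folded T_def a_def]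
  have a_nonneg: "a n \<ge> 0" for n by (simp add: a_def T_def)
  have Z_bound: "\<bar>Z q z M\<bar> \<le> (a (fst z) * real (card (touching d u (fst z)))) ^ q * B" for q z M
  proof -
    have "\<bar>(adjoin (touching d u (fst z)) ^^ q) ((avg {u..<fst z} ^^ snd z) H) M\<bar>
       \<le> real (card (touching d u (fst z))) ^ q * B"
      by (intro abs_adjoin_funpow_le abs_avg_funpow_le HB) auto
    then show ?thesis
      using mult_left_mono[OF _ zero_le_power[OF a_nonneg]]
      by (fastforce simp: Z_def abs_mult a_nonneg power_mult_distrib mult.assoc)
  qed
  define D where "D = real (K * (u - d)) + 1"
  have D: "D > 0" by (simp add: D_def add_nonneg_pos)
  have touch_le: "\<forall>\<^sub>F z in sparse_regime c. a (fst z) * real (card (touching d u (fst z))) \<le> D"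
    by (rule eventually_mono[OF order_tendstoD(2)[OF touch_lim, of D]]) (auto simp: D_def)
  have Z_lim: "\<exists>L. ((\<lambda>z. Z q z Q') \<longlongrightarrow> L) (sparse_regime c)" if "u \<le> u'" "variables_below u' Q'" for q u' Q'
    using that
  proof (induction q arbitrary: u' Q')
    case 0
    \<comment> \<open>All constraints that touch a variable below \<open>u\<close> are planted in \<open>Q'\<close>, so one round can be computed from \<open>Q'\<close>.\<close>
    define h' where "h' xs = h (map (\<lambda>i. upd (xs ! i) (inbox i ((!) xs) Q')) [0..<u])" for xs :: "'v list"
    have "(avg {u..<n} ^^ m) H Q' = (avg {u..<n} ^^ m) (\<lambda>M. h' (map (state upd v0 t M) [0..<u'])) Q'" for n m
    proof (rule avg_funpow_cong[where P = "\<lambda>M. \<exists>M'. M = Q' + M' \<and> (\<forall>C\<in>#M'. set (fst C) \<subseteq> {u..<n})"])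
      fix M idx and s :: 's
      assume "\<exists>M'. M = Q' + M' \<and> (\<forall>C\<in>#M'. set (fst C) \<subseteq> {u..<n})" and idx: "idx \<in> tuples {u..<n}"
      then obtain M' where M': "M = Q' + M'" "\<forall>C\<in>#M'. set (fst C) \<subseteq> {u..<n}" by blast
      show "\<exists>M'. add_mset (idx, s) M = Q' + M' \<and> (\<forall>C\<in>#M'. set (fst C) \<subseteq> {u..<n})"
        using M' idx by (intro exI[of _ "add_mset (idx, s) M'"]) (auto simp: tuples_def)
    next
      fix M assume "\<exists>M'. M = Q' + M' \<and> (\<forall>C\<in>#M'. set (fst C) \<subseteq> {u..<n})"
      then obtain M' where M: "M = Q' + M'" and M': "\<And>C. C \<in># M' \<Longrightarrow> set (fst C) \<subseteq> {u..<n}" by blast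
      define xs where "xs = map (state upd v0 t M) [0..<u']"
      have xs: "xs ! j = state upd v0 t M j" if "j < u'" for j using that by (simp add: xs_def)
      have "state upd v0 (Suc t) M i = upd (xs ! i) (inbox i ((!) xs) Q')" if "i < u" for i
      proof -
        have "inbox i (state upd v0 t M) M = inbox i (state upd v0 t M) Q'"
          using M' that unfolding M by (subst inbox_union, subst inbox_notin) fastforce+
        also have "\<dots> = inbox i ((!) xs) Q'"
          by (rule inbox_cong_below[OF "0"(2)]) (simp add: xs)
        finally show ?thesis using that \<open>u \<le> u'\<close> by (simp add: xs)
      qed
      then show "H M = h' (map (state upd v0 t M) [0..<u'])"
        unfolding H_def h'_def xs_def[symmetric] by (intro arg_cong[where f = h] map_cong) auto
    qed (use exI[of _ "{#}"] in auto)
    then have "Z 0 z Q' = (avg {u..<fst z} ^^ snd z) (\<lambda>M. h' (map (state upd v0 t M) [0..<u'])) Q'" for z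
      by (simp add: Z_def)
    with Suc.IH[OF \<open>u \<le> u'\<close> "0"(2), of h'] show ?case
      using Suc.prems(3) by (simp add: h'_def)
  next
    case (Suc q)
    have "Z (Suc q) z Q' = real (fst z) / real (card (tuples {d..<fst z})) * adjoin (touching d u (fst z)) (Z q z) Q'" for z
      unfolding Z_def by (subst adjoin_cmult) (simp add: a_def T_def)
    moreover have "\<exists>L. ((\<lambda>z. real (fst z) / real (card (tuples {d..<fst z})) * adjoin (touching d u (fst z)) (Z q z) Q') \<longlongrightarrow> L) (sparse_regime c)"
    proof (rule tendsto_adjoin_touching[OF \<open>d \<le> u\<close> \<open>u \<le> u'\<close> Suc.prems(2)])
      show "\<forall>\<^sub>F z in sparse_regime c. \<forall>M. \<bar>Z q z M\<bar> \<le> D ^ q * B"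
        using touch_le
      proof eventually_elim
        case (elim z)
        have "(a (fst z) * real (card (touching d u (fst z)))) ^ q * B \<le> D ^ q * B"
          using elim by (intro mult_right_mono power_mono B) (auto simp: a_nonneg)
        then show ?case using Z_bound order_trans by blast
      qed
    next
      fix z :: "nat \<times> nat" and \<pi> M assume z: "u' \<le> fst z" and \<pi>: "\<pi> permutes {u'..<fst z}"
      have bij: "bij \<pi>" using permutes_bij[OF \<pi>] .
      have im: "\<pi> ` {v..<fst z} = {v..<fst z}" if "v \<le> u'" for v
        using that by (intro permutes_image permutes_subset[OF \<pi>]) auto
      have "map \<pi> ` touching d u (fst z) = touching d u (fst z)"
        using map_permutes_tuples[OF bij im, of d] map_permutes_tuples[OF bij im, of u] \<open>d \<le> u\<close> \<open>u \<le> u'\<close>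
        by (simp add: touching_def image_set_diff bij_is_inj[OF bij])
      moreover have "(avg {u..<fst z} ^^ snd z) H (relabel \<pi> M) = (avg {u..<fst z} ^^ snd z) H M" for M
        using H_relabel[OF \<pi> \<open>u \<le> u'\<close>] by (subst avg_funpow_relabel[OF bij im[OF \<open>u \<le> u'\<close>]]) simp
      ultimately show "Z q z (relabel \<pi> M) = Z q z M"
        by (simp add: Z_def adjoin_funpow_relabel[OF bij_is_inj[OF bij]])
    next
      fix k v s assume "v < u"
      show "\<exists>L. ((\<lambda>z. Z q z (add_mset (insert_at k v [u'..<u' + (K - 1)], s) Q')) \<longlongrightarrow> L) (sparse_regime c)"
      proof (rule Suc.IH[of "u' + (K - 1)"])
        show "variables_below (u' + (K - 1)) (add_mset (insert_at k v [u'..<u' + (K - 1)], s) Q')"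
          using \<open>v < u\<close> \<open>u \<le> u'\<close> variables_below_mono[OF Suc.prems(2)] by auto
      qed (use \<open>u \<le> u'\<close> in simp)
    qed
    ultimately show ?case by simp
  qed
  then obtain L where L: "\<And>q. ((\<lambda>z. Z q z Q) \<longlongrightarrow> L q) (sparse_regime c)"
    using Suc.prems(2) by (metis order_refl)
  \<comment> \<open>The probability that a random constraint avoids the variables \<open>d, ..., u - 1\<close>.\<close>
  define \<rho> where "\<rho> n = T' n / T n" for n
  define summand where "summand q z = real (snd z choose q) / real (fst z) ^ q * \<rho> (fst z) ^ (snd z - q) * Z q (fst z, snd z - q) Q" for q z
  have touch_card: "real (card (touching d u n)) = T n - T' n" for n
  proof -
    have "tuples {u..<n} \<subseteq> tuples {d..<n}" using \<open>d \<le> u\<close> by (intro tuples_mono) auto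
    then show ?thesis
      by (simp add: touching_def T_def T'_def card_Diff_subset finite_subset[of _ "tuples {d..<n}"] of_nat_diff card_mono)
  qed
  have \<rho>01: "0 \<le> \<rho> n" "\<rho> n \<le> 1" for n
    using touch_card[of n] by (auto simp: \<rho>_def T_def T'_def divide_le_eq)
  have expand: "\<forall>\<^sub>F z in sparse_regime c. (\<Sum>q. summand q z) = (avg {d..<fst z} ^^ snd z) H Q"
    using eventually_card_tuples_pos[of d] eventually_card_tuples_pos[of u] eventually_fst_sparse[of 1]
  proof eventually_elim
    case (elim z)
    obtain n m where z: "z = (n, m)" by (cases z)
    have pos: "T n > 0" "T' n > 0" "n > 0" using elim by (auto simp: z T_def T'_def)
    have pull: "(adjoin (tuples {u..<n}) ^^ r) H = (\<lambda>M. T' n ^ r * (avg {u..<n} ^^ r) H M)" for r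
      using pos by (intro ext) (simp add: avg_funpow flip: T'_def)
    have split: "tuples {d..<n} = touching d u n \<union> tuples {u..<n}"
      using tuples_mono[of "{u..<n}" "{d..<n}"] \<open>d \<le> u\<close> by (auto simp: touching_def)
    have disj: "touching d u n \<inter> tuples {u..<n} = {}" by (auto simp: touching_def)
    have "(avg {d..<n} ^^ m) H Q = (adjoin (touching d u n \<union> tuples {u..<n}) ^^ m) H Q / T n ^ m"
      by (simp only: avg_funpow T_def split)
    then have "(avg {d..<n} ^^ m) H Q = (\<Sum>q\<le>m. real (m choose q) *
        (adjoin (touching d u n) ^^ q) (\<lambda>M. T' n ^ (m - q) * (avg {u..<n} ^^ (m - q)) H M) Q) / T n ^ m"
      by (simp only: adjoin_binomial[OF finite_touching finite_tuples[OF finite_atLeastLessThan] disj] pull)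
    also have "\<dots> = (\<Sum>q\<le>m. summand q z)"
      unfolding sum_divide_distrib
    proof (intro sum.cong refl)
      fix q assume "q \<in> {..m}"
      then have "T n ^ m = T n ^ q * T n ^ (m - q)" by (simp flip: power_add)
      then show "real (m choose q) * (adjoin (touching d u n) ^^ q) (\<lambda>M. T' n ^ (m - q) * (avg {u..<n} ^^ (m - q)) H M) Q / T n ^ m
        = summand q z"
        using pos by (simp add: summand_def z Z_def adjoin_funpow_cmult \<rho>_def a_def power_divide field_simps)
    qed
    also have "\<dots> = (\<Sum>q. summand q z)"
      by (rule suminf_finite[symmetric]) (auto simp: summand_def z binomial_eq_0)
    finally show ?case by (simp add: z)
  qed
  have \<rho>_lim: "((\<lambda>z. \<rho> (fst z) ^ snd z) \<longlongrightarrow> exp (- (c * real (K * (u - d))))) (sparse_regime c)"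
  proof -
    have eq: "\<forall>\<^sub>F z in sparse_regime c. a (fst z) * real (card (touching d u (fst z))) * (C z / real (fst z)) = C z * (1 - \<rho> (fst z))"
      for C :: "nat \<times> nat \<Rightarrow> real"
      using eventually_card_tuples_pos[of d] eventually_fst_sparse[of 1]
    proof eventually_elim
      case (elim z)
      then have "T (fst z) > 0" by (simp add: T_def)
      with elim show ?case by (simp add: a_def touch_card \<rho>_def field_simps)
    qed
    have 1: "((\<lambda>z. 1 - \<rho> (fst z)) \<longlongrightarrow> 0) (sparse_regime c)"
      using Lim_transform_eventually[OF tendsto_mult[OF touch_lim tendsto_const_over_fst[of 1]] eq[of "\<lambda>_. 1"]] by simp
    have 2: "((\<lambda>z. real (snd z) * (1 - \<rho> (fst z))) \<longlongrightarrow> c * real (K * (u - d))) (sparse_regime c)"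
      using Lim_transform_eventually[OF tendsto_mult[OF touch_lim tendsto_ratio_sparse] eq[of "\<lambda>z. real (snd z)"]]
      by (simp add: mult.commute)
    show ?thesis
      using tendsto_one_minus_power[OF 1 2] \<rho>01 by simp
  qed
  have summand_lim: "((\<lambda>z. summand q z) \<longlongrightarrow> c ^ q / fact q * exp (- (c * real (K * (u - d)))) * L q) (sparse_regime c)" for q
    unfolding summand_def
    using filterlim_compose[OF \<rho>_lim filterlim_sparse_shift[of q]] filterlim_compose[OF L[of q] filterlim_sparse_shift[of q]]
    by (intro tendsto_mult tendsto_binomial_over_power) auto
  \<comment> \<open>Only the number of touching constraints enters the bound, which makes it a term of an exponential series.\<close>
  have summand_bound: "\<forall>\<^sub>F z in sparse_regime c. \<forall>q. norm (summand q z) \<le> ((c + 1) * D) ^ q / fact q * B"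
    using touch_le order_tendstoD(2)[OF tendsto_ratio_sparse, of c "c + 1", simplified] eventually_fst_sparse[of 1]
  proof eventually_elim
    case (elim z)
    obtain n m where z: "z = (n, m)" by (cases z)
    show ?case
    proof
      fix q
      have "real (m choose q) * fact q \<le> real (m ^ q)"
        using of_nat_mono[OF binomial_fact_pow[of m q], where 'a = real] by simp
      then have "real (m choose q) / real n ^ q \<le> (real m / real n) ^ q / fact q"
        using elim by (simp add: power_divide field_simps z)
      also have "\<dots> \<le> (c + 1) ^ q / fact q"
        using elim by (intro divide_right_mono power_mono) (auto simp: z)
      finally have b1: "real (m choose q) / real n ^ q \<le> (c + 1) ^ q / fact q" .
      have b2: "\<bar>Z q (n, m - q) Q\<bar> \<le> D ^ q * B"
      proof (rule order_trans[OF Z_bound])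
        show "(a (fst (n, m - q)) * real (card (touching d u (fst (n, m - q))))) ^ q * B \<le> D ^ q * B"
          using elim by (intro mult_right_mono power_mono B) (auto simp: a_nonneg z)
      qed
      have "norm (summand q z) = real (m choose q) / real n ^ q * (\<rho> n ^ (m - q) * \<bar>Z q (n, m - q) Q\<bar>)"
        by (simp add: summand_def z abs_mult \<rho>01)
      also have "\<dots> \<le> (c + 1) ^ q / fact q * (1 * (D ^ q * B))"
        using b1 b2 c D B \<rho>01 by (intro mult_mono power_le_one) auto
      finally show "norm (summand q z) \<le> ((c + 1) * D) ^ q / fact q * B"
        by (simp add: power_mult_distrib)
    qed
  qed
  have "summable (\<lambda>q. ((c + 1) * D) ^ q / fact q * B)"
    using summable_exp[of "(c + 1) * D"] by (intro summable_mult2) (simp add: field_simps)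
  moreover have "\<forall>\<^sub>F (q, z) in at_top \<times>\<^sub>F sparse_regime c. norm (summand q z) \<le> ((c + 1) * D) ^ q / fact q * B"
    unfolding eventually_prod_filter case_prod_conv
    using summand_bound by (intro exI[of _ "\<lambda>_. True"] exI[of _ "\<lambda>z. \<forall>q. norm (summand q z) \<le> ((c + 1) * D) ^ q / fact q * B"]) auto
  ultimately have "((\<lambda>z. \<Sum>q. summand q z) \<longlongrightarrow> (\<Sum>q. c ^ q / fact q * exp (- (c * real (K * (u - d)))) * L q)) (sparse_regime c)"
    using tannerys_theorem[of summand "\<lambda>q. c ^ q / fact q * exp (- (c * real (K * (u - d)))) * L q" "sparse_regime c"
        "\<lambda>q. ((c + 1) * D) ^ q / fact q * B", OF summand_lim _ _ sparse_not_bot[OF c]] by blast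
  from Lim_transform_eventually[OF this expand] show ?case
    unfolding H_def by blast
qed


lemma avg_funpow_equivariant:
  assumes "bij \<pi>" "\<pi> ` V = V"
    and equiv: "\<And>M. G (relabel \<pi> M) = H M"
  shows "(avg V ^^ m) G (relabel \<pi> Q) = (avg V ^^ m) H Q"
  by (subst avg_funpow_relabel[OF assms(1,2)]) (simp add: equiv)

text \<open>
  By exchangeability of the variables the average is the expectation at the variable \<open>0\<close>.
\<close>

lemma vertex_average_limit:
  fixes upd :: "'v \<Rightarrow> ('s \<times> nat \<times> 'v list) multiset \<Rightarrow> 'v" and g :: "'v \<Rightarrow> real"
  assumes c: "c \<ge> 0" and gB: "\<And>x. \<bar>g x\<bar> \<le> B"
  shows "\<exists>L. ((\<lambda>z. (avg {0..<fst z} ^^ snd z) (\<lambda>M. \<Sum>i<fst z. g (state upd v0 t M i)) {#} / real (fst z)) \<longlongrightarrow> L) (sparse_regime c)"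
proof -
  have "\<exists>L. ((\<lambda>z. (avg {0..<fst z} ^^ snd z) (\<lambda>M. (\<lambda>xs. g (hd xs)) (map (state upd v0 t M) [0..<1])) {#}) \<longlongrightarrow> L) (sparse_regime c)"
    by (rule local_limit[OF c, where B = B]) (auto simp: gB)
  then obtain L where L: "((\<lambda>z. (avg {0..<fst z} ^^ snd z) (\<lambda>M. g (state upd v0 t M 0)) {#}) \<longlongrightarrow> L) (sparse_regime c)"
    by (auto simp: upt_rec)
  have "\<forall>\<^sub>F z in sparse_regime c. (avg {0..<fst z} ^^ snd z) (\<lambda>M. g (state upd v0 t M 0)) {#}
     = (avg {0..<fst z} ^^ snd z) (\<lambda>M. \<Sum>i<fst z. g (state upd v0 t M i)) {#} / real (fst z)"
    using eventually_fst_sparse[of 1]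
  proof eventually_elim
    case (elim z)
    have same: "(avg {0..<fst z} ^^ snd z) (\<lambda>M. g (state upd v0 t M i)) {#}
       = (avg {0..<fst z} ^^ snd z) (\<lambda>M. g (state upd v0 t M 0)) {#}" if "i < fst z" for i
    proof -
      define \<pi> where "\<pi> = Transposition.transpose 0 i"
      have p: "\<pi> permutes {0..<fst z}"
        unfolding \<pi>_def using elim that by (intro permutes_swap_id) auto
      have bij: "bij \<pi>" by (rule permutes_bij[OF p])
      have "g (state upd v0 t (relabel \<pi> M) i) = g (state upd v0 t M 0)" for M
        using state_relabel[OF bij_is_inj[OF bij], of upd v0 t M 0] by (simp add: \<pi>_def)
      from avg_funpow_equivariant[where G = "\<lambda>M. g (state upd v0 t M i)", OF bij permutes_image[OF p] this, of "snd z" "{#}"]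
      show ?thesis by (simp add: relabel_def)
    qed
    have "(avg {0..<fst z} ^^ snd z) (\<lambda>M. \<Sum>i<fst z. g (state upd v0 t M i)) {#}
       = (\<Sum>i<fst z. (avg {0..<fst z} ^^ snd z) (\<lambda>M. g (state upd v0 t M i)) {#})"
      using avg_funpow_sum[where A = "{..<fst z}" and c = "\<lambda>_. 1" and H = "\<lambda>i M. g (state upd v0 t M i)"] by simp
    also have "\<dots> = (\<Sum>i<fst z. (avg {0..<fst z} ^^ snd z) (\<lambda>M. g (state upd v0 t M 0)) {#})"
      by (intro sum.cong refl same) simp
    finally show ?case using elim by simp
  qed
  from Lim_transform_eventually[OF L this] show ?thesis by (rule exI)
qed

text \<open>
  The sum reduces to a single planted random constraint (\<open>avg_funpow_sum_mset\<close>). With probability tending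
  to \<open>1\<close> its variables are distinct, and it can then be renamed to the tuple \<open>[0..<K]\<close>.
\<close>

lemma constraint_average_limit:
  fixes upd :: "'v \<Rightarrow> ('s \<times> nat \<times> 'v list) multiset \<Rightarrow> 'v" and g :: "'s \<Rightarrow> 'v list \<Rightarrow> real"
  assumes c: "c \<ge> 0" and gB: "\<And>s xs. s \<in> S \<Longrightarrow> \<bar>g s xs\<bar> \<le> B"
  shows "\<exists>L. ((\<lambda>z. (avg {0..<fst z} ^^ snd z)
      (\<lambda>M. \<Sum>C\<in>#M. g (snd C) (map (state upd v0 t M) (fst C))) {#} / real (fst z)) \<longlongrightarrow> L) (sparse_regime c)"
proof -
  define T where "T n = tuples {0..<n}" for n
  define Y where "Y z idx = (\<Sum>s\<in>S. p s * (avg {0..<fst z} ^^ (snd z - 1))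
      (\<lambda>M. g s (map (state upd v0 t M) idx)) (add_mset (idx, s) {#}))" for z idx
  have B: "B \<ge> 0"
  proof -
    obtain s where "s \<in> S" using sum_p by fastforce
    from gB[OF this, of "[]"] show ?thesis by linarith
  qed
  have YB: "\<bar>Y z idx\<bar> \<le> B" for z idx
  proof -
    have "\<bar>Y z idx\<bar> \<le> (\<Sum>s\<in>S. \<bar>p s * (avg {0..<fst z} ^^ (snd z - 1))
      (\<lambda>M. g s (map (state upd v0 t M) idx)) (add_mset (idx, s) {#})\<bar>)"
      unfolding Y_def by (rule sum_abs)
    also have "\<dots> \<le> (\<Sum>s\<in>S. p s * B)"
      unfolding abs_mult by (intro sum_mono mult_mono abs_avg_funpow_le gB) (auto simp: p_nonneg)
    finally show ?thesis by (simp add: sum_distrib_right[symmetric] sum_p)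
  qed
  have "\<exists>L. ((\<lambda>z. Y z [0..<K]) \<longlongrightarrow> L) (sparse_regime c)"
  proof -
    have "\<exists>L. ((\<lambda>z. (avg {0..<fst z} ^^ (snd z - 1)) (\<lambda>M. g s (map (state upd v0 t M) [0..<K])) (add_mset ([0..<K], s) {#})) \<longlongrightarrow> L) (sparse_regime c)"
      if s: "s \<in> S" for s
    proof -
      obtain L where "((\<lambda>z. (avg {0..<fst z} ^^ snd z) (\<lambda>M. g s (map (state upd v0 t M) [0..<K])) (add_mset ([0..<K], s) {#})) \<longlongrightarrow> L) (sparse_regime c)"
        using local_limit[where h = "g s" and B = B and d = 0 and u = K and Q = "add_mset ([0..<K], s) {#}"
            and upd = upd and ?v0.0 = v0 and t = t, OF c _ _ gB[OF s]] by (auto simp: lessThan_atLeast0)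
      from filterlim_compose[OF this filterlim_sparse_shift[of 1]] show ?thesis by (intro exI) simp
    qed
    then have "\<forall>s\<in>S. \<exists>L. ((\<lambda>z. (avg {0..<fst z} ^^ (snd z - 1)) (\<lambda>M. g s (map (state upd v0 t M) [0..<K])) (add_mset ([0..<K], s) {#})) \<longlongrightarrow> L) (sparse_regime c)" ..
    from bchoice[OF this] obtain L where "\<And>s. s \<in> S \<Longrightarrow> ((\<lambda>z. (avg {0..<fst z} ^^ (snd z - 1)) (\<lambda>M. g s (map (state upd v0 t M) [0..<K])) (add_mset ([0..<K], s) {#})) \<longlongrightarrow> L s) (sparse_regime c)"
      by auto
    then have "((\<lambda>z. Y z [0..<K]) \<longlongrightarrow> (\<Sum>s\<in>S. p s * L s)) (sparse_regime c)"
      unfolding Y_def by (intro tendsto_sum tendsto_mult tendsto_const)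
    then show ?thesis by blast
  qed
  then obtain L where L: "((\<lambda>z. Y z [0..<K]) \<longlongrightarrow> L) (sparse_regime c)" by blast
  have canon: "Y z idx = Y z [0..<K]" if idx: "idx \<in> fresh K 0 (fst z)" and z: "K \<le> fst z" for z idx
  proof -
    have "\<exists>\<pi>. \<pi> permutes {0..<fst z} \<and> map \<pi> [0..<K] = idx"
      using idx z by (intro ex_permutes_map_eq) (auto simp: fresh_def)
    then obtain \<pi> where p: "\<pi> permutes {0..<fst z}" and map: "map \<pi> [0..<K] = idx" by blast
    have bij: "bij \<pi>" by (rule permutes_bij[OF p])
    have "(avg {0..<fst z} ^^ (snd z - 1)) (\<lambda>M. g s (map (state upd v0 t M) idx)) (relabel \<pi> (add_mset ([0..<K], s) {#}))
      = (avg {0..<fst z} ^^ (snd z - 1)) (\<lambda>M. g s (map (state upd v0 t M) [0..<K])) (add_mset ([0..<K], s) {#})" for s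
    proof (rule avg_funpow_equivariant[OF bij permutes_image[OF p]])
      fix M show "g s (map (state upd v0 t (relabel \<pi> M)) idx) = g s (map (state upd v0 t M) [0..<K])"
        unfolding map[symmetric] map_map o_def state_relabel[OF bij_is_inj[OF bij]] ..
    qed
    then show ?thesis by (simp add: Y_def relabel_def map)
  qed
  define y where "y z = (\<Sum>idx\<in>T (fst z). Y z idx) / real (card (T (fst z)))" for z
  define \<phi> where "\<phi> n = real (card (fresh K 0 n)) / real (card (T n))" for n
  have \<phi>: "((\<lambda>z. \<phi> (fst z)) \<longlongrightarrow> 1) (sparse_regime c)"
  proof (rule Lim_transform_eventually)
    show "((\<lambda>z. (real (card (fresh K 0 (fst z))) / real (fst z) ^ K) / (real (card (T (fst z))) / real (fst z) ^ K)) \<longlongrightarrow> 1) (sparse_regime c)"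
      unfolding T_def using tendsto_divide[OF tendsto_card_fresh[of K 0] tendsto_card_tuples[of 0] one_neq_zero] by (simp only: div_by_1)
    show "\<forall>\<^sub>F z in sparse_regime c. (real (card (fresh K 0 (fst z))) / real (fst z) ^ K) / (real (card (T (fst z))) / real (fst z) ^ K) = \<phi> (fst z)"
      using eventually_fst_sparse[of 1] by eventually_elim (simp add: \<phi>_def)
  qed
  have "((\<lambda>z. y z - \<phi> (fst z) * Y z [0..<K]) \<longlongrightarrow> 0) (sparse_regime c)"
  proof (rule Lim_null_comparison)
    show "((\<lambda>z. (1 - \<phi> (fst z)) * B) \<longlongrightarrow> 0) (sparse_regime c)"
      using tendsto_mult[OF tendsto_diff[OF tendsto_const[of 1] \<phi>] tendsto_const[of B]] by simp
    show "\<forall>\<^sub>F z in sparse_regime c. norm (y z - \<phi> (fst z) * Y z [0..<K]) \<le> (1 - \<phi> (fst z)) * B"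
      using eventually_card_tuples_pos[of 0] eventually_fst_sparse[of K]
    proof eventually_elim
      case (elim z)
      define F where "F = fresh K 0 (fst z)"
      have sub: "F \<subseteq> T (fst z)" unfolding F_def T_def by (rule fresh_subset_tuples)
      have t: "real (card (T (fst z))) > 0" using elim by (simp add: T_def)
      have fin: "finite (T (fst z))" by (simp add: T_def)
      have "(\<Sum>idx\<in>T (fst z). Y z idx) = (\<Sum>idx\<in>F. Y z idx) + (\<Sum>idx\<in>T (fst z) - F. Y z idx)"
        by (subst sum.subset_diff[OF sub fin]) simp
      also have "(\<Sum>idx\<in>F. Y z idx) = real (card F) * Y z [0..<K]"
        using canon elim by (simp add: F_def)
      finally have "y z - \<phi> (fst z) * Y z [0..<K] = (\<Sum>idx\<in>T (fst z) - F. Y z idx) / real (card (T (fst z)))"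
        by (simp add: y_def \<phi>_def F_def add_divide_distrib)
      moreover have "\<bar>\<Sum>idx\<in>T (fst z) - F. Y z idx\<bar> \<le> real (card (T (fst z) - F)) * B"
        by (rule order_trans[OF sum_abs]) (intro sum_bounded_above YB)
      moreover have "real (card (T (fst z) - F)) = real (card (T (fst z))) - real (card F)"
        using sub fin by (simp add: card_Diff_subset finite_subset[OF sub] of_nat_diff card_mono)
      ultimately have "norm (y z - \<phi> (fst z) * Y z [0..<K]) \<le> (real (card (T (fst z))) - real (card F)) * B / real (card (T (fst z)))"
        using t by (auto simp: divide_right_mono)
      also have "\<dots> = (1 - \<phi> (fst z)) * B"
        using t by (simp add: \<phi>_def F_def field_simps)
      finally show ?case .
    qed
  qed
  from tendsto_add[OF this tendsto_mult[OF \<phi> L]]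
  have "(y \<longlongrightarrow> L) (sparse_regime c)" by simp
  from tendsto_mult[OF tendsto_ratio_sparse this]
  have lim: "((\<lambda>z. real (snd z) / real (fst z) * y z) \<longlongrightarrow> c * L) (sparse_regime c)" .
  have eq: "(avg {0..<fst z} ^^ snd z) (\<lambda>M. \<Sum>C\<in>#M. g (snd C) (map (state upd v0 t M) (fst C))) {#} / real (fst z)
     = real (snd z) / real (fst z) * y z" for z
    using avg_funpow_sum_mset[of "snd z" "{0..<fst z}" "\<lambda>C M. g (snd C) (map (state upd v0 t M) (fst C))" "{#}"]
    by (simp add: y_def Y_def T_def)
  from lim show ?thesis unfolding eq by (rule exI)
qed

end

lemma sum_filtered_positions:
  fixes f :: "nat \<Rightarrow> nat \<Rightarrow> real"
  assumes "set idx \<subseteq> {..<n}"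
  shows "(\<Sum>i<n. \<Sum>k\<in>#{#k \<in># mset [0..<length idx]. idx ! k = i#}. f i k) = (\<Sum>k<length idx. f (idx ! k) k)"
proof -
  have "(\<Sum>k\<in>#{#k \<in># mset [0..<length idx]. idx ! k = i#}. f i k)
      = (\<Sum>k\<in>{k \<in> {..<length idx}. idx ! k = i}. f (idx ! k) k)" for i
  proof -
    have "{#k \<in># mset [0..<length idx]. idx ! k = i#} = mset_set {k \<in> {..<length idx}. idx ! k = i}"
      by (simp add: lessThan_atLeast0)
    then show ?thesis by (simp add: sum_unfold_sum_mset[symmetric])
  qed
  moreover have "(\<Sum>i<n. \<Sum>k\<in>{k \<in> {..<length idx}. idx ! k = i}. f (idx ! k) k) = (\<Sum>k<length idx. f (idx ! k) k)"
    using subsetD[OF assms nth_mem] by (intro sum.group) auto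
  ultimately show ?thesis by simp
qed

text \<open>
  Double counting of the pairs of a constraint and a position in it.
\<close>

lemma sum_inbox:
  fixes f :: "nat \<Rightarrow> 's \<times> nat \<times> 'v list \<Rightarrow> real"
  assumes "variables_below n M"
  shows "(\<Sum>i<n. \<Sum>c\<in>#inbox i x M. f i c) = (\<Sum>C\<in>#M. \<Sum>k<length (fst C). f (fst C ! k) (snd C, k, map x (fst C)))"
  using assms
proof (induction M)
  case (add C M)
  have "(\<Sum>c\<in>#messages i x C. f i c)
      = (\<Sum>k\<in>#{#k \<in># mset [0..<length (fst C)]. fst C ! k = i#}. f i (snd C, k, map x (fst C)))" for i
    by (simp add: messages_def multiset.map_comp o_def)
  then have "(\<Sum>i<n. \<Sum>c\<in>#messages i x C. f i c) = (\<Sum>k<length (fst C). f (fst C ! k) (snd C, k, map x (fst C)))"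
    using sum_filtered_positions[of "fst C" n "\<lambda>i k. f i (snd C, k, map x (fst C))"] add.prems by simp
  with add show ?case by (simp add: sum.distrib)
qed simp

lemma size_inbox_eq: "size (inbox i x M) = size (inbox i y M)"
  by (induction M) (auto simp: messages_def)

section \<open>Limits from approximate limits\<close>

text \<open>
  If approximate limits exist for every error \<open>e\<close> and are pairwise compatible, the intervals of radius
  \<open>e\<close> around them have a common point, namely the supremum of their left end points.
\<close>

lemma ex_common_limit:
  fixes Q :: "real \<Rightarrow> real \<Rightarrow> bool"
  assumes ex: "\<And>e. e > 0 \<Longrightarrow> \<exists>l. Q e l"
    and compatible: "\<And>e l e' l'. 0 < e \<Longrightarrow> Q e l \<Longrightarrow> 0 < e' \<Longrightarrow> Q e' l' \<Longrightarrow> \<bar>l - l'\<bar> \<le> e + e'"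
  shows "\<exists>f. \<forall>e l. 0 < e \<longrightarrow> Q e l \<longrightarrow> \<bar>l - f\<bar> \<le> e"
proof -
  define X where "X = {l - e | e l. 0 < e \<and> Q e l}"
  have upper: "x \<le> l + e" if "x \<in> X" "0 < e" "Q e l" for x e l
    using that compatible by (force simp: X_def abs_le_iff)
  obtain l where l: "Q 1 l" using ex[of 1] by auto
  then have "l - 1 \<in> X" unfolding X_def by (intro CollectI exI[of _ 1] exI[of _ l]) simp
  then have nonempty: "X \<noteq> {}" by blast
  have "bdd_above X" using upper[OF _ _ l] by (intro bdd_aboveI[of _ "l + 1"]) simp
  have "\<bar>l - Sup X\<bar> \<le> e" if "0 < e" "Q e l" for e l
  proof -
    have "l - e \<le> Sup X" using that \<open>bdd_above X\<close> unfolding X_def by (intro cSup_upper) blast+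
    moreover have "Sup X \<le> l + e" using nonempty upper that by (intro cSup_least) auto
    ultimately show ?thesis by linarith
  qed
  then show ?thesis by blast
qed

lemma filter_limit_of_approximations:
  fixes v :: "'b \<Rightarrow> real"
  assumes F: "F \<noteq> bot"
    and approx: "\<And>e. e > 0 \<Longrightarrow> \<exists>w l. (w \<longlongrightarrow> l) F \<and> (\<forall>\<^sub>F z in F. \<bar>v z - w z\<bar> \<le> e)"
  shows "\<exists>l. (v \<longlongrightarrow> l) F"
proof -
  define Q where "Q e l \<longleftrightarrow> (\<exists>w. (w \<longlongrightarrow> l) F \<and> (\<forall>\<^sub>F z in F. \<bar>v z - w z\<bar> \<le> e))" for e l
  have "\<exists>f. \<forall>e l. 0 < e \<longrightarrow> Q e l \<longrightarrow> \<bar>l - f\<bar> \<le> e"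
  proof (rule ex_common_limit)
    show "\<exists>l. Q e l" if "e > 0" for e using approx[OF that] by (auto simp: Q_def)
    fix e l e' l' assume "Q e l" "Q e' l'"
    then obtain w w' where w: "(w \<longlongrightarrow> l) F" "\<forall>\<^sub>F z in F. \<bar>v z - w z\<bar> \<le> e"
      and w': "(w' \<longlongrightarrow> l') F" "\<forall>\<^sub>F z in F. \<bar>v z - w' z\<bar> \<le> e'" by (auto simp: Q_def)
    show "\<bar>l - l'\<bar> \<le> e + e'"
    proof (rule tendsto_upperbound[OF tendsto_rabs[OF tendsto_diff[OF w(1) w'(1)]] _ F])
      show "\<forall>\<^sub>F z in F. \<bar>w z - w' z\<bar> \<le> e + e'"
        using w(2) w'(2) by eventually_elim linarith
    qed
  qed
  then obtain f where f: "\<And>e l. 0 < e \<Longrightarrow> Q e l \<Longrightarrow> \<bar>l - f\<bar> \<le> e" by blast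
  have "(v \<longlongrightarrow> f) F"
  proof (rule tendstoI)
    fix e :: real assume e: "e > 0"
    obtain w l where w: "(w \<longlongrightarrow> l) F" "\<forall>\<^sub>F z in F. \<bar>v z - w z\<bar> \<le> e / 4"
      using approx[of "e / 4"] e by auto
    have lf: "\<bar>l - f\<bar> \<le> e / 4" using w e by (intro f) (auto simp: Q_def)
    have "\<forall>\<^sub>F z in F. dist (w z) l < e / 4" using e by (intro tendstoD[OF w(1)]) simp
    with w(2) show "\<forall>\<^sub>F z in F. dist (v z) f < e"
    proof eventually_elim
      case (elim z)
      then show ?case using lf e unfolding dist_real_def by linarith
    qed
  qed
  then show ?thesis by blast
qed

section \<open>The linear program as convex minimisation\<close>

locale random_lp = sparse_model K repl S p
  for K :: nat and repl :: bool and S :: "'s set" and p :: "'s \<Rightarrow> real" +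
  fixes \<alpha> :: "'s \<Rightarrow> nat \<Rightarrow> real" and \<beta> :: "'s \<Rightarrow> real" and B1 B2 wx w\<psi> :: real
  assumes B12: "B1 \<le> B2" and wx: "wx \<ge> 0" and w\<psi>: "w\<psi> > 0"
begin

text \<open>
  The penalty left after choosing the smallest feasible slack.
\<close>

definition cost :: "'s \<Rightarrow> real list \<Rightarrow> real" where
  "cost s ys = w\<psi> * max 0 ((\<Sum>k<K. \<alpha> s k * ys ! k) - \<beta> s)"

definition objective :: "nat \<Rightarrow> 's con multiset \<Rightarrow> (nat \<Rightarrow> real) \<Rightarrow> real" where
  "objective n M x = wx * (\<Sum>i<n. x i) + (\<Sum>C\<in>#M. cost (snd C) (map x (fst C)))"

text \<open>
  All coordinates of \<open>x\<close> are confined to the box, even those that are not variables of the instance. So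
  \<open>cost_le\<close> bounds the penalty of every constraint with \<open>K\<close> entries, whatever its variables are.
\<close>

definition optimum :: "nat \<Rightarrow> 's con multiset \<Rightarrow> real" where
  "optimum n M = (INF x\<in>{x. \<forall>i. x i \<in> {B1..B2}}. objective n M x)"

definition well_formed :: "nat \<Rightarrow> 's con multiset \<Rightarrow> bool" where
  "well_formed n M \<longleftrightarrow> (\<forall>C\<in>#M. length (fst C) = K \<and> set (fst C) \<subseteq> {..<n} \<and> snd C \<in> S)"

text \<open>
  A subgradient of the penalty: it is the gradient where the penalty is positive and zero elsewhere.
\<close>

definition slope :: "'s \<Rightarrow> real list \<Rightarrow> nat \<Rightarrow> real" where
  "slope s ys k = (if (\<Sum>k<K. \<alpha> s k * ys ! k) > \<beta> s then w\<psi> * \<alpha> s k else 0)"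

definition clip :: "real \<Rightarrow> real" where
  "clip y = max B1 (min B2 y)"

definition gradient :: "('s \<times> nat \<times> real list) multiset \<Rightarrow> real" where
  "gradient I = wx + (\<Sum>(s, k, ys)\<in>#I. slope s ys k)"

text \<open>
  One plus the number of messages is one plus the degree of the variable, so high-degree variables take
  shorter steps.
\<close>

definition descend :: "real \<Rightarrow> real \<Rightarrow> ('s \<times> nat \<times> real list) multiset \<Rightarrow> real" where
  "descend \<eta> x I = clip (x - \<eta> * gradient I / (1 + real (size I)))"

abbreviation iterate :: "real \<Rightarrow> nat \<Rightarrow> 's con multiset \<Rightarrow> nat \<Rightarrow> real" where
  "iterate \<eta> \<equiv> state (descend \<eta>) B1"

definition slope_bound :: real where
  "slope_bound = wx + w\<psi> * (\<Sum>s\<in>S. \<Sum>k<K. \<bar>\<alpha> s k\<bar>)"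

definition cost_bound :: real where
  "cost_bound = w\<psi> * (\<Sum>s\<in>S. (\<Sum>k<K. \<bar>\<alpha> s k\<bar>) * (\<bar>B1\<bar> + \<bar>B2\<bar>) + \<bar>\<beta> s\<bar>)"

lemma clip_in: "clip y \<in> {B1..B2}"
  using B12 by (auto simp: clip_def)

lemma clip_id: "y \<in> {B1..B2} \<Longrightarrow> clip y = y"
  by (auto simp: clip_def)

lemma clip_dist_le: "y \<in> {B1..B2} \<Longrightarrow> \<bar>clip a - y\<bar> \<le> \<bar>a - y\<bar>"
  by (auto simp: clip_def max_def min_def)

lemma iterate_in: "iterate \<eta> t M i \<in> {B1..B2}"
  using B12 clip_in by (cases t) (auto simp: descend_def)

lemma well_formed_below: "well_formed n M \<Longrightarrow> variables_below n M"
  by (auto simp: well_formed_def variables_below_def)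

lemma well_formed_add: "well_formed n M \<Longrightarrow> idx \<in> tuples {0..<n} \<Longrightarrow> s \<in> S \<Longrightarrow> well_formed n (add_mset (idx, s) M)"
  by (auto simp: well_formed_def tuples_def)

lemma cost_nonneg: "cost s ys \<ge> 0"
  using w\<psi> by (simp add: cost_def)

lemma cost_le:
  assumes "s \<in> S" "length ys = K" "set ys \<subseteq> {B1..B2}"
  shows "cost s ys \<le> cost_bound"
proof -
  have "(\<Sum>k<K. \<alpha> s k * ys ! k) \<le> (\<Sum>k<K. \<bar>\<alpha> s k\<bar> * (\<bar>B1\<bar> + \<bar>B2\<bar>))"
  proof (rule sum_mono)
    fix k assume "k \<in> {..<K}"
    then have "ys ! k \<in> {B1..B2}" using subsetD[OF assms(3) nth_mem[of k ys]] assms(2) by simp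
    then have "\<bar>ys ! k\<bar> \<le> \<bar>B1\<bar> + \<bar>B2\<bar>" by auto
    then have "\<bar>\<alpha> s k\<bar> * \<bar>ys ! k\<bar> \<le> \<bar>\<alpha> s k\<bar> * (\<bar>B1\<bar> + \<bar>B2\<bar>)" by (intro mult_left_mono) auto
    then show "\<alpha> s k * ys ! k \<le> \<bar>\<alpha> s k\<bar> * (\<bar>B1\<bar> + \<bar>B2\<bar>)"
      by (metis abs_mult abs_ge_self order_trans)
  qed
  then have "max 0 ((\<Sum>k<K. \<alpha> s k * ys ! k) - \<beta> s) \<le> (\<Sum>k<K. \<bar>\<alpha> s k\<bar>) * (\<bar>B1\<bar> + \<bar>B2\<bar>) + \<bar>\<beta> s\<bar>"
    by (auto simp: sum_distrib_right sum_nonneg intro!: add_nonneg_nonneg)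
  also have "\<dots> \<le> (\<Sum>s\<in>S. (\<Sum>k<K. \<bar>\<alpha> s k\<bar>) * (\<bar>B1\<bar> + \<bar>B2\<bar>) + \<bar>\<beta> s\<bar>)"
    by (rule member_le_sum[OF assms(1) _ finite_S]) (auto intro!: add_nonneg_nonneg mult_nonneg_nonneg sum_nonneg)
  finally show ?thesis
    using w\<psi> by (simp add: cost_def cost_bound_def)
qed

lemma cost_bound_nonneg: "cost_bound \<ge> 0"
  using w\<psi> by (auto simp: cost_bound_def intro!: mult_nonneg_nonneg sum_nonneg add_nonneg_nonneg)

lemma cost_subgradient:
  "cost s zs \<ge> cost s ys + (\<Sum>k<K. slope s ys k * (zs ! k - ys ! k))"
proof -
  define a where "a ys = (\<Sum>k<K. \<alpha> s k * ys ! k)" for ys :: "real list"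
  have "(\<Sum>k<K. slope s ys k * (zs ! k - ys ! k)) = (if a ys > \<beta> s then w\<psi> * (a zs - a ys) else 0)"
    by (simp add: slope_def a_def sum_distrib_left sum_subtractf algebra_simps)
  moreover have "w\<psi> * max 0 (a ys - \<beta> s) + (if a ys > \<beta> s then w\<psi> * (a zs - a ys) else 0)
      \<le> w\<psi> * max 0 (a zs - \<beta> s)"
  proof (cases "a ys > \<beta> s")
    case True
    then have "w\<psi> * max 0 (a ys - \<beta> s) + w\<psi> * (a zs - a ys) = w\<psi> * (a zs - \<beta> s)"
      by (simp add: algebra_simps)
    also have "\<dots> \<le> w\<psi> * max 0 (a zs - \<beta> s)" using w\<psi> by simp
    finally show ?thesis using True by simp
  next
    case False
    then show ?thesis using w\<psi> by (simp add: max_def)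
  qed
  ultimately show ?thesis by (simp add: cost_def a_def)
qed

lemma abs_slope_le:
  assumes "s \<in> S" "k < K"
  shows "\<bar>slope s ys k\<bar> \<le> slope_bound"
proof -
  have "\<bar>\<alpha> s k\<bar> \<le> (\<Sum>k<K. \<bar>\<alpha> s k\<bar>)"
    using assms by (intro member_le_sum) auto
  also have "\<dots> \<le> (\<Sum>s\<in>S. \<Sum>k<K. \<bar>\<alpha> s k\<bar>)"
    by (rule member_le_sum[OF assms(1) _ finite_S]) (auto intro!: sum_nonneg)
  finally have "w\<psi> * \<bar>\<alpha> s k\<bar> \<le> slope_bound"
    using wx w\<psi> by (simp add: slope_bound_def add_increasing)
  moreover have "\<bar>slope s ys k\<bar> \<le> w\<psi> * \<bar>\<alpha> s k\<bar>"
    using w\<psi> by (auto simp: slope_def abs_mult)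
  ultimately show ?thesis by linarith
qed

lemma slope_bound_ge: "slope_bound \<ge> wx"
  using w\<psi> by (auto simp: slope_bound_def intro!: mult_nonneg_nonneg sum_nonneg)

text \<open>
  The gradient at a variable grows at most linearly with its degree, so that the shortened steps are
  bounded.
\<close>

lemma abs_gradient_le:
  assumes "well_formed n M"
  shows "\<bar>gradient (inbox i x M)\<bar> \<le> slope_bound * (1 + real (size (inbox i x M)))"
proof -
  have "\<bar>\<Sum>(s, k, ys)\<in>#inbox i x M. slope s ys k\<bar> \<le> slope_bound * real (size (inbox i x M))"
    using assms
  proof (induction M)
    case (add C M)
    have "\<bar>\<Sum>(s, k, ys)\<in>#messages i x C. slope s ys k\<bar> \<le> slope_bound * real (size (messages i x C))"
    proof -
      have C: "snd C \<in> S" "length (fst C) = K" using add.prems by (auto simp: well_formed_def)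
      have "\<bar>\<Sum>(s, k, ys)\<in>#N. slope s ys k\<bar> \<le> slope_bound * real (size N)"
        if "N \<subseteq># messages i x C" for N
        using that
      proof (induction N)
        case (add c N)
        then have "c \<in># messages i x C" by (meson insert_subset_eq_iff)
        then obtain k where "c = (snd C, k, map x (fst C))" "k < K"
          using C(2) by (auto simp: messages_def)
        then have "\<bar>case c of (s, k, ys) \<Rightarrow> slope s ys k\<bar> \<le> slope_bound"
          using abs_slope_le[OF C(1)] by simp
        moreover have "\<bar>\<Sum>(s, k, ys)\<in>#N. slope s ys k\<bar> \<le> slope_bound * real (size N)"
          using add by (meson subset_mset.order_trans subset_mset.less_imp_le multi_psub_of_add_self)
        ultimately show ?case by (simp add: algebra_simps)
      qed simp
      then show ?thesis by blast
    qed
    moreover have "\<bar>\<Sum>(s, k, ys)\<in>#inbox i x M. slope s ys k\<bar> \<le> slope_bound * real (size (inbox i x M))"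
      using add by (auto simp: well_formed_def)
    ultimately show ?case by (simp add: algebra_simps)
  qed simp
  then show ?thesis
    using slope_bound_ge wx by (simp add: gradient_def algebra_simps)
qed

text \<open>
  Summing the subgradient inequalities of the penalties over all constraints.
\<close>

lemma objective_gradient:
  assumes M: "well_formed n M"
  shows "objective n M y \<ge> objective n M x + (\<Sum>i<n. gradient (inbox i x M) * (y i - x i))"
proof -
  have "(\<Sum>i<n. gradient (inbox i x M) * (y i - x i))
      = wx * (\<Sum>i<n. y i - x i) + (\<Sum>i<n. \<Sum>c\<in>#inbox i x M. (case c of (s, k, ys) \<Rightarrow> slope s ys k) * (y i - x i))"
    by (simp add: gradient_def distrib_right sum.distrib sum_distrib_left sum_mset_distrib_right)
  also have "(\<Sum>i<n. \<Sum>c\<in>#inbox i x M. (case c of (s, k, ys) \<Rightarrow> slope s ys k) * (y i - x i))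
      = (\<Sum>C\<in>#M. \<Sum>k<length (fst C). slope (snd C) (map x (fst C)) k * (y (fst C ! k) - x (fst C ! k)))"
    by (subst sum_inbox[OF well_formed_below[OF M]]) simp
  finally have eq: "(\<Sum>i<n. gradient (inbox i x M) * (y i - x i)) = wx * (\<Sum>i<n. y i - x i)
     + (\<Sum>C\<in>#M. \<Sum>k<length (fst C). slope (snd C) (map x (fst C)) k * (y (fst C ! k) - x (fst C ! k)))" .
  have "(\<Sum>C\<in>#M. cost (snd C) (map x (fst C)) + (\<Sum>k<length (fst C). slope (snd C) (map x (fst C)) k * (y (fst C ! k) - x (fst C ! k))))
     \<le> (\<Sum>C\<in>#M. cost (snd C) (map y (fst C)))"
  proof (rule sum_mset_mono)
    fix C assume "C \<in># M"
    then have len: "length (fst C) = K" using M by (auto simp: well_formed_def)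
    then have "(\<Sum>k<length (fst C). slope (snd C) (map x (fst C)) k * (y (fst C ! k) - x (fst C ! k)))
      = (\<Sum>k<K. slope (snd C) (map x (fst C)) k * (map y (fst C) ! k - map x (fst C) ! k))"
      by simp
    then show "cost (snd C) (map x (fst C)) + (\<Sum>k<length (fst C). slope (snd C) (map x (fst C)) k * (y (fst C ! k) - x (fst C ! k)))
      \<le> cost (snd C) (map y (fst C))"
      using cost_subgradient by simp
  qed
  moreover have "wx * (\<Sum>i<n. y i - x i) = wx * (\<Sum>i<n. y i) - wx * (\<Sum>i<n. x i)"
    by (simp add: sum_subtractf right_diff_distrib)
  ultimately show ?thesis
    unfolding objective_def eq sum_mset.distrib by linarith
qed

lemma sum_weights:
  assumes "well_formed n M"
  shows "(\<Sum>i<n. 1 + real (size (inbox i x M))) = real n + real K * real (size M)"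
proof -
  have "(\<Sum>i<n. real (size (inbox i x M))) = (\<Sum>i<n. \<Sum>c\<in>#inbox i x M. 1)"
    by simp
  also have "\<dots> = (\<Sum>C\<in>#M. \<Sum>k<length (fst C). 1)"
    by (rule sum_inbox[OF well_formed_below[OF assms]])
  also have "\<dots> = (\<Sum>C\<in>#M. real K)"
    using assms by (intro arg_cong[where f = sum_mset] image_mset_cong) (auto simp: well_formed_def)
  finally show ?thesis by (simp add: sum.distrib)
qed

section \<open>Subgradient descent is nearly optimal\<close>

text \<open>
  Progress at one coordinate in the weighted norm. Projection onto the box does not increase the
  distance to a point \<open>y\<close> of the box.
\<close>

lemma descend_step:
  assumes \<eta>: "\<eta> > 0" and y: "y \<in> {B1..B2}" and D: "D = 1 + real (size I)"
    and g: "\<bar>gradient I\<bar> \<le> slope_bound * D"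
  shows "D * (descend \<eta> x I - y)\<^sup>2 \<le> D * (x - y)\<^sup>2 + 2 * \<eta> * (gradient I * (y - x)) + \<eta>\<^sup>2 * slope_bound\<^sup>2 * D"
proof -
  have D0: "D > 0" by (simp add: D)
  have "(descend \<eta> x I - y)\<^sup>2 \<le> (x - \<eta> * gradient I / D - y)\<^sup>2"
    using power_mono[OF clip_dist_le[OF y, of "x - \<eta> * gradient I / D"], of 2] by (simp add: descend_def D)
  then have "D * (descend \<eta> x I - y)\<^sup>2 \<le> D * (x - \<eta> * gradient I / D - y)\<^sup>2"
    using D0 by simp
  also have "\<dots> = D * (x - y)\<^sup>2 + 2 * \<eta> * (gradient I * (y - x)) + \<eta>\<^sup>2 * ((gradient I)\<^sup>2 / D)"
    using D0 by (simp add: power2_eq_square field_simps)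
  also have "(gradient I)\<^sup>2 / D \<le> slope_bound\<^sup>2 * D"
    using power_mono[OF g, of 2] D0 by (simp add: divide_le_eq power_mult_distrib power2_eq_square mult_ac)
  then have "\<eta>\<^sup>2 * ((gradient I)\<^sup>2 / D) \<le> \<eta>\<^sup>2 * slope_bound\<^sup>2 * D"
    unfolding mult.assoc by (rule mult_left_mono) simp
  finally show ?thesis by simp
qed

text \<open>
  The weighted squared distance to \<open>y\<close> is a potential: by convexity it drops in each round by \<open>2 * \<eta>\<close> times
  the suboptimality, up to an error of second order in \<open>\<eta>\<close>.
\<close>

lemma descent_regret:
  assumes \<eta>: "\<eta> > 0" and M: "well_formed n M" and y: "\<And>i. y i \<in> {B1..B2}"
  defines "W \<equiv> real n + real K * real (size M)"
  shows "2 * \<eta> * (\<Sum>t<T. objective n M (iterate \<eta> t M) - objective n M y) \<le> W * ((B2 - B1)\<^sup>2 + real T * (\<eta>\<^sup>2 * slope_bound\<^sup>2))"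
proof -
  define D where "D i = 1 + real (size (inbox i (\<lambda>_. 0 :: real) M))" for i
  have D: "D i = 1 + real (size (inbox i x M))" for i x
    using size_inbox_eq[of i "\<lambda>_. 0 :: real" M x] unfolding D_def by (simp only:)
  have W: "(\<Sum>i<n. D i) = W" unfolding D_def W_def by (rule sum_weights[OF M])
  define dist where "dist x = (\<Sum>i<n. D i * (x i - y i)\<^sup>2)" for x :: "nat \<Rightarrow> real"
  have step: "dist (iterate \<eta> (Suc t) M) + 2 * \<eta> * (objective n M (iterate \<eta> t M) - objective n M y)
     \<le> dist (iterate \<eta> t M) + W * (\<eta>\<^sup>2 * slope_bound\<^sup>2)" for t
  proof -
    define x where "x = iterate \<eta> t M"
    have "dist (iterate \<eta> (Suc t) M) \<le> (\<Sum>i<n. D i * (x i - y i)\<^sup>2 + 2 * \<eta> * (gradient (inbox i x M) * (y i - x i)) + \<eta>\<^sup>2 * slope_bound\<^sup>2 * D i)"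
      unfolding dist_def state.simps x_def[symmetric]
      by (intro sum_mono descend_step \<eta> y D) (simp only: D[symmetric] abs_gradient_le[OF M, folded D])
    also have "\<dots> = dist x + 2 * \<eta> * (\<Sum>i<n. gradient (inbox i x M) * (y i - x i)) + W * (\<eta>\<^sup>2 * slope_bound\<^sup>2)"
      unfolding W[symmetric] by (simp add: dist_def sum.distrib sum_distrib_left sum_distrib_right mult_ac)
    also have "2 * \<eta> * (\<Sum>i<n. gradient (inbox i x M) * (y i - x i)) \<le> 2 * \<eta> * (objective n M y - objective n M x)"
      using objective_gradient[OF M, of x y] \<eta> by (intro mult_left_mono) auto
    finally show ?thesis by (simp add: x_def algebra_simps)
  qed
  have "dist (iterate \<eta> T M) + 2 * \<eta> * (\<Sum>t<T. objective n M (iterate \<eta> t M) - objective n M y)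
     \<le> dist (iterate \<eta> 0 M) + real T * (W * (\<eta>\<^sup>2 * slope_bound\<^sup>2))"
  proof (induction T)
    case (Suc T)
    then show ?case using step[of T] by (simp add: algebra_simps del: state.simps)
  qed simp
  moreover have "dist (iterate \<eta> T M) \<ge> 0"
    unfolding dist_def D_def by (intro sum_nonneg mult_nonneg_nonneg) auto
  moreover have "dist (iterate \<eta> 0 M) \<le> W * (B2 - B1)\<^sup>2"
    unfolding dist_def W[symmetric] sum_distrib_right
  proof (intro sum_mono mult_left_mono)
    fix i
    have "\<bar>iterate \<eta> 0 M i - y i\<bar> \<le> B2 - B1" using y[of i] B12 by auto
    then show "(iterate \<eta> 0 M i - y i)\<^sup>2 \<le> (B2 - B1)\<^sup>2" using power_mono[of "\<bar>iterate \<eta> 0 M i - y i\<bar>" _ 2] by fastforce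
  qed (simp add: D_def)
  ultimately show ?thesis by (simp add: algebra_simps)
qed

lemma objective_ge:
  assumes "\<And>i. x i \<in> {B1..B2}"
  shows "objective n M x \<ge> wx * (real n * B1)"
proof -
  have "(\<Sum>i<n. B1) \<le> (\<Sum>i<n. x i)" using assms by (intro sum_mono) auto
  then have "wx * (real n * B1) \<le> wx * (\<Sum>i<n. x i)" using wx by (intro mult_left_mono) auto
  moreover have "(\<Sum>C\<in>#M. cost (snd C) (map x (fst C))) \<ge> 0"
    by (induction M) (auto simp: cost_nonneg)
  ultimately show ?thesis by (simp add: objective_def)
qed

lemma bdd_below_objective: "bdd_below (objective n M ` {x. \<forall>i. x i \<in> {B1..B2}})"
  using objective_ge by (intro bdd_belowI[of _ "wx * (real n * B1)"]) auto

lemma box_nonempty: "{x :: nat \<Rightarrow> real. \<forall>i. x i \<in> {B1..B2}} \<noteq> {}"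
  using B12 by (auto intro: exI[of _ "\<lambda>_. B1"])

lemma optimum_le: "(\<And>i. x i \<in> {B1..B2}) \<Longrightarrow> optimum n M \<le> objective n M x"
  unfolding optimum_def by (rule cINF_lower[OF bdd_below_objective]) simp

lemma optimum_ge: "(\<And>x. (\<And>i. x i \<in> {B1..B2}) \<Longrightarrow> l \<le> objective n M x) \<Longrightarrow> l \<le> optimum n M"
  unfolding optimum_def by (rule cINF_greatest[OF box_nonempty]) auto

lemma optimum_nonneg: "wx = 0 \<or> B1 \<ge> 0 \<Longrightarrow> optimum n M \<ge> 0"
  using wx by (intro optimum_ge order_trans[OF _ objective_ge]) auto

lemma optimum_add:
  assumes "s \<in> S" "length idx = K"
  shows "\<bar>optimum n (add_mset (idx, s) M) - optimum n M\<bar> \<le> cost_bound"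
proof -
  have "optimum n M \<le> optimum n (add_mset (idx, s) M)"
  proof (rule optimum_ge)
    fix x :: "nat \<Rightarrow> real" assume x: "\<And>i. x i \<in> {B1..B2}"
    have "objective n (add_mset (idx, s) M) x = objective n M x + cost s (map x idx)" by (simp add: objective_def)
    then show "optimum n M \<le> objective n (add_mset (idx, s) M) x"
      using cost_nonneg[of s "map x idx"] optimum_le[where x = x and n = n and M = M, OF x] by linarith
  qed
  moreover have "optimum n (add_mset (idx, s) M) - cost_bound \<le> optimum n M"
  proof (rule optimum_ge)
    fix x :: "nat \<Rightarrow> real" assume x: "\<And>i. x i \<in> {B1..B2}"
    have "objective n (add_mset (idx, s) M) x = objective n M x + cost s (map x idx)" by (simp add: objective_def)
    moreover have "cost s (map x idx) \<le> cost_bound" using assms x by (intro cost_le) auto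
    ultimately show "optimum n (add_mset (idx, s) M) - cost_bound \<le> objective n M x"
      using optimum_le[of x n "add_mset (idx, s) M"] x by fastforce
  qed
  ultimately show ?thesis using cost_bound_nonneg by linarith
qed

text \<open>
  The number of rounds and the step size depend on the accuracy \<open>e\<close> only. The average over the rounds is
  used because no single round is known to be good.
\<close>

lemma descent_near_optimal:
  assumes e: "e > 0"
  obtains \<eta> T where "T > 0"
    and "\<And>n M. optimum n M \<le> (\<Sum>t<T. objective n M (iterate \<eta> t M)) / real T"
    and "\<And>n M. well_formed n M \<Longrightarrow>
      (\<Sum>t<T. objective n M (iterate \<eta> t M)) / real T \<le> optimum n M + (real n + real K * real (size M)) * e"
proof -
  \<comment> \<open>The step size balances the second-order error; then \<open>T\<close> is chosen to absorb the initial distance.\<close>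
  define \<eta> where "\<eta> = e / (slope_bound\<^sup>2 + 1)"
  have \<eta>: "\<eta> > 0" using e by (simp add: \<eta>_def add_nonneg_pos)
  obtain T where T: "(B2 - B1)\<^sup>2 / (\<eta> * e) < real T" using reals_Archimedean2 by blast
  have "(B2 - B1)\<^sup>2 / (\<eta> * e) \<ge> 0" using \<eta> e by simp
  with T have T0: "T > 0" by linarith
  have \<eta>L: "\<eta> * slope_bound\<^sup>2 \<le> e"
    using e by (simp add: \<eta>_def divide_le_eq add_nonneg_pos mult_left_mono)
  show thesis
  proof (rule that[OF T0])
    fix n M
    have "real T * optimum n M \<le> (\<Sum>t<T. objective n M (iterate \<eta> t M))"
      using sum_bounded_below[of "{..<T}" "optimum n M" "\<lambda>t. objective n M (iterate \<eta> t M)"] optimum_le[OF iterate_in] by simp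
    then show "optimum n M \<le> (\<Sum>t<T. objective n M (iterate \<eta> t M)) / real T"
      using T0 by (simp add: field_simps)
  next
    fix n M assume M: "well_formed n M"
    define W where "W = real n + real K * real (size M)"
    have W: "W \<ge> 0" by (simp add: W_def)
    define A where "A = (\<Sum>t<T. objective n M (iterate \<eta> t M))"
    have "A / real T - W * e \<le> optimum n M"
    proof (rule optimum_ge)
      fix y :: "nat \<Rightarrow> real" assume y: "\<And>i. y i \<in> {B1..B2}"
      have "2 * \<eta> * (A - real T * objective n M y) \<le> W * ((B2 - B1)\<^sup>2 + real T * (\<eta>\<^sup>2 * slope_bound\<^sup>2))"
        using descent_regret[where T = T, OF \<eta> M y] by (simp add: A_def W_def sum_subtractf)
      also have "\<dots> \<le> W * (real T * \<eta> * e + real T * \<eta> * e)"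
      proof (intro mult_left_mono add_mono W)
        show "(B2 - B1)\<^sup>2 \<le> real T * \<eta> * e" using T \<eta> e by (simp add: field_simps)
        show "real T * (\<eta>\<^sup>2 * slope_bound\<^sup>2) \<le> real T * \<eta> * e"
          using mult_left_mono[OF \<eta>L, of "real T * \<eta>"] \<eta> by (simp add: power2_eq_square mult_ac)
      qed
      also have "\<dots> = 2 * \<eta> * (real T * (W * e))" by (simp add: algebra_simps)
      finally have "A - real T * objective n M y \<le> real T * (W * e)"
        using \<eta> by simp
      then show "A / real T - W * e \<le> objective n M y"
        using T0 by (simp add: field_simps)
    qed
    then show "(\<Sum>t<T. objective n M (iterate \<eta> t M)) / real T \<le> optimum n M + (real n + real K * real (size M)) * e"
      by (simp add: A_def W_def)
  qed
qed


section \<open>The optimum concentrates around a linear function of the size\<close>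

text \<open>
  The averaged objective of the iterates is a local statistic whose mean converges, and it approximates
  the optimum uniformly in the size of the instance.
\<close>

lemma mean_limit:
  assumes c: "c \<ge> 0"
  shows "\<exists>f. ((\<lambda>z. (avg {0..<fst z} ^^ snd z) (optimum (fst z)) {#} / real (fst z)) \<longlongrightarrow> f) (sparse_regime c)"
proof (rule filter_limit_of_approximations[OF sparse_not_bot[OF c]])
  fix e :: real assume e: "e > 0"
  define e' where "e' = e / (1 + real K * (c + 1))"
  have pos: "1 + real K * (c + 1) > 0" using c by (simp add: add_pos_nonneg)
  have e': "e' > 0" using e pos by (simp add: e'_def)
  obtain \<eta> T where T: "T > 0"
    and lower: "\<And>n M. optimum n M \<le> (\<Sum>t<T. objective n M (iterate \<eta> t M)) / real T"
    and upper: "\<And>n M. well_formed n M \<Longrightarrow>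
      (\<Sum>t<T. objective n M (iterate \<eta> t M)) / real T \<le> optimum n M + (real n + real K * real (size M)) * e'"
    by (rule descent_near_optimal[OF e']) (rule that)
  define w where "w z = (avg {0..<fst z} ^^ snd z) (\<lambda>M. (\<Sum>t<T. objective (fst z) M (iterate \<eta> t M)) / real T) {#} / real (fst z)" for z
  have "\<exists>L. ((\<lambda>z. (avg {0..<fst z} ^^ snd z) (\<lambda>M. objective (fst z) M (iterate \<eta> t M)) {#} / real (fst z)) \<longlongrightarrow> L) (sparse_regime c)" for t
  proof -
    have "\<bar>clip x\<bar> \<le> \<bar>B1\<bar> + \<bar>B2\<bar>" for x using clip_in[of x] by auto
    from vertex_average_limit[where g = clip and upd = "descend \<eta>" and ?v0.0 = B1 and t = t, OF c this]
    obtain L1 where L1: "((\<lambda>z. (avg {0..<fst z} ^^ snd z) (\<lambda>M. \<Sum>i<fst z. iterate \<eta> t M i) {#} / real (fst z)) \<longlongrightarrow> L1) (sparse_regime c)"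
      unfolding clip_id[OF iterate_in] by (rule exE)
    \<comment> \<open>Clipping makes the penalty bounded on all lists and does not change it on iterates.\<close>
    define g where "g s xs = (if length xs = K then cost s (map clip xs) else 0)" for s xs
    have "\<bar>g s xs\<bar> \<le> cost_bound" if "s \<in> S" for s xs
    proof -
      have "set (map clip xs) \<subseteq> {B1..B2}" using clip_in by auto
      then have "length xs = K \<Longrightarrow> cost s (map clip xs) \<le> cost_bound"
        by (intro cost_le that) auto
      then show ?thesis using cost_nonneg[of s "map clip xs"] cost_bound_nonneg by (simp add: g_def)
    qed
    from constraint_average_limit[where g = g and upd = "descend \<eta>" and ?v0.0 = B1 and t = t, OF c this]
    obtain L2 where L2: "((\<lambda>z. (avg {0..<fst z} ^^ snd z)
        (\<lambda>M. \<Sum>C\<in>#M. g (snd C) (map (iterate \<eta> t M) (fst C))) {#} / real (fst z)) \<longlongrightarrow> L2) (sparse_regime c)"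
      by (rule exE)
    have "(avg {0..<n} ^^ m) (\<lambda>M. objective n M (iterate \<eta> t M)) {#}
      = (avg {0..<n} ^^ m) (\<lambda>M. wx * (\<Sum>i<n. iterate \<eta> t M i) + (\<Sum>C\<in>#M. g (snd C) (map (iterate \<eta> t M) (fst C)))) {#}" for n m
    proof (rule avg_funpow_cong[where P = "well_formed n"])
      fix M assume M: "well_formed n M"
      have "cost (snd C) (map (iterate \<eta> t M) (fst C)) = g (snd C) (map (iterate \<eta> t M) (fst C))" if "C \<in># M" for C
        using M that by (auto simp: g_def well_formed_def o_def clip_id[OF iterate_in])
      then show "objective n M (iterate \<eta> t M) = wx * (\<Sum>i<n. iterate \<eta> t M i) + (\<Sum>C\<in>#M. g (snd C) (map (iterate \<eta> t M) (fst C)))"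
        unfolding objective_def by (simp cong: image_mset_cong)
    qed (rule well_formed_add, assumption+, simp add: well_formed_def)
    then have eq: "(avg {0..<n} ^^ m) (\<lambda>M. objective n M (iterate \<eta> t M)) {#} / real n
      = wx * ((avg {0..<n} ^^ m) (\<lambda>M. \<Sum>i<n. iterate \<eta> t M i) {#} / real n)
       + (avg {0..<n} ^^ m) (\<lambda>M. \<Sum>C\<in>#M. g (snd C) (map (iterate \<eta> t M) (fst C))) {#} / real n" for n m
      by (simp only: avg_funpow_add avg_funpow_cmult add_divide_distrib times_divide_eq_right)
    show ?thesis
      unfolding eq by (rule exI) (rule tendsto_add[OF tendsto_mult[OF tendsto_const[of wx] L1] L2])
  qed
  then have "\<forall>t. \<exists>L. ((\<lambda>z. (avg {0..<fst z} ^^ snd z) (\<lambda>M. objective (fst z) M (iterate \<eta> t M)) {#} / real (fst z)) \<longlongrightarrow> L) (sparse_regime c)" ..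
  from choice[OF this] obtain L where L: "\<And>t. ((\<lambda>z. (avg {0..<fst z} ^^ snd z) (\<lambda>M. objective (fst z) M (iterate \<eta> t M)) {#} / real (fst z)) \<longlongrightarrow> L t) (sparse_regime c)"
    by auto
  have w: "w = (\<lambda>z. \<Sum>t<T. (1 / real T) * ((avg {0..<fst z} ^^ snd z) (\<lambda>M. objective (fst z) M (iterate \<eta> t M)) {#} / real (fst z)))"
  proof
    fix z :: "nat \<times> nat"
    have "(\<lambda>M. (\<Sum>t<T. objective (fst z) M (iterate \<eta> t M)) / real T) = (\<lambda>M. \<Sum>t<T. (1 / real T) * objective (fst z) M (iterate \<eta> t M))"
      by (simp add: sum_divide_distrib)
    then show "w z = (\<Sum>t<T. (1 / real T) * ((avg {0..<fst z} ^^ snd z) (\<lambda>M. objective (fst z) M (iterate \<eta> t M)) {#} / real (fst z)))"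
      unfolding w_def by (simp only: avg_funpow_sum) (simp add: sum_divide_distrib)
  qed
  have "(w \<longlongrightarrow> (\<Sum>t<T. (1 / real T) * L t)) (sparse_regime c)"
    unfolding w by (intro tendsto_sum tendsto_mult tendsto_const L)
  moreover have "\<forall>\<^sub>F z in sparse_regime c. \<bar>(avg {0..<fst z} ^^ snd z) (optimum (fst z)) {#} / real (fst z) - w z\<bar> \<le> e"
    using eventually_card_tuples_pos[of 0] eventually_fst_sparse[of 1] order_tendstoD(2)[OF tendsto_ratio_sparse, of c "c + 1", simplified]
  proof eventually_elim
    case (elim z)
    obtain n m where z: "z = (n, m)" by (cases z)
    have V: "finite {0..<n}" "tuples {0..<n} \<noteq> {}" and n: "n > 0" and mn: "real m / real n < c + 1"
      using elim by (auto simp: z)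
    define A where "A M = (\<Sum>t<T. objective n M (iterate \<eta> t M)) / real T" for M
    define a where "a = (avg {0..<n} ^^ m) A {#}"
    define v where "v = (avg {0..<n} ^^ m) (optimum n) {#}"
    have "v \<le> a"
      unfolding v_def a_def by (rule avg_funpow_mono[where P = "\<lambda>_. True"]) (auto simp: A_def lower)
    have "(avg {0..<n} ^^ m) A M \<le> (avg {0..<n} ^^ m) (optimum n) M + (real n + real K * real (size M + m)) * e'" if "well_formed n M" for M
      using that
    proof (induction m arbitrary: M)
      case 0 then show ?case using upper by (simp add: A_def)
    next
      case (Suc m)
      have "(avg {0..<n} ^^ Suc m) A M \<le> avg {0..<n} (\<lambda>N. (avg {0..<n} ^^ m) (optimum n) N + (real n + real K * real (size M + Suc m)) * e') M"
        unfolding avg_def[of _ "(avg {0..<n} ^^ m) A"] funpow.simps o_apply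
        unfolding avg_def[of _ "\<lambda>N. (avg {0..<n} ^^ m) (optimum n) N + (real n + real K * real (size M + Suc m)) * e'"]
      proof (intro divide_right_mono adjoin_mono)
        fix idx s assume "idx \<in> tuples {0..<n}" "s \<in> S"
        from Suc.IH[OF well_formed_add[OF Suc.prems this]]
        show "(avg {0..<n} ^^ m) A (add_mset (idx, s) M) \<le> (avg {0..<n} ^^ m) (optimum n) (add_mset (idx, s) M) + (real n + real K * real (size M + Suc m)) * e'"
          by simp
      qed simp
      then show ?case
        using avg_funpow_add[where V = "{0..<n}" and m = 1 and G = "(avg {0..<n} ^^ m) (optimum n)"] avg_const[OF V] by simp
    qed
    from this[of "{#}"] have "a \<le> v + (real n + real K * real m) * e'"
      by (simp add: a_def v_def well_formed_def)
    then have "(a - v) / real n \<le> (real n + real K * real m) * e' / real n"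
      by (intro divide_right_mono) auto
    also have "\<dots> = (1 + real K * (real m / real n)) * e'"
      using n by (simp add: field_simps)
    also have "\<dots> \<le> (1 + real K * (c + 1)) * e'"
      using mn e' by (intro mult_right_mono add_left_mono mult_left_mono) auto
    also have "\<dots> = e" using pos by (simp add: e'_def)
    finally have "(a - v) / real n \<le> e" .
    moreover have "(a - v) / real n \<ge> 0" using \<open>v \<le> a\<close> by simp
    ultimately show ?case
      by (simp add: z w_def A_def[symmetric] a_def[symmetric] v_def[symmetric] diff_divide_distrib abs_if)
  qed
  ultimately show "\<exists>w l. (w \<longlongrightarrow> l) (sparse_regime c) \<and> (\<forall>\<^sub>F z in sparse_regime c. \<bar>(avg {0..<fst z} ^^ snd z) (optimum (fst z)) {#} / real (fst z) - w z\<bar> \<le> e)"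
    by blast
qed

text \<open>
  The variance of the optimum is at most of order \<open>m\<close>, that of the optimum per variable at most of order
  \<open>1 / n\<close>, and
  Chebyshev's inequality applies.
\<close>

lemma concentration:
  assumes c: "c \<ge> 0"
  shows "\<exists>f. (wx = 0 \<or> B1 \<ge> 0 \<longrightarrow> f \<ge> 0) \<and> (\<forall>e>0. ((\<lambda>z. (avg {0..<fst z} ^^ snd z)
     (\<lambda>M. of_bool (\<bar>optimum (fst z) M / real (fst z) - f\<bar> > e)) {#}) \<longlongrightarrow> 0) (sparse_regime c))"
proof -
  define v where "v z = (avg {0..<fst z} ^^ snd z) (optimum (fst z)) {#} / real (fst z)" for z :: "nat \<times> nat"
  obtain f where f: "(v \<longlongrightarrow> f) (sparse_regime c)"
    using mean_limit[OF c] unfolding v_def by blast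
  have "f \<ge> 0" if "wx = 0 \<or> B1 \<ge> 0"
  proof (rule tendsto_lowerbound[OF f _ sparse_not_bot[OF c]])
    have "v z \<ge> 0" for z
    proof -
      have "(avg {0..<fst z} ^^ snd z) (\<lambda>M. 0 * optimum (fst z) M) {#} \<le> (avg {0..<fst z} ^^ snd z) (optimum (fst z)) {#}"
        using optimum_nonneg[OF that] by (intro avg_funpow_mono[where P = "\<lambda>_. True"]) auto
      then show ?thesis unfolding avg_funpow_cmult by (simp add: v_def)
    qed
    then show "\<forall>\<^sub>F z in sparse_regime c. 0 \<le> v z" by simp
  qed
  moreover have "((\<lambda>z. (avg {0..<fst z} ^^ snd z) (\<lambda>M. of_bool (\<bar>optimum (fst z) M / real (fst z) - f\<bar> > e)) {#}) \<longlongrightarrow> 0) (sparse_regime c)"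
    if e: "e > 0" for e
  proof (rule tendsto_sandwich[of "\<lambda>_. 0"])
    \<comment> \<open>Variance plus squared bias of the optimum per variable, divided by \<open>e\<^sup>2\<close>.\<close>
    define u where "u z = (cost_bound\<^sup>2 * (real (snd z) / real (fst z)) * (1 / real (fst z)) + (v z - f)\<^sup>2) / e\<^sup>2" for z
    have "(u \<longlongrightarrow> (cost_bound\<^sup>2 * c * 0 + (f - f)\<^sup>2) / e\<^sup>2) (sparse_regime c)"
      unfolding u_def by (intro tendsto_intros tendsto_ratio_sparse tendsto_const_over_fst f) (use e in auto)
    then show "(u \<longlongrightarrow> 0) (sparse_regime c)" by simp
    show "\<forall>\<^sub>F z in sparse_regime c. (avg {0..<fst z} ^^ snd z) (\<lambda>M. of_bool (\<bar>optimum (fst z) M / real (fst z) - f\<bar> > e)) {#} \<le> u z"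
      using eventually_card_tuples_pos[of 0] eventually_fst_sparse[of 1]
    proof eventually_elim
      case (elim z)
      obtain n m where z: "z = (n, m)" by (cases z)
      have V: "finite {0..<n}" "tuples {0..<n} \<noteq> {}" and n: "n > 0" using elim by (auto simp: z)
      define E where "E H = (avg {0..<n} ^^ m) H {#}" for H
      have "E (\<lambda>M. (optimum n M)\<^sup>2) - (E (optimum n))\<^sup>2 \<le> real m * cost_bound\<^sup>2"
        unfolding E_def
      proof (rule avg_variance_le[where P = "\<lambda>_. True", OF V])
        fix M idx s assume "idx \<in> tuples {0..<n}" "s \<in> S"
        then show "\<bar>optimum n (add_mset (idx, s) M) - optimum n M\<bar> \<le> cost_bound"
          by (intro optimum_add) (auto simp: tuples_def)
      qed auto
      then have var: "E (\<lambda>M. (optimum n M)\<^sup>2) / (real n)\<^sup>2 \<le> cost_bound\<^sup>2 * (real m / real n) * (1 / real n) + (v z)\<^sup>2"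
        using n by (simp add: v_def z E_def field_simps power2_eq_square)
      have "E (\<lambda>M. of_bool (\<bar>optimum n M / real n - f\<bar> > e)) \<le> E (\<lambda>M. (1 / e\<^sup>2) * (optimum n M / real n - f)\<^sup>2)"
        unfolding E_def
      proof (rule avg_funpow_mono[where P = "\<lambda>_. True"])
        fix M
        show "of_bool (\<bar>optimum n M / real n - f\<bar> > e) \<le> (1 / e\<^sup>2) * (optimum n M / real n - f)\<^sup>2"
          using e power_mono[of e "\<bar>optimum n M / real n - f\<bar>" 2] by (auto simp: of_bool_def)
      qed auto
      also have "\<dots> = (1 / e\<^sup>2) * E (\<lambda>M. (optimum n M / real n - f)\<^sup>2)"
        unfolding E_def by (rule avg_funpow_cmult)
      also have "(\<lambda>M. (optimum n M / real n - f)\<^sup>2)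
          = (\<lambda>M. (1 / (real n)\<^sup>2) * (optimum n M)\<^sup>2 + ((- 2 * f / real n) * optimum n M + f\<^sup>2))"
        using n by (intro ext) (simp add: power2_eq_square field_simps)
      also have "E \<dots> = E (\<lambda>M. (optimum n M)\<^sup>2) / (real n)\<^sup>2 - 2 * f * v z + f\<^sup>2"
        unfolding E_def avg_funpow_add avg_funpow_cmult avg_funpow_const[OF V] by (simp add: v_def z)
      also have "(1 / e\<^sup>2) * \<dots> \<le> (1 / e\<^sup>2) * (cost_bound\<^sup>2 * (real m / real n) * (1 / real n) + (v z)\<^sup>2 - 2 * f * v z + f\<^sup>2)"
        using var by (intro mult_left_mono) auto
      also have "\<dots> = u z"
        unfolding u_def by (simp add: z power2_eq_square algebra_simps add_divide_distrib diff_divide_distrib)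
      finally show ?case by (simp add: E_def z)
    qed
    show "\<forall>\<^sub>F z in sparse_regime c. 0 \<le> (avg {0..<fst z} ^^ snd z) (\<lambda>M. of_bool (\<bar>optimum (fst z) M / real (fst z) - f\<bar> > e)) {#}"
    proof (rule always_eventually, rule allI)
      fix z :: "nat \<times> nat"
      define H where "H M = (of_bool (\<bar>optimum (fst z) M / real (fst z) - f\<bar> > e) :: real)" for M
      have "(avg {0..<fst z} ^^ snd z) (\<lambda>M. 0 * H M) {#} \<le> (avg {0..<fst z} ^^ snd z) H {#}"
        by (intro avg_funpow_mono[where P = "\<lambda>_. True"]) (auto simp: H_def)
      then show "0 \<le> (avg {0..<fst z} ^^ snd z) (\<lambda>M. of_bool (\<bar>optimum (fst z) M / real (fst z) - f\<bar> > e)) {#}"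
        unfolding avg_funpow_cmult by (simp add: H_def[abs_def])
    qed
  qed simp
  ultimately show ?thesis by blast
qed

end

section \<open>From the random instance to the averaging operator\<close>

lemma measurable_map_upt:
  fixes \<rho> :: "'c \<Rightarrow> 'd::countable"
  assumes \<rho>: "\<rho> \<in> measurable N (count_space UNIV)" and "k \<le> m"
  shows "(\<lambda>C. map (\<lambda>j. \<rho> (C j)) [0..<k]) \<in> measurable (\<Pi>\<^sub>M j\<in>{..<m}. N) (count_space UNIV)"
  using \<open>k \<le> m\<close>
proof (induction k)
  case (Suc k)
  have "(\<lambda>C. l @ [\<rho> (C k)]) \<in> measurable (\<Pi>\<^sub>M j\<in>{..<m}. N) (count_space UNIV)" for l
  proof -
    have "(\<lambda>C. \<rho> (C k)) \<in> measurable (\<Pi>\<^sub>M j\<in>{..<m}. N) (count_space UNIV)"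
      using Suc.prems by (intro measurable_compose[OF _ \<rho>] measurable_component_singleton) auto
    from measurable_compose[OF this, of "\<lambda>c. l @ [c]" "count_space UNIV"] show ?thesis by simp
  qed
  from measurable_compose_countable[OF this Suc.IH] Suc.prems show ?case by simp
qed simp

text \<open>
  The discretisation \<open>\<rho>\<close> sends the constraints of the random instance to a countable type. Integrating out
  the last constraint applies the averaging operator once.
\<close>

lemma integral_PiM_eq_avg:
  fixes S :: "'s::countable set" and N :: "'c measure" and \<rho> :: "'c \<Rightarrow> 's con"
  assumes "sparse_model K S p"
    and N: "prob_space N" and \<rho>: "\<rho> \<in> measurable N (count_space UNIV)"
    and law: "\<And>h B. (\<And>C. \<bar>h C\<bar> \<le> B) \<Longrightarrow> (\<integral>c. h (\<rho> c) \<partial>N)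
      = (\<Sum>idx\<in>sparse_model.tuples K repl V. \<Sum>s\<in>S. p s * h (idx, s)) / real (card (sparse_model.tuples K repl V))"
    and V: "finite V" and HB: "\<And>M. \<bar>H M\<bar> \<le> B"
  shows "(\<integral>C. H (mset (map (\<lambda>j. \<rho> (C j)) [0..<m]) + Q) \<partial>(\<Pi>\<^sub>M j\<in>{..<m}. N))
    = (sparse_model.avg K repl S p V ^^ m) H Q"
proof -
  interpret sparse_model K repl S p by fact
  interpret N: prob_space N by (rule N)
  interpret product_prob_space "\<lambda>_::nat. N" UNIV by unfold_locales
  show ?thesis
    using HB
  proof (induction m arbitrary: H B)
    case 0
    interpret inst: prob_space "\<Pi>\<^sub>M j\<in>{..<0::nat}. N" by (intro prob_space_PiM N)
    show ?case using inst.prob_space by simp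
  next
    case (Suc m)
    define L where "L m C = mset (map (\<lambda>j. \<rho> (C j)) [0..<m]) + Q" for m and C :: "nat \<Rightarrow> 'c"
    interpret inst: prob_space "\<Pi>\<^sub>M j\<in>{..<Suc m}. N" by (intro prob_space_PiM N)
    have "(\<lambda>C. H (L (Suc m) C)) \<in> borel_measurable (\<Pi>\<^sub>M j\<in>{..<Suc m}. N)"
      using measurable_compose[OF measurable_map_upt[OF \<rho> order_refl, of "Suc m"], of "\<lambda>l. H (mset l + Q)" borel] by (simp add: L_def)
    then have int: "integrable (\<Pi>\<^sub>M j\<in>{..<Suc m}. N) (\<lambda>C. H (L (Suc m) C))"
      by (intro inst.integrable_const_bound[of _ B]) (auto intro!: AE_I2 Suc.prems)
    have upd: "L (Suc m) (C(m := c)) = add_mset (\<rho> c) (L m C)" for C c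
      by (auto simp: L_def intro!: image_mset_cong)
    have "(\<integral>C. H (L (Suc m) C) \<partial>(\<Pi>\<^sub>M j\<in>{..<Suc m}. N))
      = (\<integral>C. (\<integral>c. H (L (Suc m) (C(m := c))) \<partial>N) \<partial>(\<Pi>\<^sub>M j\<in>{..<m}. N))"
      using product_integral_insert[of "{..<m}" m "\<lambda>C. H (L (Suc m) C)"] int
      by (simp add: lessThan_Suc)
    also have "\<dots> = (\<integral>C. avg V H (L m C) \<partial>(\<Pi>\<^sub>M j\<in>{..<m}. N))"
      unfolding upd by (subst law[where B = B]) (auto simp: Suc.prems avg_def adjoin_def)
    also have "\<dots> = (avg V ^^ m) (avg V H) Q"
      unfolding L_def
    proof (rule Suc.IH)
      show "\<bar>avg V H M\<bar> \<le> B" for M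
        using abs_avg_funpow_le[OF V Suc.prems, of 1] by simp
    qed
    finally show ?case
      by (simp add: L_def funpow_swap1)
  qed
qed

section \<open>Rounding the noise\<close>

text \<open>
  Rounded noise is kept as an integer level, which makes the type of labels countable; \<open>level_bound\<close>
  below multiplies the level by \<open>\<delta>\<close> again.
\<close>

definition round_noise :: "real \<Rightarrow> glp_constraint \<Rightarrow> nat list \<times> nat \<times> int" where
  "round_noise \<delta> C = (case C of (idx, r, W) \<Rightarrow> (idx, r, \<lfloor>W / \<delta>\<rfloor>))"

text \<open>
  A finite set that carries the whole distribution of the labels, since the noise is bounded.
\<close>

definition noise_levels :: "nat \<Rightarrow> real \<Rightarrow> real \<Rightarrow> (nat \<times> int) set" where
  "noise_levels R Bw \<delta> = {..<R} \<times> {\<lfloor>- Bw / \<delta>\<rfloor>..\<lfloor>Bw / \<delta>\<rfloor>}"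

definition noise_weight :: "nat \<Rightarrow> real measure \<Rightarrow> real \<Rightarrow> nat \<times> int \<Rightarrow> real" where
  "noise_weight R \<mu> \<delta> s = measure \<mu> {w. \<lfloor>w / \<delta>\<rfloor> = snd s} / real R"

lemma measurable_floor_divide:
  fixes \<delta> :: real
  assumes "sets \<mu> = sets borel"
  shows "(\<lambda>w. \<lfloor>w / \<delta>\<rfloor>) \<in> measurable \<mu> (count_space UNIV)"
proof -
  have "(\<lambda>w. w / \<delta>) \<in> measurable borel borel" by simp
  then have "(\<lambda>w. \<lfloor>w / \<delta>\<rfloor>) \<in> measurable borel (count_space UNIV)"
    by (rule measurable_compose[OF _ measurable_real_floor])
  then show ?thesis using measurable_cong_sets[OF assms refl] by blast
qed

lemma integral_rounded:
  fixes g :: "int \<Rightarrow> real" and Bw \<delta> :: real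
  assumes "prob_space \<mu>" and sets: "sets \<mu> = sets borel" and AE: "AE w in \<mu>. w \<in> {-Bw..Bw}" and \<delta>: "\<delta> > 0"
  shows "(\<integral>w. g \<lfloor>w / \<delta>\<rfloor> \<partial>\<mu>) = (\<Sum>z\<in>{\<lfloor>- Bw / \<delta>\<rfloor>..\<lfloor>Bw / \<delta>\<rfloor>}. measure \<mu> {w. \<lfloor>w / \<delta>\<rfloor> = z} * g z)"
proof -
  interpret prob_space \<mu> by fact
  let ?Z = "{\<lfloor>- Bw / \<delta>\<rfloor>..\<lfloor>Bw / \<delta>\<rfloor>}"
  have sp: "space \<mu> = UNIV" using sets_eq_imp_space_eq[OF sets] by simp
  have fl: "(\<lambda>w. \<lfloor>w / \<delta>\<rfloor>) \<in> measurable \<mu> (count_space UNIV)"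
    by (rule measurable_floor_divide[OF sets])
  have m: "{w. \<lfloor>w / \<delta>\<rfloor> = z} \<in> sets \<mu>" for z
    using measurable_sets[OF fl, of "{z}"] by (simp add: sp vimage_def)
  have "(\<integral>w. g \<lfloor>w / \<delta>\<rfloor> \<partial>\<mu>) = (\<integral>w. (\<Sum>z\<in>?Z. indicator {w. \<lfloor>w / \<delta>\<rfloor> = z} w * g z) \<partial>\<mu>)"
  proof (rule integral_cong_AE)
    show "AE w in \<mu>. g \<lfloor>w / \<delta>\<rfloor> = (\<Sum>z\<in>?Z. indicator {w. \<lfloor>w / \<delta>\<rfloor> = z} w * g z)"
      using AE
    proof eventually_elim
      case (elim w)
      then have "\<lfloor>w / \<delta>\<rfloor> \<in> ?Z" using divide_right_mono[of "- Bw" w \<delta>] divide_right_mono[of w Bw \<delta>] \<delta>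
        by (auto intro!: floor_mono)
      moreover have "indicator {w. \<lfloor>w / \<delta>\<rfloor> = z} w * g z = (if z = \<lfloor>w / \<delta>\<rfloor> then g z else 0)" for z
        by (auto simp: indicator_def)
      ultimately show ?case by simp
    qed
    from measurable_compose[OF fl, of g borel]
    show "(\<lambda>w. g \<lfloor>w / \<delta>\<rfloor>) \<in> borel_measurable \<mu>" by simp
    show "(\<lambda>w. \<Sum>z\<in>?Z. indicator {w. \<lfloor>w / \<delta>\<rfloor> = z} w * g z) \<in> borel_measurable \<mu>"
      using m by measurable
  qed
  also have "\<dots> = (\<Sum>z\<in>?Z. measure \<mu> {w. \<lfloor>w / \<delta>\<rfloor> = z} * g z)"
    using m by (subst Bochner_Integration.integral_sum) (auto simp: sp emeasure_eq_measure)
  finally show ?thesis .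
qed

lemma sparse_model_noise:
  assumes "K \<ge> 1" "R \<ge> 1" "prob_space \<mu>" "sets \<mu> = sets borel" "AE w in \<mu>. w \<in> {-Bw..Bw}" "\<delta> > 0"
  shows "sparse_model K (noise_levels R Bw \<delta>) (noise_weight R \<mu> \<delta>)"
proof
  interpret prob_space \<mu> by fact
  show "(\<Sum>s\<in>noise_levels R Bw \<delta>. noise_weight R \<mu> \<delta> s) = 1"
  proof -
    have "(\<Sum>s\<in>noise_levels R Bw \<delta>. noise_weight R \<mu> \<delta> s)
      = (\<Sum>r<R. \<Sum>z\<in>{\<lfloor>- Bw / \<delta>\<rfloor>..\<lfloor>Bw / \<delta>\<rfloor>}. measure \<mu> {w. \<lfloor>w / \<delta>\<rfloor> = z} / real R)"
      by (simp add: noise_levels_def noise_weight_def sum.cartesian_product')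
    also have "(\<Sum>z\<in>{\<lfloor>- Bw / \<delta>\<rfloor>..\<lfloor>Bw / \<delta>\<rfloor>}. measure \<mu> {w. \<lfloor>w / \<delta>\<rfloor> = z} / real R) = 1 / real R"
      using integral_rounded[OF assms(3-6), of "\<lambda>_. 1"] by (simp add: sum_divide_distrib[symmetric] prob_space)
    finally show ?thesis using assms(2) by simp
  qed
qed (use assms in \<open>auto simp: noise_levels_def noise_weight_def\<close>)

lemma sparse_model_tuples: "sparse_model K S p \<Longrightarrow> sparse_model.tuples K repl {0..<n} = index_tuples repl K n"
  by (simp add: sparse_model.tuples_def index_tuples_def atLeast0LessThan)

lemma index_tuples_finite_nonempty:
  assumes "K \<le> n"
  shows "finite (index_tuples repl K n)" "index_tuples repl K n \<noteq> {}"
proof -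
  show "finite (index_tuples repl K n)"
    unfolding index_tuples_def by (rule finite_subset[OF _ finite_lists_length_eq[of "{..<n}" K]]) auto
  have "[0..<K] \<in> index_tuples repl K n" using assms by (auto simp: index_tuples_def)
  then show "index_tuples repl K n \<noteq> {}" by blast
qed

lemma measurable_round_noise:
  assumes sets: "sets \<mu> = sets borel"
  shows "round_noise \<delta> \<in> measurable (constraint_measure repl K R \<mu> n) (count_space UNIV)"
proof -
  let ?N = "constraint_measure repl K R \<mu> n"
  have 1: "fst \<in> measurable ?N (count_space UNIV)" and 2: "(\<lambda>C. fst (snd C)) \<in> measurable ?N (count_space UNIV)"
    and 3: "(\<lambda>C. snd (snd C)) \<in> measurable ?N \<mu>"
    unfolding constraint_measure_def by measurable
  from measurable_compose[OF 3 measurable_floor_divide[OF sets]]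
  have 4: "(\<lambda>C. \<lfloor>snd (snd C) / \<delta>\<rfloor>) \<in> measurable ?N (count_space UNIV)" .
  have "(\<lambda>C. (idx, r, \<lfloor>snd (snd C) / \<delta>\<rfloor>)) \<in> measurable ?N (count_space UNIV)" for idx :: "nat list" and r :: nat
    using measurable_compose[OF 4, of "\<lambda>z. (idx, r, z)" "count_space UNIV"] by simp
  from measurable_compose_countable[OF this 2]
  have "(\<lambda>C. (idx, fst (snd C), \<lfloor>snd (snd C) / \<delta>\<rfloor>)) \<in> measurable ?N (count_space UNIV)" for idx :: "nat list" .
  from measurable_compose_countable[OF this 1]
  show ?thesis by (simp add: round_noise_def[abs_def] case_prod_unfold)
qed

lemma prob_space_constraint_measure: "prob_space \<mu> \<Longrightarrow> prob_space (constraint_measure repl K R \<mu> n)"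
  unfolding constraint_measure_def
  by (intro prob_space_pair measure_pmf.prob_space_axioms)

lemma integral_round_noise:
  fixes h :: "nat list \<times> nat \<times> int \<Rightarrow> real"
  assumes R: "R \<ge> 1" and \<mu>: "prob_space \<mu>" and sets: "sets \<mu> = sets borel" and AE: "AE w in \<mu>. w \<in> {-Bw..Bw}"
    and \<delta>: "\<delta> > 0" and n: "K \<le> n" and hB: "\<And>C. \<bar>h C\<bar> \<le> B"
  shows "(\<integral>C. h (round_noise \<delta> C) \<partial>constraint_measure repl K R \<mu> n)
    = (\<Sum>idx\<in>index_tuples repl K n. \<Sum>s\<in>noise_levels R Bw \<delta>. noise_weight R \<mu> \<delta> s * h (idx, s))
      / real (card (index_tuples repl K n))"
proof -
  interpret \<mu>: prob_space \<mu> by fact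
  define P1 where "P1 = measure_pmf (pmf_of_set (index_tuples repl K n))"
  define P2 where "P2 = measure_pmf (pmf_of_set {..<R})"
  interpret P1: prob_space P1 unfolding P1_def by (rule measure_pmf.prob_space_axioms)
  interpret P2: prob_space P2 unfolding P2_def by (rule measure_pmf.prob_space_axioms)
  interpret P2\<mu>: pair_prob_space P2 \<mu> ..
  interpret N: pair_prob_space P1 "P2 \<Otimes>\<^sub>M \<mu>" ..
  have N: "constraint_measure repl K R \<mu> n = P1 \<Otimes>\<^sub>M (P2 \<Otimes>\<^sub>M \<mu>)"
    by (simp add: constraint_measure_def P1_def P2_def)
  have meas: "(\<lambda>C. h (round_noise \<delta> C)) \<in> borel_measurable (P1 \<Otimes>\<^sub>M (P2 \<Otimes>\<^sub>M \<mu>))"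
    using measurable_compose[OF measurable_round_noise[OF sets], of h borel \<delta> repl K R n] by (simp add: N)
  have "(\<integral>C. h (round_noise \<delta> C) \<partial>constraint_measure repl K R \<mu> n)
     = (\<integral>idx. (\<integral>y. h (round_noise \<delta> (idx, y)) \<partial>(P2 \<Otimes>\<^sub>M \<mu>)) \<partial>P1)"
    unfolding N using meas hB
    by (intro N.integral_fst'[symmetric] N.integrable_const_bound[of _ B]) auto
  also have "\<dots> = (\<integral>idx. (\<integral>r. (\<integral>w. h (idx, r, \<lfloor>w / \<delta>\<rfloor>) \<partial>\<mu>) \<partial>P2) \<partial>P1)"
  proof (rule Bochner_Integration.integral_cong[OF refl])
    fix idx
    have "(\<lambda>y. h (round_noise \<delta> (idx, y))) \<in> borel_measurable (P2 \<Otimes>\<^sub>M \<mu>)"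
      using measurable_compose[OF measurable_Pair1'[of idx P1 "P2 \<Otimes>\<^sub>M \<mu>"] meas] by (simp add: P1_def)
    then have "(\<integral>y. h (round_noise \<delta> (idx, y)) \<partial>(P2 \<Otimes>\<^sub>M \<mu>)) = (\<integral>r. (\<integral>w. h (round_noise \<delta> (idx, r, w)) \<partial>\<mu>) \<partial>P2)"
      using hB by (intro P2\<mu>.integral_fst'[symmetric] P2\<mu>.integrable_const_bound[of _ B]) auto
    then show "(\<integral>y. h (round_noise \<delta> (idx, y)) \<partial>(P2 \<Otimes>\<^sub>M \<mu>)) = (\<integral>r. (\<integral>w. h (idx, r, \<lfloor>w / \<delta>\<rfloor>) \<partial>\<mu>) \<partial>P2)"
      by (simp add: round_noise_def)
  qed
  also have "\<dots> = (\<Sum>idx\<in>index_tuples repl K n. \<Sum>r<R.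
      (\<Sum>z\<in>{\<lfloor>- Bw / \<delta>\<rfloor>..\<lfloor>Bw / \<delta>\<rfloor>}. measure \<mu> {w. \<lfloor>w / \<delta>\<rfloor> = z} * h (idx, r, z)) / real R) / real (card (index_tuples repl K n))"
  proof -
    have ne: "{..<R} \<noteq> {}" using R by (auto simp: lessThan_empty_iff)
    have "(\<integral>w. h (idx, r, \<lfloor>w / \<delta>\<rfloor>) \<partial>\<mu>) = (\<Sum>z\<in>{\<lfloor>- Bw / \<delta>\<rfloor>..\<lfloor>Bw / \<delta>\<rfloor>}. measure \<mu> {w. \<lfloor>w / \<delta>\<rfloor> = z} * h (idx, r, z))" for idx r
      using integral_rounded[OF \<mu> sets AE \<delta>, of "\<lambda>z. h (idx, r, z)"] by simp
    then show ?thesis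
      unfolding P1_def P2_def
      by (simp add: integral_pmf_of_set[OF index_tuples_finite_nonempty(2,1)[OF n]] integral_pmf_of_set[OF ne] sum_divide_distrib)
  qed
  also have "\<dots> = (\<Sum>idx\<in>index_tuples repl K n. \<Sum>s\<in>noise_levels R Bw \<delta>. noise_weight R \<mu> \<delta> s * h (idx, s))
      / real (card (index_tuples repl K n))"
    by (simp add: noise_levels_def noise_weight_def sum.cartesian_product' sum_divide_distrib)
  finally show ?thesis .
qed

definition level_coeff :: "(nat \<Rightarrow> nat \<Rightarrow> real) \<Rightarrow> nat \<times> int \<Rightarrow> nat \<Rightarrow> real" where
  "level_coeff a s = a (fst s)"

definition level_bound :: "(nat \<Rightarrow> real) \<Rightarrow> real \<Rightarrow> nat \<times> int \<Rightarrow> real" where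
  "level_bound b \<delta> s = b (fst s) + \<delta> * real_of_int (snd s)"

lemma sum_mset_map_upt: "(\<Sum>x\<in>#mset (map f [0..<m]). (g x :: real)) = (\<Sum>j<m. g (f j))"
  by (induction m) simp_all

text \<open>
  Rounding down makes each constraint stricter by at most \<open>\<delta>\<close>, so that slacks that are larger by \<open>\<delta>\<close>
  compensate for it.
\<close>

lemma GLP_near_optimum:
  fixes S :: "(nat \<times> int) set"
  assumes lp: "random_lp K S p B1 B2 wx w\<psi>" and \<delta>: "\<delta> > 0"
    and idx: "\<And>j. j < m \<Longrightarrow> length (fst (C j)) = K \<and> set (fst (C j)) \<subseteq> {..<n}"
  shows "\<bar>GLP K a b B1 B2 wx w\<psi> n m C
      - random_lp.optimum K (level_coeff a) (level_bound b \<delta>) B1 B2 wx w\<psi> n (mset (map (\<lambda>j. round_noise \<delta> (C j)) [0..<m]))\<bar>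
    \<le> w\<psi> * (real m * \<delta>)"
proof -
  interpret random_lp K repl S p "level_coeff a" "level_bound b \<delta>" B1 B2 wx w\<psi> for repl by (rule lp)
  define M where "M = mset (map (\<lambda>j. round_noise \<delta> (C j)) [0..<m])"
  define I where "I j = fst (C j)" for j
  define r where "r j = fst (snd (C j))" for j
  define W where "W j = snd (snd (C j))" for j
  define excess where "excess x j = (\<Sum>k<K. a (r j) k * x (I j ! k)) - b (r j) - W j" for x :: "nat \<Rightarrow> real" and j
  define G where "G = {wx * (\<Sum>i<n. x i) + w\<psi> * (\<Sum>j<m. \<psi> j) | x \<psi>. glp_feasible K a b B1 B2 n m C x \<psi>}"
  have feasible: "glp_feasible K a b B1 B2 n m C x \<psi> \<longleftrightarrow>
      (\<forall>i<n. x i \<in> {B1..B2}) \<and> (\<forall>j<m. 0 \<le> \<psi> j \<and> excess x j \<le> \<psi> j)" for x \<psi>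
    by (auto simp: glp_feasible_def excess_def case_prod_unfold r_def I_def W_def algebra_simps)
  define rounded where "rounded x j = (\<Sum>k<K. a (r j) k * x (I j ! k)) - (b (r j) + \<delta> * real_of_int \<lfloor>W j / \<delta>\<rfloor>)"
    for x :: "nat \<Rightarrow> real" and j
  have objective: "objective n M x = wx * (\<Sum>i<n. x i) + w\<psi> * (\<Sum>j<m. max 0 (rounded x j))" for x
  proof -
    have "cost (snd (round_noise \<delta> (C j))) (map x (fst (round_noise \<delta> (C j)))) = w\<psi> * max 0 (rounded x j)" if "j < m" for j
    proof -
      have "(\<Sum>k<K. a (r j) k * map x (I j) ! k) = (\<Sum>k<K. a (r j) k * x (I j ! k))"
        using idx[OF that] by (intro sum.cong refl) (simp add: I_def)
      then show ?thesis
        by (simp add: cost_def round_noise_def case_prod_unfold level_coeff_def level_bound_def rounded_def r_def I_def W_def)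
    qed
    then show ?thesis
      unfolding objective_def M_def sum_mset_map_upt by (simp add: sum_distrib_left)
  qed
  have floor: "\<delta> * real_of_int \<lfloor>W j / \<delta>\<rfloor> \<le> W j" "W j \<le> \<delta> * real_of_int \<lfloor>W j / \<delta>\<rfloor> + \<delta>" for j
  proof -
    have "real_of_int \<lfloor>W j / \<delta>\<rfloor> \<le> W j / \<delta>" "W j / \<delta> \<le> real_of_int \<lfloor>W j / \<delta>\<rfloor> + 1" by linarith+
    from mult_left_mono[OF this(1), of \<delta>] mult_left_mono[OF this(2), of \<delta>]
    show "\<delta> * real_of_int \<lfloor>W j / \<delta>\<rfloor> \<le> W j" "W j \<le> \<delta> * real_of_int \<lfloor>W j / \<delta>\<rfloor> + \<delta>"
      using \<delta> by (simp_all add: distrib_left)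
  qed
  have between: "excess x j \<le> rounded x j" "rounded x j \<le> excess x j + \<delta>" for x j
    using floor[of j] by (auto simp: excess_def rounded_def)
  have lower: "optimum n M - w\<psi> * (real m * \<delta>) \<le> v" if "v \<in> G" for v
  proof -
    obtain x \<psi> where v: "v = wx * (\<Sum>i<n. x i) + w\<psi> * (\<Sum>j<m. \<psi> j)"
      and x: "\<And>i. i < n \<Longrightarrow> x i \<in> {B1..B2}" and \<psi>: "\<And>j. j < m \<Longrightarrow> 0 \<le> \<psi> j \<and> excess x j \<le> \<psi> j"
      using \<open>v \<in> G\<close> by (auto simp: G_def feasible)
    \<comment> \<open>Only the first \<open>n\<close> coordinates of a feasible point are constrained.\<close>
    define y where "y i = (if i < n then x i else B1)" for i
    have "optimum n M \<le> objective n M y"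
      using x B12 by (intro optimum_le) (auto simp: y_def)
    also have "objective n M y \<le> wx * (\<Sum>i<n. x i) + w\<psi> * (\<Sum>j<m. \<psi> j + \<delta>)"
      unfolding objective
    proof (intro add_mono mult_left_mono sum_mono)
      fix j assume j: "j \<in> {..<m}"
      have "(\<Sum>k<K. a (r j) k * y (I j ! k)) = (\<Sum>k<K. a (r j) k * x (I j ! k))"
      proof (intro sum.cong refl)
        fix k assume "k \<in> {..<K}"
        then have "I j ! k \<in> set (I j)" using idx[of j] j by (simp add: I_def)
        then have "I j ! k < n" using idx[of j] j by (auto simp: I_def)
        then show "a (r j) k * y (I j ! k) = a (r j) k * x (I j ! k)" by (simp add: y_def)
      qed
      then have "rounded y j = rounded x j" by (simp add: rounded_def)
      then show "max 0 (rounded y j) \<le> \<psi> j + \<delta>"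
        using \<psi>[of j] between(2)[of x j] j \<delta> by auto
    qed (use wx w\<psi> in \<open>auto simp: y_def\<close>)
    also have "\<dots> = v + w\<psi> * (real m * \<delta>)" by (simp add: v sum.distrib algebra_simps)
    finally show ?thesis by simp
  qed
  have upper: "\<exists>v\<in>G. v \<le> objective n M x" if "\<And>i. x i \<in> {B1..B2}" for x
  proof
    show "wx * (\<Sum>i<n. x i) + w\<psi> * (\<Sum>j<m. max 0 (excess x j)) \<in> G"
      unfolding G_def feasible using that
      by (intro CollectI exI[of _ x] exI[of _ "\<lambda>j. max 0 (excess x j)"]) auto
    show "wx * (\<Sum>i<n. x i) + w\<psi> * (\<Sum>j<m. max 0 (excess x j)) \<le> objective n M x"
      unfolding objective using w\<psi> between(1)
      by (intro add_left_mono mult_left_mono sum_mono max.mono) auto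
  qed
  have "\<exists>v\<in>G. v \<le> objective n M (\<lambda>_. B1)" using B12 by (intro upper) simp
  then have "G \<noteq> {}" by blast
  then have "optimum n M - w\<psi> * (real m * \<delta>) \<le> Inf G"
    by (rule cInf_greatest) (rule lower)
  moreover have "Inf G \<le> optimum n M"
  proof (rule optimum_ge)
    fix x :: "nat \<Rightarrow> real" assume "\<And>i. x i \<in> {B1..B2}"
    from upper[OF this] obtain v where v: "v \<in> G" "v \<le> objective n M x" by (rule bexE)
    have "Inf G \<le> v" using v(1) by (intro cInf_lower bdd_belowI[OF lower])
    with v(2) show "Inf G \<le> objective n M x" by linarith
  qed
  moreover have "w\<psi> * (real m * \<delta>) \<ge> 0" using w\<psi> \<delta> by simp
  ultimately show ?thesis
    unfolding GLP_def G_def[symmetric] M_def[symmetric] by linarith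
qed

section \<open>Convergence in probability\<close>

text \<open>
  Besides the deviations of the rounded optimum, the exceptional set \<open>A\<close> contains the null set of
  instances with invalid constraints. A measurable \<open>A\<close> is what makes two such approximations comparable:
  small measure then guarantees instances outside of it, whereas the value \<open>0\<close> that \<open>measure\<close> assigns to
  a non-measurable set says nothing about its size.
\<close>

lemma rounded_limit:
  fixes K R :: nat and a :: "nat \<Rightarrow> nat \<Rightarrow> real" and b :: "nat \<Rightarrow> real"
    and B1 B2 wx w\<psi> Bw c \<delta> \<epsilon> :: real and \<mu> :: "real measure" and repl :: bool
  assumes K: "K \<ge> 1" and R: "R \<ge> 1" and B: "B1 \<le> B2" and wx: "wx \<ge> 0" and w\<psi>: "w\<psi> > 0"
    and \<mu>: "prob_space \<mu>" and sets: "sets \<mu> = sets borel" and AE: "AE w in \<mu>. w \<in> {-Bw..Bw}"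
    and c: "c \<ge> 0" and \<delta>: "\<delta> > 0" and \<epsilon>: "\<epsilon> > 0"
  defines "m \<equiv> \<lambda>n. nat \<lfloor>c * real n\<rfloor>"
  defines "P \<equiv> \<lambda>n. instance_measure repl K R \<mu> n (m n)"
  shows "\<exists>f A. (wx = 0 \<or> B1 \<ge> 0 \<longrightarrow> f \<ge> 0) \<and> (\<forall>n. A n \<in> sets (P n)) \<and> (\<lambda>n. measure (P n) (A n)) \<longlonglongrightarrow> 0 \<and>
    (\<forall>n>0. \<forall>C\<in>space (P n) - A n. \<bar>GLP K a b B1 B2 wx w\<psi> n (m n) C / real n - f\<bar> \<le> w\<psi> * c * \<delta> + \<epsilon>)"
proof -
  define S where "S = noise_levels R Bw \<delta>"
  define p where "p = noise_weight R \<mu> \<delta>"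
  have model: "sparse_model K S p"
    unfolding S_def p_def by (rule sparse_model_noise[OF K R \<mu> sets AE \<delta>])
  then interpret random_lp K repl S p "level_coeff a" "level_bound b \<delta>" B1 B2 wx w\<psi>
    using B wx w\<psi> by (intro random_lp.intro random_lp_axioms.intro)
  obtain f where f0: "wx = 0 \<or> B1 \<ge> 0 \<longrightarrow> f \<ge> 0"
    and f: "((\<lambda>z. (avg {0..<fst z} ^^ snd z) (\<lambda>M. of_bool (\<bar>optimum (fst z) M / real (fst z) - f\<bar> > \<epsilon>)) {#}) \<longlongrightarrow> 0) (sparse_regime c)"
    using concentration[OF c] \<epsilon> by blast
  define L where "L n C = mset (map (\<lambda>j. round_noise \<delta> (C j)) [0..<m n])" for n and C :: "nat \<Rightarrow> glp_constraint"
  define bad where "bad n M \<longleftrightarrow> \<not> well_formed n M \<or> \<bar>optimum n M / real n - f\<bar> > \<epsilon>" for n M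
  define A where "A n = {C \<in> space (P n). bad n (L n C)}" for n
  have N: "prob_space (constraint_measure repl K R \<mu> n)" for n
    by (rule prob_space_constraint_measure[OF \<mu>])
  have P: "P n = (\<Pi>\<^sub>M j\<in>{..<m n}. constraint_measure repl K R \<mu> n)" for n
    by (simp add: P_def instance_measure_def)
  have meas: "(\<lambda>C. map (\<lambda>j. round_noise \<delta> (C j)) [0..<m n]) \<in> measurable (P n) (count_space UNIV)" for n
    unfolding P by (rule measurable_map_upt[OF measurable_round_noise[OF sets]]) simp
  have A_sets: "A n \<in> sets (P n)" for n
    using measurable_sets[OF meas, of "{l. bad n (mset l)}" n]
    by (simp add: A_def L_def vimage_def Int_def conj_commute)
  have "measure (P n) (A n) = (avg {0..<n} ^^ m n) (\<lambda>M. of_bool (\<bar>optimum n M / real n - f\<bar> > \<epsilon>)) {#}" if n: "K \<le> n" for n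
  proof -
    interpret Pn: prob_space "P n" unfolding P by (intro prob_space_PiM N)
    have "measure (P n) (A n) = (\<integral>C. indicator (A n) C \<partial>P n)"
      using A_sets by simp
    also have "\<dots> = (\<integral>C. of_bool (bad n (L n C)) \<partial>P n)"
      by (intro Bochner_Integration.integral_cong refl) (auto simp: A_def indicator_def)
    also have "\<dots> = (\<integral>C. of_bool (bad n (mset (map (\<lambda>j. round_noise \<delta> (C j)) [0..<m n]) + {#})) \<partial>P n)"
      by (simp add: L_def)
    also have "\<dots> = (avg {0..<n} ^^ m n) (\<lambda>M. of_bool (bad n M)) {#}"
      unfolding P
    proof (rule integral_PiM_eq_avg[OF model N measurable_round_noise[OF sets]])
      fix h :: "nat list \<times> nat \<times> int \<Rightarrow> real" and B assume "\<And>C. \<bar>h C\<bar> \<le> B"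
      then show "(\<integral>C. h (round_noise \<delta> C) \<partial>constraint_measure repl K R \<mu> n)
        = (\<Sum>idx\<in>tuples {0..<n}. \<Sum>s\<in>S. p s * h (idx, s)) / real (card (tuples {0..<n}))"
        unfolding sparse_model_tuples[OF model] S_def p_def
        by (rule integral_round_noise[OF R \<mu> sets AE \<delta> n])
    qed (auto simp: of_bool_def)
    also have "\<dots> = (avg {0..<n} ^^ m n) (\<lambda>M. of_bool (\<bar>optimum n M / real n - f\<bar> > \<epsilon>)) {#}"
    proof (rule avg_funpow_cong[where P = "well_formed n"])
      show "of_bool (bad n M) = (of_bool (\<bar>optimum n M / real n - f\<bar> > \<epsilon>) :: real)" if "well_formed n M" for M
        using that by (simp add: bad_def)
    qed (rule well_formed_add, assumption+, simp add: well_formed_def)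
    finally show ?thesis .
  qed
  then have eq: "\<forall>\<^sub>F n in sequentially. (avg {0..<n} ^^ m n) (\<lambda>M. of_bool (\<bar>optimum n M / real n - f\<bar> > \<epsilon>)) {#} = measure (P n) (A n)"
    by (intro eventually_mono[OF eventually_ge_at_top[of K]]) simp
  have "(\<lambda>n. (avg {0..<n} ^^ m n) (\<lambda>M. of_bool (\<bar>optimum n M / real n - f\<bar> > \<epsilon>)) {#}) \<longlonglongrightarrow> 0"
    using filterlim_compose[OF f filterlim_sparse_floor[OF c]] by (simp add: m_def)
  from Lim_transform_eventually[OF this eq]
  have "(\<lambda>n. measure (P n) (A n)) \<longlonglongrightarrow> 0" .
  moreover have "\<bar>GLP K a b B1 B2 wx w\<psi> n (m n) C / real n - f\<bar> \<le> w\<psi> * c * \<delta> + \<epsilon>"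
    if n: "n > 0" and C: "C \<in> space (P n) - A n" for n C
  proof -
    have good: "well_formed n (L n C)" and close: "\<bar>optimum n (L n C) / real n - f\<bar> \<le> \<epsilon>"
      using C by (auto simp: A_def bad_def)
    have idx: "length (fst (C j)) = K \<and> set (fst (C j)) \<subseteq> {..<n}" if "j < m n" for j
    proof -
      have "round_noise \<delta> (C j) \<in># L n C" using that by (auto simp: L_def)
      moreover have "fst (round_noise \<delta> (C j)) = fst (C j)" by (simp add: round_noise_def case_prod_unfold)
      ultimately show ?thesis using good unfolding well_formed_def by metis
    qed
    have "random_lp K S p B1 B2 wx w\<psi>" by unfold_locales
    from GLP_near_optimum[where m = "m n" and a = a and b = b and C = C, OF this \<delta> idx]
    have "\<bar>GLP K a b B1 B2 wx w\<psi> n (m n) C - optimum n (L n C)\<bar> \<le> w\<psi> * (real (m n) * \<delta>)"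
      by (simp add: L_def)
    then have "\<bar>GLP K a b B1 B2 wx w\<psi> n (m n) C / real n - optimum n (L n C) / real n\<bar> \<le> w\<psi> * (real (m n) * \<delta>) / real n"
      unfolding diff_divide_distrib[symmetric] abs_divide by (simp add: divide_right_mono)
    also have "\<dots> = w\<psi> * (real (m n) / real n) * \<delta>" by simp
    also have "\<dots> \<le> w\<psi> * c * \<delta>"
    proof (intro mult_right_mono mult_left_mono)
      have "real (m n) \<le> c * real n" using c by (simp add: m_def)
      then show "real (m n) / real n \<le> c" using n by (simp add: divide_le_eq)
    qed (use w\<psi> \<delta> in auto)
    finally show ?thesis using close by linarith
  qed
  ultimately show ?thesis using f0 A_sets by blast
qed

theorem theorem1:
  fixes K R :: nat and a :: "nat \<Rightarrow> nat \<Rightarrow> real" and b :: "nat \<Rightarrow> real"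
    and B1 B2 wx w\<psi> Bw c :: real and \<mu> :: "real measure" and repl :: bool
  assumes "K \<ge> 1" and "R \<ge> 1" and "B1 \<le> B2" and "wx \<ge> 0" and "w\<psi> > 0"
    and "prob_space \<mu>" and "sets \<mu> = sets borel" and "AE w in \<mu>. w \<in> {-Bw..Bw}"
    and "c \<ge> 0"
  shows "\<exists>f :: real.
    (wx = 0 \<or> B1 \<ge> 0 \<longrightarrow> f \<ge> 0) \<and>
    (\<forall>\<epsilon>>0. (\<lambda>n. let m = nat \<lfloor>c * real n\<rfloor>; M = instance_measure repl K R \<mu> n m in
        measure M {C \<in> space M. \<bar>GLP K a b B1 B2 wx w\<psi> n m C / real n - f\<bar> > \<epsilon>})
      \<longlonglongrightarrow> 0)"
proof -
  define m where "m n = nat \<lfloor>c * real n\<rfloor>" for n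
  define P where "P n = instance_measure repl K R \<mu> n (m n)" for n
  define g where "g n C = GLP K a b B1 B2 wx w\<psi> n (m n) C / real n" for n C
  \<comment> \<open>The value \<open>l\<close> is a limit in probability up to an error \<open>e\<close>.\<close>
  define near where "near e l \<longleftrightarrow> (\<exists>A. (wx = 0 \<or> B1 \<ge> 0 \<longrightarrow> l \<ge> 0) \<and> (\<forall>n. A n \<in> sets (P n)) \<and>
      (\<lambda>n. measure (P n) (A n)) \<longlonglongrightarrow> 0 \<and> (\<forall>n>0. \<forall>C\<in>space (P n) - A n. \<bar>g n C - l\<bar> \<le> e))" for e l
  have prob: "prob_space (P n)" for n
    unfolding P_def instance_measure_def
    by (intro prob_space_PiM prob_space_constraint_measure assms)
  have ex: "\<exists>l. near e l" if e: "e > 0" for e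
  proof -
    define \<delta> where "\<delta> = e / (2 * (w\<psi> * c + 1))"
    have pos: "w\<psi> * c + 1 > 0" using assms(5,9) by (simp add: add_nonneg_pos)
    then have \<delta>: "\<delta> > 0" using e by (simp add: \<delta>_def)
    have "w\<psi> * c * \<delta> \<le> (w\<psi> * c + 1) * \<delta>" using \<delta> by (simp add: distrib_right)
    also have "\<dots> = e / 2" using pos unfolding \<delta>_def by (metis less_numeral_extra(3) nonzero_mult_divide_mult_cancel_left mult.commute times_divide_eq_right)
    finally have small: "w\<psi> * c * \<delta> + e / 2 \<le> e" by simp
    obtain l A where "wx = 0 \<or> B1 \<ge> 0 \<longrightarrow> l \<ge> 0" "\<forall>n. A n \<in> sets (P n)" "(\<lambda>n. measure (P n) (A n)) \<longlonglongrightarrow> 0"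
      and close: "\<forall>n>0. \<forall>C\<in>space (P n) - A n. \<bar>g n C - l\<bar> \<le> w\<psi> * c * \<delta> + e / 2"
      using rounded_limit[OF assms \<delta> half_gt_zero[OF e], of repl a b] unfolding P_def g_def m_def by blast
    moreover have "\<forall>n>0. \<forall>C\<in>space (P n) - A n. \<bar>g n C - l\<bar> \<le> e"
      using close small by (meson order_trans)
    ultimately show ?thesis unfolding near_def by blast
  qed
  have compatible: "\<bar>l - l'\<bar> \<le> e + e'" if near: "near e l" "near e' l'" for e l e' l'
  proof -
    obtain A where A: "\<And>n. A n \<in> sets (P n)" "(\<lambda>n. measure (P n) (A n)) \<longlonglongrightarrow> 0"
      "\<And>n C. n > 0 \<Longrightarrow> C \<in> space (P n) - A n \<Longrightarrow> \<bar>g n C - l\<bar> \<le> e"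
      using near(1) unfolding near_def by blast
    obtain A' where A': "\<And>n. A' n \<in> sets (P n)" "(\<lambda>n. measure (P n) (A' n)) \<longlonglongrightarrow> 0"
      "\<And>n C. n > 0 \<Longrightarrow> C \<in> space (P n) - A' n \<Longrightarrow> \<bar>g n C - l'\<bar> \<le> e'"
      using near(2) unfolding near_def by blast
    \<comment> \<open>Two exceptional sets of probability below \<open>1/2\<close> leave a common instance on which to compare \<open>l\<close> and \<open>l'\<close>.\<close>
    have "\<forall>\<^sub>F n in sequentially. measure (P n) (A n) < 1/2 \<and> measure (P n) (A' n) < 1/2 \<and> n > 0"
      using A(2) A'(2) by (intro eventually_conj order_tendstoD(2) eventually_gt_at_top) auto
    then obtain n where n: "measure (P n) (A n) < 1/2" "measure (P n) (A' n) < 1/2" "n > 0"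
      using eventually_happens'[OF sequentially_bot] by blast
    interpret Pn: prob_space "P n" by (rule prob)
    have "measure (P n) (A n \<union> A' n) < 1"
      using measure_Un_le[OF A(1) A'(1), of n] n by simp
    then have "A n \<union> A' n \<noteq> space (P n)" using Pn.prob_space by auto
    then obtain C where "C \<in> space (P n)" "C \<notin> A n" "C \<notin> A' n"
      using sets.sets_into_space[OF A(1)] sets.sets_into_space[OF A'(1)] by blast
    then show ?thesis using A(3)[of n C] A'(3)[of n C] n(3) by auto
  qed
  obtain f where f: "\<And>e l. 0 < e \<Longrightarrow> near e l \<Longrightarrow> \<bar>l - f\<bar> \<le> e"
    using ex_common_limit[of near, OF ex compatible] by blast
  have "f \<ge> 0" if "wx = 0 \<or> B1 \<ge> 0"
  proof (rule field_le_epsilon)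
    fix e :: real assume e: "e > 0"
    obtain l where l: "near e l" using ex[OF e] by blast
    then have "l \<ge> 0" using that unfolding near_def by blast
    with f[OF e l] show "0 \<le> f + e" by linarith
  qed
  moreover have "(\<lambda>n. measure (P n) {C \<in> space (P n). \<bar>g n C - f\<bar> > \<epsilon>}) \<longlonglongrightarrow> 0" if \<epsilon>: "\<epsilon> > 0" for \<epsilon>
  proof -
    have e: "\<epsilon> / 2 > 0" using \<epsilon> by simp
    obtain l where l: "near (\<epsilon> / 2) l" using ex[OF e] by blast
    then obtain A where A: "\<And>n. A n \<in> sets (P n)" "(\<lambda>n. measure (P n) (A n)) \<longlonglongrightarrow> 0"
      "\<And>n C. n > 0 \<Longrightarrow> C \<in> space (P n) - A n \<Longrightarrow> \<bar>g n C - l\<bar> \<le> \<epsilon> / 2"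
      unfolding near_def by blast
    have lf: "\<bar>l - f\<bar> \<le> \<epsilon> / 2" by (rule f[OF e l])
    show ?thesis
    proof (rule tendsto_sandwich[OF _ _ tendsto_const A(2)])
      show "\<forall>\<^sub>F n in sequentially. measure (P n) {C \<in> space (P n). \<bar>g n C - f\<bar> > \<epsilon>} \<le> measure (P n) (A n)"
        using eventually_gt_at_top[of 0]
      proof eventually_elim
        case (elim n)
        interpret Pn: prob_space "P n" by (rule prob)
        have "{C \<in> space (P n). \<bar>g n C - f\<bar> > \<epsilon>} \<subseteq> A n"
        proof
          fix C assume C: "C \<in> {C \<in> space (P n). \<bar>g n C - f\<bar> > \<epsilon>}"
          show "C \<in> A n"
          proof (rule ccontr)
            assume "C \<notin> A n"
            then have "\<bar>g n C - l\<bar> \<le> \<epsilon> / 2" using A(3)[OF elim] C by blast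
            moreover have "\<bar>g n C - f\<bar> > \<epsilon>" using C by simp
            ultimately show False using lf by linarith
          qed
        qed
        then show ?case by (rule Pn.finite_measure_mono[OF _ A(1)])
      qed
    qed simp
  qed
  ultimately show ?thesis
    unfolding P_def g_def m_def Let_def by blast
qed

end
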